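(* Let $G$ be a parametric bilinear system given by matrix functions $\mathcal{C},\mathcal{K},\mathcal{B},\mathcal{N}_1,\dots,\mathcal{N}_m$ with structured subsystem transfer functions $G_k$, and let $\widehat G$ be the reduced-order parametric bilinear system obtained by projection with $V,W\in\mathbb{C}^{n\times r}$, with subsystem transfer functions $\widehat G_k$ (see context). Let $k,\theta\ge1$, let $\ell_1,\dots,\ell_k$ and $\nu_1,\dots,\nu_\theta$ be nonnegative integers, and let the matrix functions $\mathcal{C}(s,\mu)$, $\mathcal{K}(s,\mu)^{-1}$, $\mathcal{N}(s,\mu)$, $\mathcal{B}(s,\mu)$ and $\widehat{\mathcal{K}}(s,\mu)^{-1}$ be analytic at given sets of frequency interpolation points $\sigma_1,\dots,\sigma_k\in\mathbb{C}$ and $\varsigma_1,\dots,\varsigma_\theta\in\mathbb{C}$ and the parameter interpolation point $\hat\mu\in\mathbb{M}$. (a) If $V$ is constructed such that $\operatorname{span}(V)$ contains the columns of all $V_{q,j_q}$, $1\le q\le k$, $0\le j_q\le\ell_q$, where $$V_{1,j_1}=\partial_{s^{j_1}}(\mathcal{K}^{-1}\mathcal{B})(\sigma_1,\hat\mu),$$ $$V_{q,j_q}=\partial_{s^{j_q}}\mathcal{K}^{-1}(\sigma_q,\hat\mu)\left(\prod_{j=1}^{q-2}\partial_{s^{\ell_{q-j}}}\big((I_{m^{j-1}}\otimes\mathcal{N})(I_{m^j}\otimes\mathcal{K}^{-1})\big)(\sigma_{q-j},\hat\mu)\right)\partial_{s^{\ell_1}}\big((I_{m^{q-2}}\otimes\mathcal{N})(I_{m^{q-1}}\otimes\mathcal{K}^{-1})(I_{m^{q-1}}\otimes\mathcal{B})\big)(\sigma_1,\hat\mu)$$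 for $2\le q\le k$, then $$\partial_{s_1^{\ell_1}\cdots s_{q-1}^{\ell_{q-1}}s_q^{j_q}}G_q(\sigma_1,\dots,\sigma_q,\hat\mu)=\partial_{s_1^{\ell_1}\cdots s_{q-1}^{\ell_{q-1}}s_q^{j_q}}\widehat G_q(\sigma_1,\dots,\sigma_q,\hat\mu)$$ for $q=1,\dots,k$ and $j_q=0,\dots,\ell_q$. (b) If $W$ is constructed such that $\operatorname{span}(W)$ contains the columns of all $W_{\eta,i_{\theta-\eta+1}}$, $1\le\eta\le\theta$, $0\le i_{\theta-\eta+1}\le\nu_{\theta-\eta+1}$, where $$W_{1,i_\theta}=\partial_{s^{i_\theta}}(\mathcal{K}^{-\mathsf H}\mathcal{C}^{\mathsf H})(\varsigma_\theta,\hat\mu),$$ $$W_{\eta,i_{\theta-\eta+1}}=\partial_{s^{i_{\theta-\eta+1}}}(\mathcal{K}^{-\mathsf H}\widetilde{\mathcal{N}}^{\mathsf H})(\varsigma_{\theta-\eta+1},\hat\mu)\left(\prod_{i=\theta-\eta+2}^{\theta-1}\Big(I_{m^{i-(\theta-\eta)-1}}\otimes\partial_{s^{\nu_i}}(\mathcal{K}^{-\mathsf H}\widetilde{\mathcal{N}}^{\mathsf H})(\varsigma_i,\hat\mu)\Big)\right)\Big(I_{m^{\eta-1}}\otimes\partial_{s^{\nu_\theta}}(\mathcal{K}^{-\mathsf H}\mathcal{C}^{\mathsf H})(\varsigma_\theta,\hat\mu)\Big)$$ for $2\le\eta\le\theta$, then $$\partial_{s_1^{i_{\theta-\eta+1}}s_2^{\nu_{\theta-\eta+2}}\cdots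 s_\eta^{\nu_\theta}}G_\eta(\varsigma_{\theta-\eta+1},\dots,\varsigma_\theta,\hat\mu)=\partial_{s_1^{i_{\theta-\eta+1}}s_2^{\nu_{\theta-\eta+2}}\cdots s_\eta^{\nu_\theta}}\widehat G_\eta(\varsigma_{\theta-\eta+1},\dots,\varsigma_\theta,\hat\mu)$$ for $\eta=1,\dots,\theta$ and $i_{\theta-\eta+1}=0,\dots,\nu_{\theta-\eta+1}$. (c) Let $V$ be constructed as in (a) and $W$ as in (b). Then, in addition to the conditions in (a) and (b), $$\partial_{s_1^{\ell_1}\cdots s_{q-1}^{\ell_{q-1}}s_q^{j_q}s_{q+1}^{i_{\theta-\eta+1}}s_{q+2}^{\nu_{\theta-\eta+2}}\cdots s_{q+\eta}^{\nu_\theta}}G_{q+\eta}(\sigma_1,\dots,\sigma_q,\varsigma_{\theta-\eta+1},\dots,\varsigma_\theta,\hat\mu)$$ $$=\partial_{s_1^{\ell_1}\cdots s_{q-1}^{\ell_{q-1}}s_q^{j_q}s_{q+1}^{i_{\theta-\eta+1}}s_{q+2}^{\nu_{\theta-\eta+2}}\cdots s_{q+\eta}^{\nu_\theta}}\widehat G_{q+\eta}(\sigma_1,\dots,\sigma_q,\varsigma_{\theta-\eta+1},\dots,\varsigma_\theta,\hat\mu)$$ holds for $j_q=0,\dots,\ell_q$; $i_{\theta-\eta+1}=0,\dots,\nu_{\theta-\eta+1}$; $1\le q\le k$ and $1\le\eta\le\theta$.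
   Context: Let $n,m,p,d,r$ be positive integers and $\mathbb{M}\subset\mathbb{R}^d$. A (structured) parametric bilinear system $G$ is described by matrix functions $\mathcal{C}:\mathbb{C}\times\mathbb{M}\to\mathbb{C}^{p\times n}$, $\mathcal{K}:\mathbb{C}\times\mathbb{M}\to\mathbb{C}^{n\times n}$, $\mathcal{B}:\mathbb{C}\times\mathbb{M}\to\mathbb{C}^{n\times m}$, $\mathcal{N}_j:\mathbb{C}\times\mathbb{M}\to\mathbb{C}^{n\times n}$ for $j=1,\dots,m$. Put $\mathcal{N}(s,\mu)=[\mathcal{N}_1(s,\mu),\dots,\mathcal{N}_m(s,\mu)]\in\mathbb{C}^{n\times nm}$ (horizontal concatenation) and let $\widetilde{\mathcal{N}}(s,\mu)\in\mathbb{C}^{nm\times n}$ be the vertical concatenation of $\mathcal{N}_1(s,\mu),\dots,\mathcal{N}_m(s,\mu)$. For $k\ge1$ the $k$-th structured subsystem transfer function is $$G_k(s_1,\dots,s_k,\mu)=\mathcal{C}(s_k,\mu)\mathcal{K}(s_k,\mu)^{-1}\left(\prod_{j=1}^{k-1}(I_{m^{j-1}}\otimes\mathcal{N}(s_{k-j},\mu))(I_{m^j}\otimes\mathcal{K}(s_{k-j},\mu)^{-1})\right)(I_{m^{k-1}}\otimes\mathcal{B}(s_1,\mu)),$$ where matrix products are ordered from left to right with increasing index, an empty product is the identity, $I_\ell$ is the $\ell\times\ell$ identity and $\otimes$ is the Kronecker product. Given $V,W\in\mathbb{C}^{n\times r}$, the reduced-order system $\widehat G$ is given by $\widehat{\mathcal{C}}(s,\mu)=\mathcal{C}(s,\mu)V$,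 $\widehat{\mathcal{K}}(s,\mu)=W^{\mathsf H}\mathcal{K}(s,\mu)V$, $\widehat{\mathcal{B}}(s,\mu)=W^{\mathsf H}\mathcal{B}(s,\mu)$, $\widehat{\mathcal{N}}_j(s,\mu)=W^{\mathsf H}\mathcal{N}_j(s,\mu)V$, $\widehat{\mathcal{N}}=[\widehat{\mathcal{N}}_1,\dots,\widehat{\mathcal{N}}_m]$, and $\widehat G_k$ is defined by the same formula as $G_k$ with all matrix functions replaced by their hatted versions. $\operatorname{span}(X)$ denotes the column space of a matrix $X$; $X^{\mathsf H}$ is the conjugate transpose and $X^{-\mathsf H}=(X^{-1})^{\mathsf H}$. "Analytic at" the interpolation points means that the function is defined and analytic in a neighbourhood of $(s,\hat\mu)$ for $s$ each of the given frequency points (in particular $\mathcal{K}$ and $\widehat{\mathcal{K}}$ are invertible there). $\partial_{s_1^{j_1}\cdots s_k^{j_k}}f(z_1,\dots,z_k)$ denotes the mixed partial derivative of $f$ of order $j_i$ in the variable $s_i$, evaluated at $(z_1,\dots,z_k)$ (order $0$ meaning no differentiation); $\partial_{s^{j}}F(\sigma,\hat\mu)$ is the $j$-th derivative of the matrix function $F(s,\hat\mu)$ with respect to $s$ at $s=\sigma$. For conjugate-transposed functions, the derivative is the conjugate transpose of the derivative: $\partial_{s^i}(\mathcal{K}^{-\mathsf H}\mathcal{C}^{\mathsf H})(\varsigma,\hat\mu):=\big(\partial_{s^i}(\mathcal{C}\mathcal{K}^{-1})(\varsigma,\hat\mu)\big)^{\mathsf H}$ and $\partial_{s^i}(\mathcal{K}^{-\mathsf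 H}\widetilde{\mathcal{N}}^{\mathsf H})(\varsigma,\hat\mu):=\big(\partial_{s^i}(\widetilde{\mathcal{N}}\mathcal{K}^{-1})(\varsigma,\hat\mu)\big)^{\mathsf H}$. *)

theory Defs
  imports
    "HOL-Analysis.Complex_Analysis_Basics"
    "Jordan_Normal_Form.Gauss_Jordan_Elimination"
    "Jordan_Normal_Form.Schur_Decomposition"
    "Jordan_Normal_Form.VS_Connect"
begin

section \<open>Matrices\<close>

definition kron :: "complex mat \<Rightarrow> complex mat \<Rightarrow> complex mat" where
  "kron A B = mat (dim_row A * dim_row B) (dim_col A * dim_col B)
     (\<lambda>(i, j). A $$ (i div dim_row B, j div dim_col B) * B $$ (i mod dim_row B, j mod dim_col B))"

text \<open>The inverse is unspecified for matrices that are not invertible.\<close>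

definition mat_inv :: "complex mat \<Rightarrow> complex mat" where
  "mat_inv A = the (mat_inverse A)"

text \<open>Product from left to right; the first argument is the size of the identity matrix that
  is the value of the empty product.\<close>

definition mat_prod :: "nat \<Rightarrow> complex mat list \<Rightarrow> complex mat" where
  "mat_prod N As = foldl (*) (1\<^sub>m N) As"

definition cols_in_span :: "nat \<Rightarrow> complex mat \<Rightarrow> complex mat \<Rightarrow> bool" where
  "cols_in_span n X V \<longleftrightarrow> set (cols X) \<subseteq> vec_space.col_space n V"

section \<open>Analyticity and derivatives of matrix functions\<close>

definition mat_analytic_at :: "nat \<Rightarrow> nat \<Rightarrow> (complex \<Rightarrow> complex mat) \<Rightarrow> complex \<Rightarrow> bool" where
  "mat_analytic_at nr nc F z \<longleftrightarrow> (\<forall>i<nr. \<forall>j<nc. (\<lambda>s. F s $$ (i, j)) analytic_on {z})"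

text \<open>Since \<^const>\<open>mat_inv\<close> is total, that the pointwise inverse is defined near a point has to
  be demanded separately.\<close>

definition inv_analytic_at :: "nat \<Rightarrow> (complex \<Rightarrow> complex mat) \<Rightarrow> complex \<Rightarrow> bool" where
  "inv_analytic_at N F z \<longleftrightarrow>
     (\<forall>\<^sub>F s in nhds z. invertible_mat (F s)) \<and> mat_analytic_at N N (\<lambda>s. mat_inv (F s)) z"

definition mat_deriv :: "nat \<Rightarrow> (complex \<Rightarrow> complex mat) \<Rightarrow> complex \<Rightarrow> complex mat" where
  "mat_deriv j F z = mat (dim_row (F z)) (dim_col (F z))
     (\<lambda>(a, b). (deriv ^^ j) (\<lambda>s. F s $$ (a, b)) z)"

text \<open>Functions of the variables $s_1, \ldots, s_k$ take a family of type
  \<^typ>\<open>nat \<Rightarrow> complex\<close> of which only the entries at indices $1, \ldots, k$ matter.\<close>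

definition partial_deriv ::
    "nat \<Rightarrow> nat \<Rightarrow> ((nat \<Rightarrow> complex) \<Rightarrow> complex) \<Rightarrow> (nat \<Rightarrow> complex) \<Rightarrow> complex" where
  "partial_deriv i j f z = (deriv ^^ j) (\<lambda>t. f (z(i := t))) (z i)"

definition mixed_deriv :: "nat \<Rightarrow> (nat \<Rightarrow> nat) \<Rightarrow> ((nat \<Rightarrow> complex) \<Rightarrow> complex mat)
    \<Rightarrow> (nat \<Rightarrow> complex) \<Rightarrow> complex mat" where
  "mixed_deriv k js F z = mat (dim_row (F z)) (dim_col (F z))
     (\<lambda>(a, b). foldr (\<lambda>i. partial_deriv i (js i)) [1..<Suc k] (\<lambda>s. F s $$ (a, b)) z)"

section \<open>Structured parametric bilinear systems\<close>

text \<open>\<open>Nfun G j\<close> is relevant for $j = 1, \ldots, m$.\<close>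

record bilinear_system =
  Cfun :: "complex \<Rightarrow> real vec \<Rightarrow> complex mat"
  Kfun :: "complex \<Rightarrow> real vec \<Rightarrow> complex mat"
  Bfun :: "complex \<Rightarrow> real vec \<Rightarrow> complex mat"
  Nfun :: "nat \<Rightarrow> complex \<Rightarrow> real vec \<Rightarrow> complex mat"

definition parametric_bilinear_system ::
    "nat \<Rightarrow> nat \<Rightarrow> nat \<Rightarrow> real vec set \<Rightarrow> bilinear_system \<Rightarrow> bool" where
  "parametric_bilinear_system n m p M G \<longleftrightarrow> (\<forall>s. \<forall>\<mu>\<in>M.
     Cfun G s \<mu> \<in> carrier_mat p n \<and>
     Kfun G s \<mu> \<in> carrier_mat n n \<and>
     Bfun G s \<mu> \<in> carrier_mat n m \<and>
     (\<forall>j\<in>{1..m}. Nfun G j s \<mu> \<in> carrier_mat n n))"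

definition Kinv :: "bilinear_system \<Rightarrow> complex \<Rightarrow> real vec \<Rightarrow> complex mat" where
  "Kinv G s \<mu> = mat_inv (Kfun G s \<mu>)"

definition Nhor :: "nat \<Rightarrow> nat \<Rightarrow> bilinear_system \<Rightarrow> complex \<Rightarrow> real vec \<Rightarrow> complex mat" where
  "Nhor n m G s \<mu> = mat n (n * m) (\<lambda>(a, b). Nfun G (Suc (b div n)) s \<mu> $$ (a, b mod n))"

definition Nver :: "nat \<Rightarrow> nat \<Rightarrow> bilinear_system \<Rightarrow> complex \<Rightarrow> real vec \<Rightarrow> complex mat" where
  "Nver n m G s \<mu> = mat (n * m) n (\<lambda>(a, b). Nfun G (Suc (a div n)) s \<mu> $$ (a mod n, b))"

definition transfer_function ::
    "nat \<Rightarrow> nat \<Rightarrow> bilinear_system \<Rightarrow> nat \<Rightarrow> real vec \<Rightarrow> (nat \<Rightarrow> complex) \<Rightarrow> complex mat" where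
  "transfer_function n m G k \<mu> s =
     Cfun G (s k) \<mu> * Kinv G (s k) \<mu>
     * mat_prod n (map (\<lambda>j. kron (1\<^sub>m (m ^ (j - 1))) (Nhor n m G (s (k - j)) \<mu>)
                          * kron (1\<^sub>m (m ^ j)) (Kinv G (s (k - j)) \<mu>)) [1..<k])
     * kron (1\<^sub>m (m ^ (k - 1))) (Bfun G (s 1) \<mu>)"

definition reduced_system ::
    "complex mat \<Rightarrow> complex mat \<Rightarrow> bilinear_system \<Rightarrow> bilinear_system" where
  "reduced_system V W G = \<lparr>
     Cfun = (\<lambda>s \<mu>. Cfun G s \<mu> * V),
     Kfun = (\<lambda>s \<mu>. mat_adjoint W * Kfun G s \<mu> * V),
     Bfun = (\<lambda>s \<mu>. mat_adjoint W * Bfun G s \<mu>),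
     Nfun = (\<lambda>j s \<mu>. mat_adjoint W * Nfun G j s \<mu> * V) \<rparr>"

section \<open>Projection matrices\<close>

definition Vmat :: "nat \<Rightarrow> nat \<Rightarrow> bilinear_system \<Rightarrow> real vec \<Rightarrow> (nat \<Rightarrow> complex) \<Rightarrow> (nat \<Rightarrow> nat)
    \<Rightarrow> nat \<Rightarrow> nat \<Rightarrow> complex mat" where
  "Vmat n m G \<mu> \<sigma> l q j =
     (if q = 1 then mat_deriv j (\<lambda>s. Kinv G s \<mu> * Bfun G s \<mu>) (\<sigma> 1)
      else mat_deriv j (\<lambda>s. Kinv G s \<mu>) (\<sigma> q)
        * mat_prod n (map (\<lambda>i. mat_deriv (l (q - i))
              (\<lambda>s. kron (1\<^sub>m (m ^ (i - 1))) (Nhor n m G s \<mu>) * kron (1\<^sub>m (m ^ i)) (Kinv G s \<mu>))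
              (\<sigma> (q - i))) [1..<q - 1])
        * mat_deriv (l 1)
            (\<lambda>s. kron (1\<^sub>m (m ^ (q - 2))) (Nhor n m G s \<mu>) * kron (1\<^sub>m (m ^ (q - 1))) (Kinv G s \<mu>)
                 * kron (1\<^sub>m (m ^ (q - 1))) (Bfun G s \<mu>)) (\<sigma> 1))"

text \<open>The derivatives of $K^{-H} C^H$ and $K^{-H} \widetilde{N}^H$ are by convention the conjugate
  transposes of the derivatives of $C K^{-1}$ and $\widetilde{N} K^{-1}$; the functions
  themselves are not holomorphic in $s$.\<close>

definition KC_deriv ::
    "bilinear_system \<Rightarrow> real vec \<Rightarrow> nat \<Rightarrow> complex \<Rightarrow> complex mat" where
  "KC_deriv G \<mu> i z = mat_adjoint (mat_deriv i (\<lambda>s. Cfun G s \<mu> * Kinv G s \<mu>) z)"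

definition KN_deriv ::
    "nat \<Rightarrow> nat \<Rightarrow> bilinear_system \<Rightarrow> real vec \<Rightarrow> nat \<Rightarrow> complex \<Rightarrow> complex mat" where
  "KN_deriv n m G \<mu> i z = mat_adjoint (mat_deriv i (\<lambda>s. Nver n m G s \<mu> * Kinv G s \<mu>) z)"

definition Wmat :: "nat \<Rightarrow> nat \<Rightarrow> bilinear_system \<Rightarrow> real vec \<Rightarrow> nat \<Rightarrow> (nat \<Rightarrow> complex) \<Rightarrow> (nat \<Rightarrow> nat)
    \<Rightarrow> nat \<Rightarrow> nat \<Rightarrow> complex mat" where
  "Wmat n m G \<mu> \<theta> \<tau> \<nu> \<eta> j =
     (if \<eta> = 1 then KC_deriv G \<mu> j (\<tau> \<theta>)
      else KN_deriv n m G \<mu> j (\<tau> (\<theta> - \<eta> + 1))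
        * mat_prod (n * m) (map (\<lambda>i. kron (1\<^sub>m (m ^ (i - (\<theta> - \<eta>) - 1)))
              (KN_deriv n m G \<mu> (\<nu> i) (\<tau> i))) [\<theta> - \<eta> + 2..<\<theta>])
        * kron (1\<^sub>m (m ^ (\<eta> - 1))) (KC_deriv G \<mu> (\<nu> \<theta>) (\<tau> \<theta>)))"

end

theory Submission
  imports Defs "HOL-Complex_Analysis.Complex_Analysis"
begin

text \<open>
  The block columns of the \<open>k\<close>-th transfer function are indexed by words \<open>a\<^sub>1 \<dots> a\<^sub>k\<^sub>-\<^sub>1\<close> over the
  inputs. The block of such a word is the product \<open>C(s\<^sub>k) K(s\<^sub>k)\<^sup>-\<^sup>1 \<cdot> N\<^sub>a K(s\<^sub>k\<^sub>-\<^sub>1)\<^sup>-\<^sup>1 \<cdots> N\<^sub>a' K(s\<^sub>1)\<^sup>-\<^sup>1 B(s\<^sub>1)\<close>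
  with \<open>a = a\<^sub>1, \<dots>, a' = a\<^sub>k\<^sub>-\<^sub>1\<close>, each variable occurring in one factor only. So a mixed derivative is the
  product of the derivatives of the factors, and for every \<open>q\<close> it is a derivative in \<open>s\<^sub>q\<close> of \<open>L K\<^sup>-\<^sup>1 R\<close>,
  where \<open>L\<close> and \<open>R\<close> collect what is left and right of \<open>K(s\<^sub>q)\<^sup>-\<^sup>1\<close>. The blocks of the matrices defining
  \<open>V\<close> are the derivatives of the \<open>K\<^sup>-\<^sup>1 R\<close>, those of the matrices defining \<open>W\<close> the adjoints of the
  derivatives of the \<open>L K\<^sup>-\<^sup>1\<close>.

  The matrix function \<open>P = V (W\<^sup>H K V)\<^sup>-\<^sup>1 W\<^sup>H K\<close> satisfies \<open>P V = V\<close> identically in \<open>s\<close>. Hence, by the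
  Leibniz rule, \<open>P X\<close> and \<open>X\<close> have the same derivatives at every point at which the derivatives of \<open>X\<close>
  have their columns in the span of \<open>V\<close>. For \<open>X = K\<^sup>-\<^sup>1 R\<close> the product \<open>P X\<close> is the counterpart
  \<open>V (W\<^sup>H K V)\<^sup>-\<^sup>1 W\<^sup>H R\<close> of \<open>X\<close> in the reduced system; by induction on the word, the right factor of the
  reduced system is \<open>W\<^sup>H R\<close>, and dually its left factor is \<open>L V\<close>.
\<close>

section \<open>Holomorphic matrix functions\<close>

lemma index_mult_mat_sum:
  assumes "A \<in> carrier_mat a b" "B \<in> carrier_mat b c" "i < a" "j < c"
  shows "(A * B) $$ (i, j) = (\<Sum>k<b. A $$ (i, k) * B $$ (k, j))"
  using assms by (auto simp: scalar_prod_def lessThan_atLeast0)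

text \<open>The dimensions are part of the notion because the type of matrices does not record them,
  and entries beyond them are unspecified.\<close>

definition holo_mat :: "complex set \<Rightarrow> nat \<Rightarrow> nat \<Rightarrow> (complex \<Rightarrow> complex mat) \<Rightarrow> bool" where
  "holo_mat S nr nc F \<longleftrightarrow> (\<forall>s\<in>S. F s \<in> carrier_mat nr nc)
     \<and> (\<forall>i<nr. \<forall>j<nc. (\<lambda>s. F s $$ (i, j)) holomorphic_on S)"

lemma holo_mat_carrier: "holo_mat S nr nc F \<Longrightarrow> s \<in> S \<Longrightarrow> F s \<in> carrier_mat nr nc"
  by (simp add: holo_mat_def)

lemma holo_mat_index:
  "holo_mat S nr nc F \<Longrightarrow> i < nr \<Longrightarrow> j < nc \<Longrightarrow> (\<lambda>s. F s $$ (i, j)) holomorphic_on S"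
  by (simp add: holo_mat_def)

lemma holo_mat_const: "A \<in> carrier_mat nr nc \<Longrightarrow> holo_mat S nr nc (\<lambda>_. A)"
  by (simp add: holo_mat_def)

lemma holo_mat_mult:
  assumes F: "holo_mat S a b F" and G: "holo_mat S b c G"
  shows "holo_mat S a c (\<lambda>s. F s * G s)"
  unfolding holo_mat_def[of S a c]
proof (intro conjI ballI allI impI)
  show "F s * G s \<in> carrier_mat a c" if "s \<in> S" for s
    using holo_mat_carrier[OF F that] holo_mat_carrier[OF G that] by auto
next
  fix i j assume ij: "i < a" "j < c"
  have "(\<lambda>s. \<Sum>k<b. F s $$ (i, k) * G s $$ (k, j)) holomorphic_on S"
    using ij by (intro holomorphic_intros holo_mat_index[OF F] holo_mat_index[OF G]) auto
  moreover have "(F s * G s) $$ (i, j) = (\<Sum>k<b. F s $$ (i, k) * G s $$ (k, j))" if "s \<in> S" for s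
    using index_mult_mat_sum[OF holo_mat_carrier[OF F that] holo_mat_carrier[OF G that] ij] .
  ultimately show "(\<lambda>s. (F s * G s) $$ (i, j)) holomorphic_on S"
    by (simp cong: holomorphic_cong)
qed

section \<open>Entrywise derivatives of matrix functions and the Leibniz rule\<close>

lemma mat_deriv_carrier: "F z \<in> carrier_mat nr nc \<Longrightarrow> mat_deriv j F z \<in> carrier_mat nr nc"
  by (auto simp: mat_deriv_def)

lemma holo_mat_deriv_carrier:
  "holo_mat S nr nc F \<Longrightarrow> z \<in> S \<Longrightarrow> mat_deriv j F z \<in> carrier_mat nr nc"
  by (intro mat_deriv_carrier holo_mat_carrier)

lemma mat_deriv_0: "mat_deriv 0 F z = F z"
  by (auto simp: mat_deriv_def)

lemma index_mat_deriv:
  "F z \<in> carrier_mat nr nc \<Longrightarrow> a < nr \<Longrightarrow> b < nc \<Longrightarrow>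
    mat_deriv j F z $$ (a, b) = (deriv ^^ j) (\<lambda>s. F s $$ (a, b)) z"
  by (auto simp: mat_deriv_def)

lemma mat_deriv_cong:
  assumes "open S" "z \<in> S" "\<And>s. s \<in> S \<Longrightarrow> F s = G s"
  shows "mat_deriv j F z = mat_deriv j G z"
proof -
  have "eventually (\<lambda>s. F s = G s) (nhds z)"
    using assms by (auto simp: eventually_nhds)
  then have "(deriv ^^ j) (\<lambda>s. F s $$ (a, b)) z = (deriv ^^ j) (\<lambda>s. G s $$ (a, b)) z" for a b
    by (intro higher_deriv_cong_ev refl) (auto elim: eventually_mono)
  then show ?thesis
    using assms by (simp add: mat_deriv_def)
qed

lemma higher_deriv_sum:
  fixes f :: "'a \<Rightarrow> complex \<Rightarrow> complex"
  assumes "\<And>i. i \<in> I \<Longrightarrow> f i holomorphic_on S" "open S" "z \<in> S"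
  shows "(deriv ^^ n) (\<lambda>w. \<Sum>i\<in>I. f i w) z = (\<Sum>i\<in>I. (deriv ^^ n) (f i) z)"
  using assms(1)
proof (induction I rule: infinite_finite_induct)
  case (insert i I)
  then show ?case
    using assms(2,3) by (simp add: higher_deriv_add[of _ S] holomorphic_on_sum)
qed auto

text \<open>The Leibniz rule. It is stated for entries because matrices of all dimensions share one
  type, so that a sum of matrices would have no common zero to start from.\<close>

lemma mat_deriv_mult_index:
  assumes S: "open S" "z \<in> S" and F: "holo_mat S a b F" and G: "holo_mat S b c G"
    and xy: "x < a" "y < c"
  shows "mat_deriv j (\<lambda>s. F s * G s) z $$ (x, y)
    = (\<Sum>i\<le>j. of_nat (j choose i) * (mat_deriv i F z * mat_deriv (j - i) G z) $$ (x, y))"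
proof -
  note h = holo_mat_index[OF F xy(1)] holo_mat_index[OF G _ xy(2)]
  have Fz: "F z \<in> carrier_mat a b" and Gz: "G z \<in> carrier_mat b c"
    using holo_mat_carrier[OF F S(2)] holo_mat_carrier[OF G S(2)] .
  have "mat_deriv j (\<lambda>s. F s * G s) z $$ (x, y) = (deriv ^^ j) (\<lambda>s. (F s * G s) $$ (x, y)) z"
    using Fz Gz xy by (intro index_mat_deriv[of _ _ a c]) auto
  also have "\<dots> = (deriv ^^ j) (\<lambda>s. \<Sum>k<b. F s $$ (x, k) * G s $$ (k, y)) z"
    using S xy index_mult_mat_sum[OF holo_mat_carrier[OF F] holo_mat_carrier[OF G]]
    by (intro higher_deriv_cong_ev refl) (auto simp: eventually_nhds intro!: exI[of _ S])
  also have "\<dots> = (\<Sum>k<b. (deriv ^^ j) (\<lambda>s. F s $$ (x, k) * G s $$ (k, y)) z)"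
    using S by (intro higher_deriv_sum[of _ _ S] holomorphic_on_mult h) auto
  also have "\<dots> = (\<Sum>k<b. \<Sum>i\<le>j. of_nat (j choose i)
      * (mat_deriv i F z $$ (x, k) * mat_deriv (j - i) G z $$ (k, y)))"
    using S xy Fz Gz h
    by (intro sum.cong)
      (simp_all add: higher_deriv_mult[of _ S] index_mat_deriv[of _ _ a b] index_mat_deriv[of _ _ b c]
        atMost_atLeast0 mult.assoc)
  also have "\<dots> = (\<Sum>i\<le>j. of_nat (j choose i)
      * (\<Sum>k<b. mat_deriv i F z $$ (x, k) * mat_deriv (j - i) G z $$ (k, y)))"
    by (subst sum.swap) (simp add: sum_distrib_left)
  also have "\<dots> = (\<Sum>i\<le>j. of_nat (j choose i) * (mat_deriv i F z * mat_deriv (j - i) G z) $$ (x, y))"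
    using Fz Gz xy
    by (intro sum.cong refl, subst index_mult_mat_sum[of _ a b _ c]) (auto intro: mat_deriv_carrier)
  finally show ?thesis .
qed

text \<open>Only products of derivatives with orders \<open>i\<close> and \<open>j - i\<close> occur
  in the Leibniz rule, so these may be compared even where the single factors have different
  derivatives.\<close>

lemma mat_deriv_mult_cong:
  assumes S: "open S" "z \<in> S"
    and "holo_mat S a b F" "holo_mat S b c G" "holo_mat S a b' F'" "holo_mat S b' c G'"
    and eq: "\<And>i. i \<le> j \<Longrightarrow>
      mat_deriv i F z * mat_deriv (j - i) G z = mat_deriv i F' z * mat_deriv (j - i) G' z"
  shows "mat_deriv j (\<lambda>s. F s * G s) z = mat_deriv j (\<lambda>s. F' s * G' s) z"
proof -
  let ?L = "mat_deriv j (\<lambda>s. F s * G s) z" and ?R = "mat_deriv j (\<lambda>s. F' s * G' s) z"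
  have c: "?L \<in> carrier_mat a c" "?R \<in> carrier_mat a c"
    by (rule holo_mat_deriv_carrier[OF holo_mat_mult[OF assms(3,4)] S(2)],
        rule holo_mat_deriv_carrier[OF holo_mat_mult[OF assms(5,6)] S(2)])
  have "?L $$ (x, y) = ?R $$ (x, y)" if "x < a" "y < c" for x y
    unfolding mat_deriv_mult_index[OF S assms(3,4) that] mat_deriv_mult_index[OF S assms(5,6) that]
    by (intro sum.cong refl) (simp add: eq)
  then show ?thesis
    using c by (intro eq_matI) auto
qed

lemma mat_deriv_const:
  "A \<in> carrier_mat a b \<Longrightarrow> mat_deriv j (\<lambda>_. A) z = (if j = 0 then A else 0\<^sub>m a b)"
  by (auto simp: mat_deriv_def intro!: eq_matI)

lemma mat_deriv_mult_left:
  assumes S: "open S" "z \<in> S" and A: "A \<in> carrier_mat a b" and F: "holo_mat S b c F"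
  shows "mat_deriv j (\<lambda>s. A * F s) z = A * mat_deriv j F z"
proof (rule eq_matI)
  have Fz: "mat_deriv i F z \<in> carrier_mat b c" "F z \<in> carrier_mat b c" for i
    using holo_mat_deriv_carrier[OF F S(2)] holo_mat_carrier[OF F S(2)] by auto
  then show "dim_row (mat_deriv j (\<lambda>s. A * F s) z) = dim_row (A * mat_deriv j F z)"
    "dim_col (mat_deriv j (\<lambda>s. A * F s) z) = dim_col (A * mat_deriv j F z)"
    using A by (auto simp: mat_deriv_def)
  fix x y assume "x < dim_row (A * mat_deriv j F z)" "y < dim_col (A * mat_deriv j F z)"
  then have xy: "x < a" "y < c" using Fz(1)[of j] A by auto
  have "mat_deriv j (\<lambda>s. A * F s) z $$ (x, y)
    = (\<Sum>i\<le>j. of_nat (j choose i) * (mat_deriv i (\<lambda>_. A) z * mat_deriv (j - i) F z) $$ (x, y))"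
    by (rule mat_deriv_mult_index[OF S _ F xy]) (use A in \<open>rule holo_mat_const\<close>)
  \<comment> \<open>Derivatives of positive order of the constant factor vanish, which leaves the
    summand \<open>i = 0\<close>.\<close>
  also have "\<dots> = (\<Sum>i\<le>j. if i = 0 then (A * mat_deriv j F z) $$ (x, y) else 0)"
    using A Fz xy
    by (intro sum.cong) (auto simp: mat_deriv_const[OF A] left_mult_zero_mat[of _ b c] split: if_splits)
  finally show "mat_deriv j (\<lambda>s. A * F s) z $$ (x, y) = (A * mat_deriv j F z) $$ (x, y)" by simp
qed

lemma mat_deriv_mult_right:
  assumes S: "open S" "z \<in> S" and F: "holo_mat S a b F" and A: "A \<in> carrier_mat b c"
  shows "mat_deriv j (\<lambda>s. F s * A) z = mat_deriv j F z * A"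
proof (rule eq_matI)
  have Fz: "mat_deriv i F z \<in> carrier_mat a b" "F z \<in> carrier_mat a b" for i
    using holo_mat_deriv_carrier[OF F S(2)] holo_mat_carrier[OF F S(2)] by auto
  then show "dim_row (mat_deriv j (\<lambda>s. F s * A) z) = dim_row (mat_deriv j F z * A)"
    "dim_col (mat_deriv j (\<lambda>s. F s * A) z) = dim_col (mat_deriv j F z * A)"
    using A by (auto simp: mat_deriv_def)
  fix x y assume "x < dim_row (mat_deriv j F z * A)" "y < dim_col (mat_deriv j F z * A)"
  then have xy: "x < a" "y < c" using Fz(1)[of j] A by auto
  have "mat_deriv j (\<lambda>s. F s * A) z $$ (x, y)
    = (\<Sum>i\<le>j. of_nat (j choose i) * (mat_deriv i F z * mat_deriv (j - i) (\<lambda>_. A) z) $$ (x, y))"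
    by (rule mat_deriv_mult_index[OF S F _ xy]) (use A in \<open>rule holo_mat_const\<close>)
  also have "\<dots> = (\<Sum>i\<le>j. if i = j then (mat_deriv j F z * A) $$ (x, y) else 0)"
    using A xy
    by (intro sum.cong)
      (auto simp: mat_deriv_const[OF A] right_mult_zero_mat[OF Fz(1)] split: if_splits)
  finally show "mat_deriv j (\<lambda>s. F s * A) z $$ (x, y) = (mat_deriv j F z * A) $$ (x, y)" by simp
qed

text \<open>\<open>F\<close> and \<open>F'\<close> agree on the range of the constant matrix
  \<open>V\<close> throughout \<open>S\<close>, hence so do all their derivatives at
  \<open>z\<close>. In every Leibniz term these derivatives act on a derivative of \<open>X\<close>,
  which lies in that range. This is required of the derivatives of \<open>X\<close> at the single
  point \<open>z\<close>, not of \<open>X\<close> nearby.\<close>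

lemma mat_deriv_mult_eq_on_range:
  assumes S: "open S" "z \<in> S" and F: "holo_mat S a b F" and F': "holo_mat S a b F'"
    and X: "holo_mat S b c X" and V: "V \<in> carrier_mat b r"
    and FV: "\<And>s. s \<in> S \<Longrightarrow> F s * V = F' s * V"
    and range: "\<And>i. i \<le> j \<Longrightarrow> \<exists>Y\<in>carrier_mat r c. mat_deriv i X z = V * Y"
  shows "mat_deriv j (\<lambda>s. F s * X s) z = mat_deriv j (\<lambda>s. F' s * X s) z"
proof (rule mat_deriv_mult_cong[OF S F X F' X])
  fix i assume "i \<le> j"
  obtain Y where Y: "Y \<in> carrier_mat r c" "mat_deriv (j - i) X z = V * Y"
    using range[of "j - i"] by auto
  have c: "mat_deriv i F z \<in> carrier_mat a b" "mat_deriv i F' z \<in> carrier_mat a b"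
    using holo_mat_deriv_carrier[OF F S(2)] holo_mat_deriv_carrier[OF F' S(2)] by auto
  have "mat_deriv i F z * V = mat_deriv i F' z * V"
    using mat_deriv_cong[OF S, of "\<lambda>s. F s * V" "\<lambda>s. F' s * V", OF FV]
    by (simp only: mat_deriv_mult_right[OF S F V] mat_deriv_mult_right[OF S F' V])
  then show "mat_deriv i F z * mat_deriv (j - i) X z = mat_deriv i F' z * mat_deriv (j - i) X z"
    unfolding Y(2) using c V Y(1) by (simp flip: assoc_mult_mat)
qed

text \<open>The mirror image for row spaces. It is proved directly instead of by passing to
  adjoints, since these are not holomorphic in \<open>s\<close>.\<close>

lemma mat_deriv_mult_eq_on_corange:
  assumes S: "open S" "z \<in> S" and F: "holo_mat S b a F" and F': "holo_mat S b a F'"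
    and X: "holo_mat S c b X" and W: "W \<in> carrier_mat r b"
    and WF: "\<And>s. s \<in> S \<Longrightarrow> W * F s = W * F' s"
    and corange: "\<And>i. i \<le> j \<Longrightarrow> \<exists>Y\<in>carrier_mat c r. mat_deriv i X z = Y * W"
  shows "mat_deriv j (\<lambda>s. X s * F s) z = mat_deriv j (\<lambda>s. X s * F' s) z"
proof (rule mat_deriv_mult_cong[OF S X F X F'])
  fix i assume "i \<le> j"
  then obtain Y where Y: "Y \<in> carrier_mat c r" "mat_deriv i X z = Y * W"
    using corange[of i] by auto
  have c: "mat_deriv (j - i) F z \<in> carrier_mat b a" "mat_deriv (j - i) F' z \<in> carrier_mat b a"
    using holo_mat_deriv_carrier[OF F S(2)] holo_mat_deriv_carrier[OF F' S(2)] by auto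
  have "W * mat_deriv (j - i) F z = W * mat_deriv (j - i) F' z"
    using mat_deriv_cong[OF S, of "\<lambda>s. W * F s" "\<lambda>s. W * F' s", OF WF]
    by (simp only: mat_deriv_mult_left[OF S W F] mat_deriv_mult_left[OF S W F'])
  then show "mat_deriv i X z * mat_deriv (j - i) F z = mat_deriv i X z * mat_deriv (j - i) F' z"
    unfolding Y(2) using c W Y(1) by (simp add: assoc_mult_mat)
qed

section \<open>Determinants and inverses of holomorphic matrix functions\<close>

lemma holomorphic_on_det:
  assumes F: "holo_mat S n n F"
  shows "(\<lambda>s. Determinant.det (F s)) holomorphic_on S"
proof -
  have "(\<lambda>s. \<Sum>p\<in>{p. p permutes {0..<n}}. signof p * (\<Prod>i = 0..<n. F s $$ (i, p i))) holomorphic_on S"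
  proof (intro holomorphic_on_sum holomorphic_on_mult holomorphic_on_const holomorphic_on_prod)
    fix p i assume "p \<in> {p. p permutes {0..<n}}" and i: "i \<in> {0..<n}"
    then have "p i < n" using permutes_in_image[of p "{0..<n}" i] by auto
    then show "(\<lambda>s. F s $$ (i, p i)) holomorphic_on S"
      using i by (intro holo_mat_index[OF F]) auto
  qed
  moreover have "Determinant.det (F s) = (\<Sum>p\<in>{p. p permutes {0..<n}}. signof p * (\<Prod>i = 0..<n. F s $$ (i, p i)))"
    if "s \<in> S" for s
    by (rule det_def'[OF holo_mat_carrier[OF F that]])
  ultimately show ?thesis by (simp cong: holomorphic_cong)
qed

lemma holo_mat_delete:
  assumes F: "holo_mat S n n F" and ij: "i < n" "j < n"
  shows "holo_mat S (n - 1) (n - 1) (\<lambda>s. mat_delete (F s) i j)"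
  unfolding holo_mat_def
proof (intro conjI ballI allI impI)
  show "mat_delete (F s) i j \<in> carrier_mat (n - 1) (n - 1)" if "s \<in> S" for s
    using holo_mat_carrier[OF F that] by (rule mat_delete_carrier)
  fix x y assume xy: "x < n - 1" "y < n - 1"
  have "mat_delete (F s) i j $$ (x, y) = F s $$ (insert_index i x, insert_index j y)" if "s \<in> S" for s
    using mat_delete_index[of "F s" "n - 1" i j x y] holo_mat_carrier[OF F that] ij xy by auto
  moreover have "(\<lambda>s. F s $$ (insert_index i x, insert_index j y)) holomorphic_on S"
    using xy by (intro holo_mat_index[OF F]) (auto simp: insert_index_def)
  ultimately show "(\<lambda>s. mat_delete (F s) i j $$ (x, y)) holomorphic_on S"
    by (simp cong: holomorphic_cong)
qed

text \<open>Cramer's rule: the entries of \<open>K s\<close> are cofactors of \<open>F s\<close>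
  divided by its determinant, which has no zero on \<open>S\<close>. This yields holomorphy of a
  matrix function from that of its inverse.\<close>

lemma holo_mat_inverse:
  assumes F: "holo_mat S n n F" and K: "\<And>s. s \<in> S \<Longrightarrow> K s \<in> carrier_mat n n"
    and KF: "\<And>s. s \<in> S \<Longrightarrow> K s * F s = 1\<^sub>m n"
  shows "holo_mat S n n K"
  unfolding holo_mat_def
proof (intro conjI ballI allI impI)
  fix i j assume ij: "i < n" "j < n"
  have det: "Determinant.det (F s) \<noteq> 0" if "s \<in> S" for s
    using det_mult[OF K[OF that] holo_mat_carrier[OF F that]] KF[OF that] by auto
  have "K s $$ (i, j) = (-1) ^ (j + i) * Determinant.det (mat_delete (F s) j i) / Determinant.det (F s)" if s: "s \<in> S" for s
  proof -
    note Fs = holo_mat_carrier[OF F s]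
    note adj = adj_mat[OF Fs]
    have "adj_mat (F s) = K s * (F s * adj_mat (F s))"
      using assoc_mult_mat[OF K[OF s] Fs adj(1)] KF[OF s] adj(1) by simp
    also have "\<dots> = Determinant.det (F s) \<cdot>\<^sub>m K s"
      using K[OF s] adj(2) by (simp add: mult_smult_distrib[of _ n n _ n])
    finally have "adj_mat (F s) $$ (i, j) = Determinant.det (F s) * K s $$ (i, j)"
      using K[OF s] ij by simp
    then show ?thesis
      using det[OF s] Fs ij by (simp add: adj_mat_def cofactor_def field_simps)
  qed
  moreover have "(\<lambda>s. (-1) ^ (j + i) * Determinant.det (mat_delete (F s) j i) / Determinant.det (F s)) holomorphic_on S"
    using ij det
    by (intro holomorphic_intros holomorphic_on_det[OF F] holomorphic_on_det[OF holo_mat_delete[OF F]]) auto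
  ultimately show "(\<lambda>s. K s $$ (i, j)) holomorphic_on S"
    by (simp cong: holomorphic_cong)
qed (rule K)

text \<open>A function holomorphic on an open set is analytic at each of its points. With the next
  two lemmas this makes the set of all points that satisfy the analyticity hypotheses one open
  domain, shared by all interpolation points.\<close>

lemma open_analytic_at: "open {s. f analytic_on {s}}"
proof (subst open_subopen, intro ballI)
  fix s assume "s \<in> {s. f analytic_on {s}}"
  then obtain T where "open T" "s \<in> T" "f holomorphic_on T" by (auto simp: analytic_at)
  then show "\<exists>T. open T \<and> s \<in> T \<and> T \<subseteq> {s. f analytic_on {s}}"
    by (intro exI[of _ T]) (auto simp: analytic_at)
qed

lemma open_mat_analytic_at: "open {s. mat_analytic_at nr nc F s}"
proof -
  have "{s. mat_analytic_at nr nc F s}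
      = (\<Inter>i\<in>{..<nr}. \<Inter>j\<in>{..<nc}. {s. (\<lambda>s. F s $$ (i, j)) analytic_on {s}})"
    by (auto simp: mat_analytic_at_def)
  then show ?thesis by (auto intro!: open_INT open_analytic_at)
qed

lemma open_inv_analytic_at: "open {s. inv_analytic_at n F s}"
proof -
  have "open {s. \<forall>\<^sub>F t in nhds s. P t}" for P :: "complex \<Rightarrow> bool"
    by (subst open_subopen) (auto simp: eventually_nhds)
  then show ?thesis
    unfolding inv_analytic_at_def Collect_conj_eq by (intro open_Int open_mat_analytic_at)
qed

lemma holo_mat_analytic_at:
  assumes "\<And>s. s \<in> S \<Longrightarrow> F s \<in> carrier_mat nr nc" "\<And>s. s \<in> S \<Longrightarrow> mat_analytic_at nr nc F s"
  shows "holo_mat S nr nc F"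
  using assms unfolding holo_mat_def mat_analytic_at_def
  by (meson analytic_imp_holomorphic analytic_on_analytic_at)

lemma mat_inv:
  assumes A: "A \<in> carrier_mat n n" and inv: "invertible_mat A"
  shows "mat_inv A \<in> carrier_mat n n" "A * mat_inv A = 1\<^sub>m n" "mat_inv A * A = 1\<^sub>m n"
proof -
  obtain B where B: "A * B = 1\<^sub>m n" "B * A = 1\<^sub>m (dim_row B)"
    using inv A by (auto simp: invertible_mat_def inverts_mat_def)
  \<comment> \<open>The dimensions of \<open>B\<close> are not given in advance; comparing column
    numbers in both equations forces them.\<close>
  have "dim_col B = n" "dim_row B = n"
    using arg_cong[OF B(1), of dim_col] arg_cong[OF B(2), of dim_col] A by auto
  then have "B \<in> carrier_mat n n" by auto
  with A B have "A \<in> Units (ring_mat TYPE(complex) n ())"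
    by (auto simp: Units_def ring_mat_def)
  then obtain B' where "mat_inverse A = Some B'"
    using mat_inverse(1)[OF A, of "()"] by (cases "mat_inverse A") auto
  then show "mat_inv A \<in> carrier_mat n n" "A * mat_inv A = 1\<^sub>m n" "mat_inv A * A = 1\<^sub>m n"
    using mat_inverse(2)[OF A] by (auto simp: mat_inv_def)
qed

section \<open>Kronecker products and words\<close>

text \<open>The column block with number \<open>e\<close>, counted from 0. Kronecker products with
  an identity on the left act on such blocks separately, so that equations between transfer
  functions can be checked word by word.\<close>

definition blk :: "nat \<Rightarrow> nat \<Rightarrow> 'a mat \<Rightarrow> 'a mat" where
  "blk c e A = mat (dim_row A) c (\<lambda>(x, y). A $$ (x, e * c + y))"

lemma blk_carrier [simp]: "A \<in> carrier_mat r k \<Longrightarrow> blk c e A \<in> carrier_mat r c"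
  by (simp add: blk_def)

lemma index_blk: "A \<in> carrier_mat r k \<Longrightarrow> x < r \<Longrightarrow> y < c \<Longrightarrow> blk c e A $$ (x, y) = A $$ (x, e * c + y)"
  by (simp add: blk_def)

lemma block_index_less: "e < E \<Longrightarrow> y < c \<Longrightarrow> e * c + y < E * (c :: nat)"
  by (metis add.commute mult_Suc less_eq_Suc_le mult_le_mono1 nat_add_left_cancel_less order_less_le_trans)

lemma blk_eqI:
  assumes A: "A \<in> carrier_mat r (E * c)" and B: "B \<in> carrier_mat r (E * c)"
    and eq: "\<And>e. e < E \<Longrightarrow> blk c e A = blk c e B"
  shows "A = B"
proof (rule eq_matI)
  fix x y assume "x < dim_row B" "y < dim_col B"
  then have xy: "x < r" "y < E * c" using B by auto
  then have c: "c > 0" by (cases c) auto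
  from xy(2) have e: "y div c < E" by (simp add: less_mult_imp_div_less)
  have "A $$ (x, y div c * c + y mod c) = B $$ (x, y div c * c + y mod c)"
    using arg_cong[OF eq[OF e], of "\<lambda>M. M $$ (x, y mod c)"] xy(1) c A B
    by (simp add: index_blk)
  then show "A $$ (x, y) = B $$ (x, y)" by simp
qed (use A B in auto)

lemma blk_mult_left:
  assumes A: "A \<in> carrier_mat r k" and B: "B \<in> carrier_mat k (E * c)" and e: "e < E"
  shows "blk c e (A * B) = A * blk c e B"
  using assms by (intro eq_matI) (auto simp: index_blk[of _ r "E * c"] index_mult_mat_sum[of _ r k _ "E * c"]
      index_mult_mat_sum[of A r k _ c] index_blk[of B k "E * c"] block_index_less blk_def scalar_prod_def)

lemma blk_one_block: "A \<in> carrier_mat r c \<Longrightarrow> blk c 0 A = A"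
  by (auto simp: blk_def)

lemma kron_carrier [simp]:
  "A \<in> carrier_mat a b \<Longrightarrow> B \<in> carrier_mat c d \<Longrightarrow> kron A B \<in> carrier_mat (a * c) (b * d)"
  by (auto simp: kron_def)

lemma div_mod_block:
  "y < c \<Longrightarrow> (e * c + y) div c = e" "y < c \<Longrightarrow> (e * c + y) mod c = (y :: nat)"
  by auto

text \<open>\<open>kron (1\<^sub>m E) A\<close> is block diagonal with \<open>E\<close> copies of
  \<open>A\<close>. A column block inside the \<open>e\<close>-th copy therefore meets only block
  \<open>e\<close> of \<open>X\<close>, and \<open>e * u + i\<close> is the number of sub-block
  \<open>i\<close> of that copy.\<close>

lemma blk_mult_kron_one:
  assumes X: "X \<in> carrier_mat r (E * n)" and A: "A \<in> carrier_mat n (u * c)"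
    and e: "e < E" and i: "i < u"
  shows "blk c (e * u + i) (X * kron (1\<^sub>m E) A) = blk n e X * blk c i A"
proof (rule eq_matI)
  have K: "kron (1\<^sub>m E) A \<in> carrier_mat (E * n) (E * (u * c))"
    using A by (intro kron_carrier) auto
  fix x y assume "x < dim_row (blk n e X * blk c i A)" "y < dim_col (blk n e X * blk c i A)"
  then have x: "x < r" and y: "y < c" using X A by (auto simp: blk_def)
  have iy: "i * c + y < u * c" using i y by (rule block_index_less)
  have eiy: "e * (u * c) + (i * c + y) < E * (u * c)" using e iy by (rule block_index_less)
  have "blk c (e * u + i) (X * kron (1\<^sub>m E) A) $$ (x, y)
      = (X * kron (1\<^sub>m E) A) $$ (x, e * (u * c) + (i * c + y))"
    using X K x y by (subst index_blk[of _ r "E * (u * c)"]) (auto simp: algebra_simps)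
  also have "\<dots> = (\<Sum>k<E * n. X $$ (x, k) * kron (1\<^sub>m E) A $$ (k, e * (u * c) + (i * c + y)))"
    using X K x eiy by (rule index_mult_mat_sum)
  \<comment> \<open>The identity matrix vanishes off the diagonal, so only the rows of the
    \<open>e\<close>-th copy contribute.\<close>
  also have "\<dots> = (\<Sum>k<E * n. if k div n = e then X $$ (x, k) * A $$ (k mod n, i * c + y) else 0)"
    using A e eiy iy
    by (intro sum.cong refl) (auto simp: kron_def div_mod_block less_mult_imp_div_less)
  also have "\<dots> = (\<Sum>k\<in>{k. k < E * n \<and> k div n = e}. X $$ (x, k) * A $$ (k mod n, i * c + y))"
    by (simp add: sum.inter_filter[symmetric])
  also have "{k. k < E * n \<and> k div n = e} = (\<lambda>k. e * n + k) ` {..<n}"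
  proof (intro equalityI subsetI)
    fix k assume k: "k \<in> {k. k < E * n \<and> k div n = e}"
    then have "n > 0" by (cases n) auto
    with k show "k \<in> (\<lambda>k. e * n + k) ` {..<n}"
      by (intro image_eqI[of _ _ "k mod n"]) auto
  qed (use e in \<open>auto intro: block_index_less\<close>)
  also have "(\<Sum>k\<in>(\<lambda>k. e * n + k) ` {..<n}. X $$ (x, k) * A $$ (k mod n, i * c + y))
      = (\<Sum>k<n. X $$ (x, e * n + k) * A $$ (k, i * c + y))"
    by (subst sum.reindex) (auto simp: inj_on_def)
  also have "\<dots> = (\<Sum>k<n. blk n e X $$ (x, k) * blk c i A $$ (k, y))"
    using X A x y by (intro sum.cong refl) (simp add: index_blk[of X r "E * n"] index_blk[of A n "u * c"])
  also have "\<dots> = (blk n e X * blk c i A) $$ (x, y)"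
    using X A x y by (intro index_mult_mat_sum[symmetric, of _ r n _ c]) auto
  finally show "blk c (e * u + i) (X * kron (1\<^sub>m E) A) $$ (x, y) = (blk n e X * blk c i A) $$ (x, y)" .
qed (use X A in \<open>auto simp: blk_def\<close>)

text \<open>With start value 0 this reads the word as a numeral in base \<open>m\<close>, most
  significant digit first. The start value is the block number reached so far: each further
  Kronecker factor splits every block into \<open>m\<close> blocks.\<close>

fun word_index :: "nat \<Rightarrow> nat \<Rightarrow> nat list \<Rightarrow> nat" where
  "word_index m e [] = e"
| "word_index m e (j # w) = word_index m (e * m + j) w"

lemma word_index_less:
  "e < E \<Longrightarrow> set w \<subseteq> {..<m} \<Longrightarrow> word_index m e w < E * m ^ length w"
proof (induction w arbitrary: e E)
  case (Cons j w)
  then have "e * m + j < E * m" by (intro block_index_less) auto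
  from Cons.IH[OF this] Cons.prems show ?case by (simp add: mult.assoc)
qed simp

text \<open>Every block number belongs to a word, so equality of the blocks of all words gives
  equality of matrices. In the induction the quotient and the remainder of the start value obtained
  for \<open>E * m\<close> become the new start value and the first letter.\<close>

lemma word_index_surj:
  assumes "f < E * m ^ T"
  obtains e w where "e < E" "length w = T" "set w \<subseteq> {..<m}" "f = word_index m e w"
  using assms
proof (induction T arbitrary: E thesis)
  case (Suc T)
  then obtain e w where w: "e < E * m" "length w = T" "set w \<subseteq> {..<m}" "f = word_index m e w"
    by (metis mult.assoc power_Suc)
  then have "m > 0" by (cases m) auto
  with w show ?case
    by (intro Suc.prems(1)[of "e div m" "(e mod m) # w"]) (auto simp: less_mult_imp_div_less)
qed (use that[of f "[]"] in auto)

lemma word_index_append: "word_index m e (w @ [j]) = word_index m e w * m + j"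
  by (induction w arbitrary: e) auto

text \<open>The position passed to \<open>D\<close> is the number of letters still to come, so
  factors are numbered from the right end, like the variables of a transfer function. The
  accumulator nests products to the left, as \<open>foldl\<close> does in
  \<open>mat_prod\<close>.\<close>

fun word_prod :: "(nat \<Rightarrow> nat \<Rightarrow> complex mat) \<Rightarrow> complex mat \<Rightarrow> nat list \<Rightarrow> complex mat" where
  "word_prod D A [] = A"
| "word_prod D A (j # w) = word_prod D (A * D (length w) j) w"

lemma word_prod_mult_left:
  assumes "A \<in> carrier_mat a r" "B \<in> carrier_mat r n"
    "\<And>t j. t < length w \<Longrightarrow> j \<in> set w \<Longrightarrow> D t j \<in> carrier_mat n n"
  shows "word_prod D (A * B) w = A * word_prod D B w"
  using assms
proof (induction w arbitrary: B)
  case (Cons j w)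
  then have D: "D (length w) j \<in> carrier_mat n n" by auto
  have "word_prod D (A * (B * D (length w) j)) w = A * word_prod D (B * D (length w) j) w"
    using Cons D by auto
  then show ?case using Cons.prems D by (simp add: assoc_mult_mat[of A a r B n _ n])
qed simp

text \<open>Each factor splits the blocks present into \<open>m\<close> new ones and appends a
  letter to their words, so the block of a word is the product of one block from every factor. In
  the induction \<open>E\<close> and \<open>e\<close> become \<open>E * m\<close> and
  \<open>e * m + j\<close>. The start is \<open>E = 1\<close> for the transfer functions and for
  \<open>V\<close>, but \<open>E = m\<close> for \<open>W\<close>, where one letter has been read
  before.\<close>

lemma blk_foldl_kron:
  assumes "X \<in> carrier_mat r (E * n)" "e < E" "set w \<subseteq> {..<m}"
    and "\<And>i. i \<in> {a..<a + length w} \<Longrightarrow> A i \<in> carrier_mat n (m * n)"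
    and "\<And>i. i \<in> {a..<a + length w} \<Longrightarrow> F i = kron (1\<^sub>m (E * m ^ (i - a))) (A i)"
    and "\<And>i j. i \<in> {a..<a + length w} \<Longrightarrow> j < m \<Longrightarrow> blk n j (A i) = D (a + length w - Suc i) j"
  shows "foldl (*) X (map F [a..<a + length w]) \<in> carrier_mat r (E * m ^ length w * n) \<and>
    blk n (word_index m e w) (foldl (*) X (map F [a..<a + length w])) = word_prod D (blk n e X) w"
  using assms
proof (induction w arbitrary: X E e a)
  case (Cons j w)
  have A: "A a \<in> carrier_mat n (m * n)" and F: "F a = kron (1\<^sub>m E) (A a)"
    using Cons.prems(4)[of a] Cons.prems(5)[of a] by auto
  have j: "j < m" using Cons.prems by auto
  have K: "kron (1\<^sub>m E) (A a) \<in> carrier_mat (E * n) (E * (m * n))"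
    using A by (intro kron_carrier) auto
  have XF: "X * F a \<in> carrier_mat r (E * m * n)"
    using mult_carrier_mat[OF Cons.prems(1) K] F by (simp add: mult.assoc)
  have 1: "blk n (e * m + j) (X * F a) = blk n e X * D (length w) j"
    using blk_mult_kron_one[OF Cons.prems(1) A Cons.prems(2) j] Cons.prems(6)[of a j] F j by simp
  have "foldl (*) (X * F a) (map F [Suc a..<Suc a + length w])
        \<in> carrier_mat r (E * m * m ^ length w * n) \<and>
      blk n (word_index m (e * m + j) w) (foldl (*) (X * F a) (map F [Suc a..<Suc a + length w]))
        = word_prod D (blk n (e * m + j) (X * F a)) w"
  proof (rule Cons.IH[OF XF])
    show "e * m + j < E * m" using Cons.prems(2) j by (rule block_index_less)
    show "set w \<subseteq> {..<m}" using Cons.prems(3) by auto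
    fix i assume i: "i \<in> {Suc a..<Suc a + length w}"
    then show "A i \<in> carrier_mat n (m * n)" using Cons.prems(4)[of i] by auto
    have "m ^ (i - a) = m * m ^ (i - Suc a)" using i by (auto simp flip: power_Suc simp: Suc_diff_Suc)
    then show "F i = kron (1\<^sub>m (E * m * m ^ (i - Suc a))) (A i)"
      using i Cons.prems(5)[of i] by (simp add: mult.assoc)
    show "blk n k (A i) = D (Suc a + length w - Suc i) k" if "k < m" for k
      using i Cons.prems(6)[of i k] that by simp
  qed
  moreover have "[a..<a + length (j # w)] = a # [Suc a..<Suc a + length w]"
    using upt_conv_Cons[of a "a + length (j # w)"] by simp
  ultimately show ?case by (simp add: 1 mult.assoc)
qed (auto simp del: upt_Suc)

section \<open>Adjoints and column spans\<close>

lemma mat_adjoint_carrier: "A \<in> carrier_mat a b \<Longrightarrow> mat_adjoint A \<in> carrier_mat b a"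
  by (auto simp: mat_adjoint_def)

lemma index_mat_adjoint:
  "A \<in> carrier_mat a b \<Longrightarrow> x < b \<Longrightarrow> y < a \<Longrightarrow> mat_adjoint A $$ (x, y) = conjugate (A $$ (y, x))"
  by (auto simp: mat_adjoint_def mat_of_rows_def)

lemma mat_adjoint_adjoint: "mat_adjoint (mat_adjoint A) = (A :: complex mat)"
  by (rule eq_matI) (auto simp: mat_adjoint_def mat_of_rows_def)

lemma mat_adjoint_mult:
  fixes A :: "complex mat"
  assumes "A \<in> carrier_mat a b" "B \<in> carrier_mat b c"
  shows "mat_adjoint (A * B) = mat_adjoint B * mat_adjoint A"
proof (rule eq_matI)
  have c: "mat_adjoint B * mat_adjoint A \<in> carrier_mat c a" "mat_adjoint (A * B) \<in> carrier_mat c a"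
    using assms by (auto intro!: mult_carrier_mat mat_adjoint_carrier)
  then show "dim_row (mat_adjoint (A * B)) = dim_row (mat_adjoint B * mat_adjoint A)"
    "dim_col (mat_adjoint (A * B)) = dim_col (mat_adjoint B * mat_adjoint A)" by auto
  fix x y assume "x < dim_row (mat_adjoint B * mat_adjoint A)" "y < dim_col (mat_adjoint B * mat_adjoint A)"
  then have xy: "x < c" "y < a" using c by auto
  have "mat_adjoint (A * B) $$ (x, y) = cnj ((A * B) $$ (y, x))"
    using assms xy by (subst index_mat_adjoint[of _ a c]) auto
  also have "\<dots> = (\<Sum>k<b. cnj (A $$ (y, k)) * cnj (B $$ (k, x)))"
    using assms xy by (subst index_mult_mat_sum[of _ a b _ c]) auto
  also have "\<dots> = (\<Sum>k<b. mat_adjoint B $$ (x, k) * mat_adjoint A $$ (k, y))"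
    using assms xy by (intro sum.cong) (auto simp: index_mat_adjoint[of A a b] index_mat_adjoint[of B b c])
  also have "\<dots> = (mat_adjoint B * mat_adjoint A) $$ (x, y)"
    using assms xy by (intro index_mult_mat_sum[symmetric] mat_adjoint_carrier)
  finally show "mat_adjoint (A * B) $$ (x, y) = (mat_adjoint B * mat_adjoint A) $$ (x, y)" .
qed

text \<open>Each column of \<open>X\<close> has a coefficient vector with respect to
  \<open>V\<close>; these vectors are the columns of \<open>Y\<close>.\<close>

lemma cols_in_span_factor:
  assumes X: "X \<in> carrier_mat n c" and V: "V \<in> carrier_mat n r" and span: "cols_in_span n X V"
  shows "\<exists>Y\<in>carrier_mat r c. X = V * Y"
proof -
  interpret vec_space "TYPE(complex)" n .
  have "\<exists>v\<in>carrier_vec r. col X i = V *\<^sub>v v" if "i < c" for i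
  proof -
    have "col X i \<in> set (cols X)" using that X by (auto simp: cols_def)
    then have "\<exists>v\<in>carrier_vec r. V *\<^sub>v v = col X i"
      using span col_space_eq[OF V] V unfolding cols_in_span_def by auto
    then show ?thesis by metis
  qed
  then obtain v where v: "\<And>i. i < c \<Longrightarrow> v i \<in> carrier_vec r \<and> col X i = V *\<^sub>v v i"
    by metis
  define Y where "Y = mat_of_cols r (map v [0..<c])"
  have Y: "Y \<in> carrier_mat r c" using mat_of_cols_carrier(1)[of r "map v [0..<c]"] by (simp add: Y_def)
  moreover have "X = V * Y"
  proof (rule mat_col_eqI)
    fix i assume "i < dim_col (V * Y)"
    then have i: "i < c" using Y by simp
    then have "col Y i = v i" using v by (simp add: Y_def)
    then show "col X i = col (V * Y) i" using v[OF i] i by (simp add: col_mult2[OF V Y i])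
  qed (use X V Y in auto)
  ultimately show ?thesis by blast
qed

lemma cols_in_span_blk:
  assumes X: "X \<in> carrier_mat n (E * c)" and e: "e < E" and span: "cols_in_span n X V"
  shows "cols_in_span n (blk c e X) V"
proof -
  have "col (blk c e X) y = col X (e * c + y)" if "y < c" for y
    using that X block_index_less[OF e that] by (intro eq_vecI) (auto simp: blk_def)
  then have "set (cols (blk c e X)) \<subseteq> set (cols X)"
    using X block_index_less[OF e] by (auto simp: cols_def blk_def)
  then show ?thesis using span by (auto simp: cols_in_span_def)
qed

section \<open>Kronecker products and blocks under differentiation\<close>

lemma mat_deriv_kron_one:
  assumes S: "open S" "z \<in> S" and F: "\<And>s. s \<in> S \<Longrightarrow> F s \<in> carrier_mat a b"
  shows "mat_deriv j (\<lambda>s. kron (1\<^sub>m E) (F s)) z = kron (1\<^sub>m E) (mat_deriv j F z)"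
proof (rule eq_matI)
  have Fz: "F z \<in> carrier_mat a b" "mat_deriv j F z \<in> carrier_mat a b"
    using F S by (auto intro!: mat_deriv_carrier)
  then show "dim_row (mat_deriv j (\<lambda>s. kron (1\<^sub>m E) (F s)) z) = dim_row (kron (1\<^sub>m E) (mat_deriv j F z))"
    "dim_col (mat_deriv j (\<lambda>s. kron (1\<^sub>m E) (F s)) z) = dim_col (kron (1\<^sub>m E) (mat_deriv j F z))"
    by (auto simp: mat_deriv_def kron_def)
  fix x y assume "x < dim_row (kron (1\<^sub>m E) (mat_deriv j F z))" "y < dim_col (kron (1\<^sub>m E) (mat_deriv j F z))"
  then have xy: "x < E * a" "y < E * b" using Fz by (auto simp: kron_def)
  then have "a > 0" "b > 0" by (cases a; auto) (cases b; use xy in auto)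
  with xy have l: "x div a < E" "y div b < E" "x mod a < a" "y mod b < b"
    by (auto simp: less_mult_imp_div_less)
  have ev: "eventually (\<lambda>s. kron (1\<^sub>m E) (F s) $$ (x, y)
     = (if x div a = y div b then F s $$ (x mod a, y mod b) else 0)) (nhds z)"
    unfolding eventually_nhds
  proof (intro exI[of _ S] conjI ballI S)
    fix s assume "s \<in> S"
    then have "F s \<in> carrier_mat a b" by (rule F)
    then show "kron (1\<^sub>m E) (F s) $$ (x, y)
     = (if x div a = y div b then F s $$ (x mod a, y mod b) else 0)"
      using xy l by (auto simp: kron_def)
  qed
  have "mat_deriv j (\<lambda>s. kron (1\<^sub>m E) (F s)) z $$ (x, y)
    = (deriv ^^ j) (\<lambda>s. kron (1\<^sub>m E) (F s) $$ (x, y)) z"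
    using xy Fz by (intro index_mat_deriv kron_carrier) auto
  also have "\<dots> = (deriv ^^ j) (\<lambda>s. if x div a = y div b then F s $$ (x mod a, y mod b) else 0) z"
    by (rule higher_deriv_cong_ev[OF ev refl])
  also have "\<dots> = (if x div a = y div b then (deriv ^^ j) (\<lambda>s. F s $$ (x mod a, y mod b)) z else 0)"
    by (cases "x div a = y div b") simp_all
  also have "\<dots> = kron (1\<^sub>m E) (mat_deriv j F z) $$ (x, y)"
    using xy l Fz by (auto simp: kron_def mat_deriv_def)
  finally show "mat_deriv j (\<lambda>s. kron (1\<^sub>m E) (F s)) z $$ (x, y)
    = kron (1\<^sub>m E) (mat_deriv j F z) $$ (x, y)" .
qed

text \<open>The mixed-product rule, with \<open>1\<^sub>m (E * m)\<close> read as
  \<open>kron (1\<^sub>m E) (1\<^sub>m m)\<close>. It merges the factors that depend on the same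
  variable under one common identity.\<close>

lemma kron_one_mult:
  assumes M: "M \<in> carrier_mat a (m * n)" and Y: "Y \<in> carrier_mat n c"
  shows "kron (1\<^sub>m E) M * kron (1\<^sub>m (E * m)) Y = kron (1\<^sub>m E) (M * kron (1\<^sub>m m) Y)"
proof (rule blk_eqI[where E = "E * m" and c = c])
  have K: "kron (1\<^sub>m E) M \<in> carrier_mat (E * a) (E * m * n)"
    using kron_carrier[OF one_carrier_mat M, of E] by (simp add: mult.assoc)
  have MY: "M * kron (1\<^sub>m m) Y \<in> carrier_mat a (m * c)"
    using M Y by (intro mult_carrier_mat[OF M] kron_carrier) auto
  show "kron (1\<^sub>m E) M * kron (1\<^sub>m (E * m)) Y \<in> carrier_mat (E * a) (E * m * c)"
    using K Y by (intro mult_carrier_mat[OF K] kron_carrier) auto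
  show "kron (1\<^sub>m E) (M * kron (1\<^sub>m m) Y) \<in> carrier_mat (E * a) (E * m * c)"
    using kron_carrier[OF one_carrier_mat MY, of E] by (simp add: mult.assoc)
  fix f assume f: "f < E * m"
  define e i where "e = f div m" and "i = f mod m"
  have "m > 0" using f by (cases m) auto
  then have ei: "f = e * m + i" "e < E" "i < m"
    using f by (auto simp: e_def i_def less_mult_imp_div_less)
  have 1: "(1\<^sub>m (E * a) :: complex mat) \<in> carrier_mat (E * a) (E * a)" by simp
  have Y': "Y \<in> carrier_mat n (1 * c)" using Y by simp
  \<comment> \<open>An identity is put in front so that \<open>blk_mult_kron_one\<close> applies to
    a Kronecker product standing alone.\<close>
  have "blk n f (1\<^sub>m (E * a) * kron (1\<^sub>m E) M) = blk a e (1\<^sub>m (E * a)) * blk n i M"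
    unfolding ei(1) by (rule blk_mult_kron_one[OF 1 M ei(2,3)])
  then have M_blk: "blk n f (kron (1\<^sub>m E) M) = blk a e (1\<^sub>m (E * a)) * blk n i M"
    using K by simp
  have MY_blk: "blk c i (M * kron (1\<^sub>m m) Y) = blk n i M * Y"
    using blk_mult_kron_one[OF M Y' ei(3), of 0] blk_one_block[OF Y] by simp
  have "blk c f (kron (1\<^sub>m E) M * kron (1\<^sub>m (E * m)) Y) = blk n f (kron (1\<^sub>m E) M) * Y"
    using blk_mult_kron_one[OF K Y' f, of 0] blk_one_block[OF Y] by simp
  also have "\<dots> = blk a e (1\<^sub>m (E * a)) * (blk n i M * Y)"
    unfolding M_blk using blk_carrier[OF 1] blk_carrier[OF M] Y by (rule assoc_mult_mat)
  also have "\<dots> = blk c f (1\<^sub>m (E * a) * kron (1\<^sub>m E) (M * kron (1\<^sub>m m) Y))"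
    unfolding ei(1) MY_blk[symmetric] by (rule blk_mult_kron_one[symmetric, OF 1 MY ei(2,3)])
  finally show "blk c f (kron (1\<^sub>m E) M * kron (1\<^sub>m (E * m)) Y) = blk c f (kron (1\<^sub>m E) (M * kron (1\<^sub>m m) Y))"
    using kron_carrier[OF one_carrier_mat MY, of E] by simp
qed

lemma blk_mult_kron_last:
  assumes X: "X \<in> carrier_mat r (E * n)" and Y: "Y \<in> carrier_mat n c" and e: "e < E"
  shows "blk c e (X * kron (1\<^sub>m E) Y) = blk n e X * Y"
  using blk_mult_kron_one[of X r E n Y 1 c e 0] blk_one_block[OF Y] assms by simp

lemma blk_mat_deriv:
  assumes S: "open S" "z \<in> S" and e: "e < E"
    and F: "\<And>s. s \<in> S \<Longrightarrow> F s \<in> carrier_mat r (E * c) \<and> blk c e (F s) = G s"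
  shows "blk c e (mat_deriv j F z) = mat_deriv j G z"
proof -
  have Fz: "F z \<in> carrier_mat r (E * c)" using F S(2) by blast
  have "blk c e (mat_deriv j F z) = mat_deriv j (\<lambda>s. blk c e (F s)) z"
  proof (rule eq_matI)
    fix x y assume "x < dim_row (mat_deriv j (\<lambda>s. blk c e (F s)) z)"
      "y < dim_col (mat_deriv j (\<lambda>s. blk c e (F s)) z)"
    then have xy: "x < r" "y < c" using Fz by (auto simp: mat_deriv_def blk_def)
    have ev: "eventually (\<lambda>s. F s $$ (x, e * c + y) = blk c e (F s) $$ (x, y)) (nhds z)"
      unfolding eventually_nhds
      using S index_blk[OF conjunct1[OF F] xy] by (intro exI[of _ S]) simp
    have "blk c e (mat_deriv j F z) $$ (x, y) = mat_deriv j F z $$ (x, e * c + y)"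
      using Fz xy by (intro index_blk mat_deriv_carrier)
    also have "\<dots> = (deriv ^^ j) (\<lambda>s. F s $$ (x, e * c + y)) z"
      using Fz xy block_index_less[OF e xy(2)] by (intro index_mat_deriv)
    also have "\<dots> = (deriv ^^ j) (\<lambda>s. blk c e (F s) $$ (x, y)) z"
      by (rule higher_deriv_cong_ev[OF ev refl])
    also have "\<dots> = mat_deriv j (\<lambda>s. blk c e (F s)) z $$ (x, y)"
      using Fz xy by (intro index_mat_deriv[symmetric, of _ _ r c]) auto
    finally show "blk c e (mat_deriv j F z) $$ (x, y) = mat_deriv j (\<lambda>s. blk c e (F s)) z $$ (x, y)" .
  qed (auto simp: blk_def mat_deriv_def)
  also have "\<dots> = mat_deriv j G z"
    using F by (intro mat_deriv_cong[OF S]) blast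
  finally show ?thesis .
qed

section \<open>Mixed derivatives of transfer functions\<close>

text \<open>Associativity under conditions on dimensions alone, which makes it a rewrite rule for
  long products.\<close>

lemma mult_mat_assoc:
  fixes A :: "'a :: semiring_0 mat"
  shows "dim_col A = dim_row B \<Longrightarrow> dim_col B = dim_row C \<Longrightarrow> A * B * C = A * (B * C)"
  by (rule assoc_mult_mat[of A "dim_row A" "dim_col A" B "dim_col B" C "dim_col C"]) auto

text \<open>For \<open>right_factor\<close>, \<open>js t\<close> and \<open>z t\<close> belong to the variable \<open>s\<^sub>t\<close>; for \<open>left_factor\<close> the variables are
  counted from the last one downwards, and the letters are in reverse order: \<open>left_factor\<close> at \<open>u\<close> and
  \<open>right_factor\<close> at \<open>w\<close> belong to the word \<open>rev u @ w\<close>.\<close>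

fun right_factor :: "(complex \<Rightarrow> complex mat) \<Rightarrow> (complex \<Rightarrow> complex mat) \<Rightarrow> (nat \<Rightarrow> complex \<Rightarrow> complex mat)
    \<Rightarrow> (nat \<Rightarrow> nat) \<Rightarrow> (nat \<Rightarrow> complex) \<Rightarrow> nat list \<Rightarrow> complex \<Rightarrow> complex mat" where
  "right_factor Ki B N js z [] = B"
| "right_factor Ki B N js z (j # w) = (\<lambda>_. mat_deriv (js (Suc (length w)))
     (\<lambda>s. N j s * Ki s * right_factor Ki B N js z w s) (z (Suc (length w))))"

fun left_factor :: "(complex \<Rightarrow> complex mat) \<Rightarrow> (complex \<Rightarrow> complex mat) \<Rightarrow> (nat \<Rightarrow> complex \<Rightarrow> complex mat)
    \<Rightarrow> (nat \<Rightarrow> nat) \<Rightarrow> (nat \<Rightarrow> complex) \<Rightarrow> nat list \<Rightarrow> complex \<Rightarrow> complex mat" where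
  "left_factor C Ki N js z [] = C"
| "left_factor C Ki N js z (j # u) = (\<lambda>s. mat_deriv (js (length u))
     (\<lambda>s. left_factor C Ki N js z u s * Ki s) (z (length u)) * N j s)"

lemma right_factor_cong:
  "(\<And>t. 1 \<le> t \<Longrightarrow> t \<le> length w \<Longrightarrow> js t = js' t \<and> z t = z' t) \<Longrightarrow>
    right_factor Ki B N js z w = right_factor Ki B N js' z' w"
proof (induction w)
  case (Cons j w)
  then have "right_factor Ki B N js z w = right_factor Ki B N js' z' w" by auto
  then show ?case using Cons.prems[of "Suc (length w)"] by simp
qed simp

lemma left_factor_cong:
  "(\<And>t. t < length u \<Longrightarrow> js t = js' t \<and> z t = z' t) \<Longrightarrow>
    left_factor C Ki N js z u = left_factor C Ki N js' z' u"
proof (induction u)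
  case (Cons j u)
  then have "left_factor C Ki N js z u = left_factor C Ki N js' z' u" by auto
  then show ?case using Cons.prems[of "length u"] by simp
qed simp

text \<open>The parameter is fixed. The full and the reduced system are both instances, with state
  dimensions \<open>n\<close> and \<open>r\<close>, so the calculus of words is developed once for
  both.\<close>

locale holo_system =
  fixes n m p :: nat and S :: "complex set"
    and C Ki B :: "complex \<Rightarrow> complex mat" and N :: "nat \<Rightarrow> complex \<Rightarrow> complex mat"
  assumes S: "open S"
    and C: "holo_mat S p n C" and Ki: "holo_mat S n n Ki" and B: "holo_mat S n m B"
    and N: "\<And>j. j < m \<Longrightarrow> holo_mat S n n (N j)"
begin

abbreviation "right \<equiv> right_factor Ki B N"
abbreviation "left \<equiv> left_factor C Ki N"

lemma right_holo:
  "set w \<subseteq> {..<m} \<Longrightarrow> (\<And>t. 1 \<le> t \<Longrightarrow> t \<le> length w \<Longrightarrow> z t \<in> S) \<Longrightarrow> holo_mat S n m (right js z w)"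
proof (induction w)
  case (Cons j w)
  then have IH: "holo_mat S n m (right js z w)" by auto
  have "j < m" using Cons.prems by auto
  then have "holo_mat S n m (\<lambda>s. N j s * Ki s * right js z w s)"
    by (intro holo_mat_mult[where b = n] IH N Ki)
  then have "mat_deriv (js (Suc (length w))) (\<lambda>s. N j s * Ki s * right js z w s) (z (Suc (length w)))
      \<in> carrier_mat n m"
    by (rule holo_mat_deriv_carrier) (use Cons.prems(2)[of "Suc (length w)"] in auto)
  then show ?case by (simp add: holo_mat_const)
qed (simp add: B)

lemma left_holo:
  "set u \<subseteq> {..<m} \<Longrightarrow> (\<And>t. t < length u \<Longrightarrow> z t \<in> S) \<Longrightarrow> holo_mat S p n (left js z u)"
proof (induction u)
  case (Cons j u)
  then have IH: "holo_mat S p n (left js z u)" by auto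
  have "j < m" using Cons.prems by auto
  have "holo_mat S p n (\<lambda>s. left js z u s * Ki s)"
    by (intro holo_mat_mult[where b = n] IH Ki)
  then have "mat_deriv (js (length u)) (\<lambda>s. left js z u s * Ki s) (z (length u)) \<in> carrier_mat p n"
    by (rule holo_mat_deriv_carrier) (use Cons.prems in auto)
  then show ?case
    unfolding left_factor.simps by (intro holo_mat_mult[where b = n] holo_mat_const N \<open>j < m\<close>)
qed (simp add: C)

text \<open>The right factor at \<open>j # w\<close> is constant in the variable at \<open>x\<close>
  and can be taken out of that derivative. What remains is the constant \<open>M\<close>, which can
  be moved into the derivative that defines this right factor. So the same matrix is a derivative in
  either of two neighbouring variables.\<close>

lemma shift_letter:
  assumes j: "j < m" and u: "set u \<subseteq> {..<m}" and w: "set w \<subseteq> {..<m}"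
    and z: "\<And>t. 1 \<le> t \<Longrightarrow> t \<le> Suc (length w) \<Longrightarrow> z t \<in> S" "\<And>t. t < length u \<Longrightarrow> zt t \<in> S"
    and x: "x \<in> S" and zx: "zt (length u) = x" "jt (length u) = i"
  shows "mat_deriv i (\<lambda>s. left jt zt u s * Ki s * right js z (j # w) s) x
    = mat_deriv (js (Suc (length w)))
        (\<lambda>s. left jt zt (j # u) s * Ki s * right js z w s) (z (Suc (length w)))"
proof -
  let ?q = "Suc (length w)"
  have L: "holo_mat S p n (\<lambda>s. left jt zt u s * Ki s)"
    using u z by (intro holo_mat_mult[where b = n] left_holo Ki)
  have R: "holo_mat S n m (\<lambda>s. N j s * Ki s * right js z w s)"
    using j w z by (intro holo_mat_mult[where b = n] N Ki right_holo) auto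
  have q: "z ?q \<in> S" using z by auto
  define M where "M = mat_deriv i (\<lambda>s. left jt zt u s * Ki s) x"
  have M: "M \<in> carrier_mat p n" unfolding M_def using L x by (rule holo_mat_deriv_carrier)
  have Rc: "right js z w s \<in> carrier_mat n m" if "s \<in> S" for s
    using w z that by (intro holo_mat_carrier[OF right_holo]) auto
  have "mat_deriv i (\<lambda>s. left jt zt u s * Ki s * right js z (j # w) s) x = M * right js z (j # w) x"
    unfolding M_def right_factor.simps
    by (rule mat_deriv_mult_right[OF S x L holo_mat_deriv_carrier[OF R q]])
  also have "\<dots> = mat_deriv (js ?q) (\<lambda>s. M * (N j s * Ki s * right js z w s)) (z ?q)"
    using mat_deriv_mult_left[OF S q M R, of "js ?q"] by simp
  also have "\<dots> = mat_deriv (js ?q) (\<lambda>s. left jt zt (j # u) s * Ki s * right js z w s) (z ?q)"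
  proof (rule mat_deriv_cong[OF S q])
    fix s assume s: "s \<in> S"
    have "left jt zt (j # u) s = M * N j s" by (simp add: M_def zx)
    then show "M * (N j s * Ki s * right js z w s) = left jt zt (j # u) s * Ki s * right js z w s"
      using M Rc[OF s] holo_mat_carrier[OF N[OF j] s] holo_mat_carrier[OF Ki s]
      by (simp add: mult_mat_assoc)
  qed
  finally show ?thesis .
qed

text \<open>The subtraction \<open>k - t\<close> turns the count from the last variable, used by
  \<open>left_factor\<close>, into the number of the variable.\<close>

definition word_deriv :: "nat \<Rightarrow> (nat \<Rightarrow> nat) \<Rightarrow> (nat \<Rightarrow> complex) \<Rightarrow> nat list \<Rightarrow> nat list \<Rightarrow> complex mat" where
  "word_deriv k js z u w = mat_deriv (js (Suc (length w)))
     (\<lambda>s. left (\<lambda>t. js (k - t)) (\<lambda>t. z (k - t)) u s * Ki s * right js z w s) (z (Suc (length w)))"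

text \<open>Moving letters one at a time with \<open>shift_letter\<close> shows that the place of
  the split is immaterial. Part (a) will use an empty left word, part (b) an empty right word, and
  part (c) a split at the variable number \<open>q\<close>.\<close>

lemma word_deriv_split:
  assumes "k = Suc (length u + length w)" "set u \<subseteq> {..<m}" "set w \<subseteq> {..<m}" "\<And>i. i \<in> {1..k} \<Longrightarrow> z i \<in> S"
  shows "word_deriv k js z (rev w @ u) [] = word_deriv k js z u w"
  using assms
proof (induction w arbitrary: u)
  case (Cons j w)
  have k: "k - length u = Suc (Suc (length w))" using Cons.prems by simp
  have "word_deriv k js z (rev w @ j # u) [] = word_deriv k js z (j # u) w"
    using Cons.prems by (intro Cons.IH) auto
  also have "\<dots> = word_deriv k js z u (j # w)"
    unfolding word_deriv_def using Cons.prems k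
    by (subst shift_letter) auto
  finally show ?case by simp
qed simp

text \<open>The left factor involves only variables numbered above \<open>q\<close> and the right
  factor only those below. Freezing them turns the partial derivative into an ordinary one. The
  orders 0 in the right factor say that the lower variables have not been differentiated
  yet.\<close>

lemma mixed_deriv_step:
  assumes wq: "length w' = q'" "q = Suc q'" "k = length u + q" and u: "set u \<subseteq> {..<m}" "set w' \<subseteq> {..<m}"
    and f: "\<And>s. (\<And>i. i \<in> {1..k} \<Longrightarrow> s i \<in> S) \<Longrightarrow>
      f s = (left (\<lambda>t. js (k - t)) (\<lambda>t. s (k - t)) u (s q) * Ki (s q) * right (\<lambda>_. 0) s w' (s q)) $$ (x, y)"
    and xy: "x < p" "y < m" and s: "\<And>i. i \<in> {1..k} \<Longrightarrow> s i \<in> S"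
  shows "partial_deriv q (js q) f s = mat_deriv (js q)
    (\<lambda>a. left (\<lambda>t. js (k - t)) (\<lambda>t. s (k - t)) u a * Ki a * right (\<lambda>_. 0) s w' a) (s q) $$ (x, y)"
proof -
  let ?E = "\<lambda>a. left (\<lambda>t. js (k - t)) (\<lambda>t. s (k - t)) u a * Ki a * right (\<lambda>_. 0) s w' a"
  have q: "s q \<in> S" using s wq by auto
  have "eventually (\<lambda>a. f (s(q := a)) = ?E a $$ (x, y)) (nhds (s q))"
    unfolding eventually_nhds
  proof (intro exI[of _ S] conjI ballI S q)
    fix a assume a: "a \<in> S"
    have "left (\<lambda>t. js (k - t)) (\<lambda>t. (s(q := a)) (k - t)) u = left (\<lambda>t. js (k - t)) (\<lambda>t. s (k - t)) u"
      using wq by (intro left_factor_cong) auto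
    moreover have "right (\<lambda>_. 0) (s(q := a)) w' = right (\<lambda>_. 0) s w'"
      using wq by (intro right_factor_cong) auto
    ultimately show "f (s(q := a)) = ?E a $$ (x, y)"
      using s a by (subst f) auto
  qed
  then have "partial_deriv q (js q) f s = (deriv ^^ js q) (\<lambda>a. ?E a $$ (x, y)) (s q)"
    unfolding partial_deriv_def by (rule higher_deriv_cong_ev) simp
  also have "\<dots> = mat_deriv (js q) ?E (s q) $$ (x, y)"
  proof (rule index_mat_deriv[symmetric, OF _ xy], intro mult_carrier_mat[of _ p n])
    show "left (\<lambda>t. js (k - t)) (\<lambda>t. s (k - t)) u (s q) \<in> carrier_mat p n"
      using u s wq by (intro holo_mat_carrier[OF left_holo q]) auto
    show "Ki (s q) \<in> carrier_mat n n" by (rule holo_mat_carrier[OF Ki q])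
    show "right (\<lambda>_. 0) s w' (s q) \<in> carrier_mat n m"
      using u s wq by (intro holo_mat_carrier[OF right_holo q]) auto
  qed
  finally show ?thesis .
qed

text \<open>\<open>foldr\<close> differentiates in the last variable first, so the finished
  variables always form the left factor. The induction moves one variable at a time from right to
  left.\<close>

lemma mixed_deriv_prefix:
  assumes "k = Suc (length u + length w)" "set u \<subseteq> {..<m}" "set w \<subseteq> {..<m}"
    and "\<And>s. (\<And>i. i \<in> {1..k} \<Longrightarrow> s i \<in> S) \<Longrightarrow>
      f s = (C (s k) * Ki (s k) * right (\<lambda>_. 0) s (rev u @ w) (s k)) $$ (x, y)"
    and "x < p" "y < m" and "\<And>i. i \<in> {1..k} \<Longrightarrow> s i \<in> S"
  shows "foldr (\<lambda>i. partial_deriv i (js i)) [Suc (Suc (length w))..<Suc k] f s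
    = (left (\<lambda>t. js (k - t)) (\<lambda>t. s (k - t)) u (s (Suc (length w))) * Ki (s (Suc (length w)))
       * right (\<lambda>_. 0) s w (s (Suc (length w)))) $$ (x, y)"
  using assms
proof (induction u arbitrary: w s)
  case (Cons j u)
  let ?q = "Suc (Suc (length w))"
  let ?f = "foldr (\<lambda>i. partial_deriv i (js i)) [Suc ?q..<Suc k] f"
  have "foldr (\<lambda>i. partial_deriv i (js i)) [?q..<Suc k] f s = partial_deriv ?q (js ?q) ?f s"
    using Cons.prems(1) by (subst upt_conv_Cons) auto
  also have "\<dots> = mat_deriv (js ?q) (\<lambda>a. left (\<lambda>t. js (k - t)) (\<lambda>t. s (k - t)) u a * Ki a
      * right (\<lambda>_. 0) s (j # w) a) (s ?q) $$ (x, y)"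
  proof (rule mixed_deriv_step[of "j # w" "Suc (length w)"])
    fix s assume s: "\<And>i. i \<in> {1..k} \<Longrightarrow> s i \<in> S"
    show "?f s = (left (\<lambda>t. js (k - t)) (\<lambda>t. s (k - t)) u (s ?q) * Ki (s ?q)
       * right (\<lambda>_. 0) s (j # w) (s ?q)) $$ (x, y)"
      using Cons.IH[of "j # w" s] Cons.prems s by simp
  qed (use Cons.prems in auto)
  \<comment> \<open>The letter moves with order 0, because the next lower variable is still
    undifferentiated.\<close>
  also have "\<dots> = mat_deriv 0 (\<lambda>a. left (\<lambda>t. js (k - t)) (\<lambda>t. s (k - t)) (j # u) a * Ki a
      * right (\<lambda>_. 0) s w a) (s (Suc (length w))) $$ (x, y)"
    using Cons.prems by (subst shift_letter) auto
  finally show ?case by (simp only: mat_deriv_0)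
qed simp

lemma mixed_deriv_index:
  assumes k: "k = Suc (length v)" and v: "set v \<subseteq> {..<m}"
    and f: "\<And>s. (\<And>i. i \<in> {1..k} \<Longrightarrow> s i \<in> S) \<Longrightarrow>
      f s = (C (s k) * Ki (s k) * right (\<lambda>_. 0) s v (s k)) $$ (x, y)"
    and xy: "x < p" "y < m" and z: "\<And>i. i \<in> {1..k} \<Longrightarrow> z i \<in> S"
  shows "foldr (\<lambda>i. partial_deriv i (js i)) [1..<Suc k] f z = word_deriv k js z (rev v) [] $$ (x, y)"
proof -
  have v': "set (rev v) \<subseteq> {..<m}" "k = length (rev v) + 1" using v k by simp_all
  have pre: "foldr (\<lambda>i. partial_deriv i (js i)) [Suc 1..<Suc k] f s
    = (left (\<lambda>t. js (k - t)) (\<lambda>t. s (k - t)) (rev v) (s 1) * Ki (s 1)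
       * right (\<lambda>_. 0) s [] (s 1)) $$ (x, y)"
    if s: "\<And>i. i \<in> {1..k} \<Longrightarrow> s i \<in> S" for s
  proof -
    have f': "f s = (C (s k) * Ki (s k) * right (\<lambda>_. 0) s (rev (rev v) @ []) (s k)) $$ (x, y)"
      if "\<And>i. i \<in> {1..k} \<Longrightarrow> s i \<in> S" for s
      using f[of s, OF that] by (simp only: rev_rev_ident append_Nil2)
    have kv: "k = Suc (length (rev v) + length [])" and e: "set [] \<subseteq> {..<m}" using k by simp_all
    from mixed_deriv_prefix[where f = f and js = js, OF kv v'(1) e f' xy s]
    show ?thesis by (simp only: list.size One_nat_def)
  qed
  \<comment> \<open>The derivative in the first variable comes last; there the right factor is that
    of the empty word.\<close>
  have "foldr (\<lambda>i. partial_deriv i (js i)) [1..<Suc k] f z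
      = partial_deriv 1 (js 1) (foldr (\<lambda>i. partial_deriv i (js i)) [Suc 1..<Suc k] f) z"
    using k by (subst upt_conv_Cons) auto
  also have "\<dots> = mat_deriv (js 1) (\<lambda>a. left (\<lambda>t. js (k - t)) (\<lambda>t. z (k - t)) (rev v) a * Ki a
      * right (\<lambda>_. 0) z [] a) (z 1) $$ (x, y)"
    by (rule mixed_deriv_step[where q' = 0, OF _ _ v'(2) v'(1) _ pre xy z]) simp_all
  also have "\<dots> = word_deriv k js z (rev v) [] $$ (x, y)"
    by (simp add: word_deriv_def)
  finally show ?thesis .
qed

theorem blk_mixed_deriv:
  assumes k: "k = Suc (length u + length w)" and u: "set u \<subseteq> {..<m}" and w: "set w \<subseteq> {..<m}"
    and F: "\<And>s. (\<And>i. i \<in> {1..k} \<Longrightarrow> s i \<in> S) \<Longrightarrow> F s \<in> carrier_mat p (m ^ (k - 1) * m) \<and>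
      blk m (word_index m 0 (rev u @ w)) (F s) = C (s k) * Ki (s k) * right (\<lambda>_. 0) s (rev u @ w) (s k)"
    and z: "\<And>i. i \<in> {1..k} \<Longrightarrow> z i \<in> S"
  shows "blk m (word_index m 0 (rev u @ w)) (mixed_deriv k js F z) = word_deriv k js z u w"
proof (rule eq_matI)
  let ?v = "rev u @ w" let ?e = "word_index m 0 (rev u @ w)"
  have v: "length (rev ?v) = k - 1" "set (rev ?v) \<subseteq> {..<m}" "k = Suc (length (rev ?v))"
    using k u w by auto
  have e: "?e < m ^ (k - 1)"
    using word_index_less[of 0 1 ?v m] v by (simp add: add.commute)
  have Fz: "F z \<in> carrier_mat p (m ^ (k - 1) * m)"
    using F[of z] z by blast
  have D: "mixed_deriv k js F z \<in> carrier_mat p (m ^ (k - 1) * m)"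
    using Fz unfolding mixed_deriv_def by simp
  have "holo_mat S p m (\<lambda>s. left (\<lambda>t. js (k - t)) (\<lambda>t. z (k - t)) u s * Ki s * right js z w s)"
    using k u w z by (intro holo_mat_mult[where b = n] left_holo right_holo Ki) auto
  then have wd: "word_deriv k js z u w \<in> carrier_mat p m"
    unfolding word_deriv_def using k z by (intro holo_mat_deriv_carrier) auto
  show "dim_row (blk m ?e (mixed_deriv k js F z)) = dim_row (word_deriv k js z u w)"
    "dim_col (blk m ?e (mixed_deriv k js F z)) = dim_col (word_deriv k js z u w)"
    using D wd by (auto simp: blk_def)
  fix x y assume "x < dim_row (word_deriv k js z u w)" "y < dim_col (word_deriv k js z u w)"
  then have xy: "x < p" "y < m" using wd by auto
  let ?f = "\<lambda>s. F s $$ (x, ?e * m + y)"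
  have f: "?f s = (C (s k) * Ki (s k) * right (\<lambda>_. 0) s ?v (s k)) $$ (x, y)"
    if s: "\<And>i. i \<in> {1..k} \<Longrightarrow> s i \<in> S" for s
  proof -
    have Fs: "F s \<in> carrier_mat p (m ^ (k - 1) * m) \<and>
      blk m ?e (F s) = C (s k) * Ki (s k) * right (\<lambda>_. 0) s ?v (s k)"
      using s by (rule F)
    from index_blk[OF conjunct1[OF Fs] xy, of ?e] conjunct2[OF Fs]
    show ?thesis by (simp only:)
  qed
  have "blk m ?e (mixed_deriv k js F z) $$ (x, y) = mixed_deriv k js F z $$ (x, ?e * m + y)"
    using D xy by (rule index_blk)
  also have "\<dots> = foldr (\<lambda>i. partial_deriv i (js i)) [1..<Suc k] ?f z"
    using Fz xy block_index_less[OF e xy(2)] by (simp add: mixed_deriv_def del: upt_Suc)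
  also have "\<dots> = word_deriv k js z (rev ?v) [] $$ (x, y)"
    by (rule mixed_deriv_index[OF _ _ f xy z]) (use k u w in simp_all)
  \<comment> \<open>So far all letters are on the left; those of \<open>w\<close> are now moved back
    to the right.\<close>
  also have "rev ?v = rev w @ u" by simp
  also have "word_deriv k js z (rev w @ u) [] = word_deriv k js z u w"
    by (rule word_deriv_split[OF k u w z])
  finally show "blk m ?e (mixed_deriv k js F z) $$ (x, y) = word_deriv k js z u w $$ (x, y)" .
qed

text \<open>With all orders 0 the derivatives are values and the right factor is the plain product.
  Position \<open>t\<close> from the right end belongs to the variable with number
  \<open>Suc t\<close>.\<close>

lemma word_prod_right_factor:
  assumes "M \<in> carrier_mat r n" "set v \<subseteq> {..<m}" "\<And>i. i \<in> {1..Suc (length v)} \<Longrightarrow> s i \<in> S"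
  shows "word_prod (\<lambda>t j. N j (s (Suc t)) * Ki (s (Suc t))) M v * B (s 1)
    = M * right (\<lambda>_. 0) s v (s (Suc (length v)))"
  using assms
proof (induction v arbitrary: M)
  case (Cons j v)
  let ?q = "Suc (length v)"
  have q: "s ?q \<in> S" and j: "j < m" using Cons.prems by auto
  note c = holo_mat_carrier[OF N[OF j] q] holo_mat_carrier[OF Ki q]
  have R: "right (\<lambda>_. 0) s v (s ?q) \<in> carrier_mat n m"
    using Cons.prems q by (intro holo_mat_carrier[OF right_holo]) auto
  have "M * (N j (s ?q) * Ki (s ?q)) \<in> carrier_mat r n"
    using Cons.prems(1) c by auto
  from Cons.IH[OF this] Cons.prems c R show ?case
    by (simp add: mat_deriv_0 mult_mat_assoc)
qed simp

text \<open>The last letter is kept apart because in the matrices defining \<open>V\<close> its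
  factor is differentiated jointly with the input matrix at the first point. Hence position
  \<open>t\<close> of the remaining word belongs to variable \<open>t + 2\<close>. The argument
  \<open>x\<close> is arbitrary, as right factors of nonempty words are constant.\<close>

lemma word_prod_right_factor_deriv:
  assumes "M \<in> carrier_mat r n" "set v \<subseteq> {..<m}" "j < m" "\<And>i. i \<in> {1..Suc (length v)} \<Longrightarrow> z i \<in> S"
  shows "word_prod (\<lambda>t j. mat_deriv (l (Suc (Suc t))) (\<lambda>s. N j s * Ki s) (z (Suc (Suc t)))) M v
      * mat_deriv (l 1) (\<lambda>s. N j s * Ki s * B s) (z 1)
    = M * right l z (v @ [j]) x"
  using assms
proof (induction v arbitrary: M)
  case (Cons i v)
  let ?q = "Suc (Suc (length v))"
  have q: "z ?q \<in> S" and i: "i < m" using Cons.prems by auto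
  have NK: "holo_mat S n n (\<lambda>s. N i s * Ki s)" by (intro holo_mat_mult[where b = n] N Ki i)
  have D: "mat_deriv (l ?q) (\<lambda>s. N i s * Ki s) (z ?q) \<in> carrier_mat n n"
    using NK q by (rule holo_mat_deriv_carrier)
  have "holo_mat S n m (right l z (v @ [j]))"
    using Cons.prems by (intro right_holo) auto
  then have R: "right l z (v @ [j]) x \<in> carrier_mat n m" for x
    using holo_mat_carrier[OF _ q] by (cases v) auto
  \<comment> \<open>Being constant, this factor can be taken out of the derivative.\<close>
  have c: "right l z (v @ [j]) = (\<lambda>_. right l z (v @ [j]) x)"
    by (cases v) auto
  have "right l z ((i # v) @ [j]) x
      = mat_deriv (l ?q) (\<lambda>s. N i s * Ki s * right l z (v @ [j]) x) (z ?q)"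
    unfolding append_Cons right_factor.simps length_append_singleton by (subst c) (rule refl)
  also have "\<dots> = mat_deriv (l ?q) (\<lambda>s. N i s * Ki s) (z ?q) * right l z (v @ [j]) x"
    by (rule mat_deriv_mult_right[OF S q NK R])
  finally have "M * right l z ((i # v) @ [j]) x
      = M * mat_deriv (l ?q) (\<lambda>s. N i s * Ki s) (z ?q) * right l z (v @ [j]) x"
    using assoc_mult_mat[OF Cons.prems(1) D R] by simp
  moreover have "M * mat_deriv (l ?q) (\<lambda>s. N i s * Ki s) (z ?q) \<in> carrier_mat r n"
    using Cons.prems(1) D by simp
  ultimately show ?case using Cons.IH Cons.prems by simp
qed simp

text \<open>Adjoints reverse products: a left factor built from the last variable downwards becomes
  a product whose rightmost factor comes from \<open>C\<close>. This is the order of factors in the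
  matrices defining \<open>W\<close>.\<close>

lemma word_prod_left_factor:
  assumes "M \<in> carrier_mat r n" "set u \<subseteq> {..<m}" "\<And>t. t \<le> length u \<Longrightarrow> z t \<in> S"
  shows "word_prod (\<lambda>t j. mat_adjoint (mat_deriv (js (Suc t)) (\<lambda>s. N j s * Ki s) (z (Suc t)))) M u
      * mat_adjoint (mat_deriv (js 0) (\<lambda>s. C s * Ki s) (z 0))
    = M * mat_adjoint (mat_deriv (js (length u)) (\<lambda>s. left js z u s * Ki s) (z (length u)))"
  using assms
proof (induction u arbitrary: M)
  case (Cons j u)
  have j: "j < m" and q: "z (Suc (length u)) \<in> S" "z (length u) \<in> S" using Cons.prems by auto
  let ?D = "mat_deriv (js (Suc (length u))) (\<lambda>s. N j s * Ki s) (z (Suc (length u)))"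
  let ?Z = "mat_deriv (js (length u)) (\<lambda>s. left js z u s * Ki s) (z (length u))"
  have NK: "holo_mat S n n (\<lambda>s. N j s * Ki s)" by (intro holo_mat_mult[where b = n] N Ki j)
  have D: "?D \<in> carrier_mat n n"
    using NK q(1) by (rule holo_mat_deriv_carrier)
  have "holo_mat S p n (\<lambda>s. left js z u s * Ki s)"
    using Cons.prems by (intro holo_mat_mult[where b = n] left_holo Ki) auto
  then have Z: "?Z \<in> carrier_mat p n" using q(2) by (rule holo_mat_deriv_carrier)
  have "mat_deriv (js (Suc (length u))) (\<lambda>s. left js z (j # u) s * Ki s) (z (Suc (length u)))
    = mat_deriv (js (Suc (length u))) (\<lambda>s. ?Z * (N j s * Ki s)) (z (Suc (length u)))"
    using Z holo_mat_carrier[OF N[OF j]] holo_mat_carrier[OF Ki]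
    by (intro mat_deriv_cong[OF S q(1)]) (auto intro!: assoc_mult_mat)
  also have "\<dots> = ?Z * ?D"
    by (rule mat_deriv_mult_left[OF S q(1) Z NK])
  finally have "mat_adjoint (mat_deriv (js (Suc (length u))) (\<lambda>s. left js z (j # u) s * Ki s) (z (Suc (length u))))
    = mat_adjoint ?D * mat_adjoint ?Z"
    using mat_adjoint_mult[OF Z D] by simp
  then have *: "M * mat_adjoint (mat_deriv (js (Suc (length u))) (\<lambda>s. left js z (j # u) s * Ki s) (z (Suc (length u))))
    = M * mat_adjoint ?D * mat_adjoint ?Z"
    using assoc_mult_mat[OF Cons.prems(1) mat_adjoint_carrier[OF D] mat_adjoint_carrier[OF Z]] by simp
  have "M * mat_adjoint ?D \<in> carrier_mat r n"
    using Cons.prems(1) mat_adjoint_carrier[OF D] by simp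
  from Cons.IH[OF this] Cons.prems * show ?case by simp
qed simp

end

section \<open>Blocks of the projection matrices\<close>

text \<open>Letters are digits in base \<open>m\<close> and start at 0, whereas the bilinear
  matrices are numbered from 1; hence \<open>Suc j\<close>.\<close>

locale bilinear_at =
  holo_system n m p S "\<lambda>s. Cfun G s \<mu>" "\<lambda>s. Kinv G s \<mu>" "\<lambda>s. Bfun G s \<mu>" "\<lambda>j s. Nfun G (Suc j) s \<mu>"
  for n m p S G \<mu>
begin

abbreviation "Cs s \<equiv> Cfun G s \<mu>"
abbreviation "Kis s \<equiv> Kinv G s \<mu>"
abbreviation "Bs s \<equiv> Bfun G s \<mu>"
abbreviation "Ns j s \<equiv> Nfun G (Suc j) s \<mu>"

lemma Nhor_carrier: "Nhor n m G s \<mu> \<in> carrier_mat n (m * n)"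
  by (simp add: Nhor_def mult.commute)

lemma blk_Nhor:
  assumes "s \<in> S" "j < m"
  shows "blk n j (Nhor n m G s \<mu>) = Ns j s"
  using holo_mat_carrier[OF N[OF assms(2)] assms(1)] assms(2)
  by (intro eq_matI) (auto simp: blk_def Nhor_def block_index_less mult.commute[of n m])

lemma Nhor_Kinv:
  assumes s: "s \<in> S" and j: "j < m"
  shows "Nhor n m G s \<mu> * kron (1\<^sub>m m) (Kis s) \<in> carrier_mat n (m * n) \<and>
    blk n j (Nhor n m G s \<mu> * kron (1\<^sub>m m) (Kis s)) = Ns j s * Kis s"
  using blk_mult_kron_last[OF Nhor_carrier holo_mat_carrier[OF Ki s] j] blk_Nhor[OF s j]
    mult_carrier_mat[OF Nhor_carrier kron_carrier[OF one_carrier_mat holo_mat_carrier[OF Ki s]]]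
  by simp

text \<open>This gives the factor of one variable the shape that \<open>blk_foldl_kron\<close>
  expects.\<close>

lemma kron_Nhor_Kinv:
  assumes s: "s \<in> S" and i: "i \<ge> 1"
  shows "kron (1\<^sub>m (m ^ (i - 1))) (Nhor n m G s \<mu>) * kron (1\<^sub>m (m ^ i)) (Kis s)
    = kron (1\<^sub>m (m ^ (i - 1))) (Nhor n m G s \<mu> * kron (1\<^sub>m m) (Kis s))"
  using kron_one_mult[OF Nhor_carrier holo_mat_carrier[OF Ki s], of "m ^ (i - 1)"] i
  by (simp add: power_eq_if mult.commute)

lemma blk_transfer_function:
  assumes k: "k = Suc (length v)" and v: "set v \<subseteq> {..<m}" and s: "\<And>i. i \<in> {1..k} \<Longrightarrow> s i \<in> S"
  shows "transfer_function n m G k \<mu> s \<in> carrier_mat p (m ^ (k - 1) * m) \<and>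
    blk m (word_index m 0 v) (transfer_function n m G k \<mu> s)
      = Cs (s k) * Kis (s k) * right (\<lambda>_. 0) s v (s k)"
proof -
  define A where "A i = Nhor n m G (s (k - i)) \<mu> * kron (1\<^sub>m m) (Kis (s (k - i)))" for i
  define F where "F i = kron (1\<^sub>m (m ^ (i - 1))) (Nhor n m G (s (k - i)) \<mu>)
    * kron (1\<^sub>m (m ^ i)) (Kis (s (k - i)))" for i
  let ?D = "\<lambda>t j. Ns j (s (Suc t)) * Kis (s (Suc t))"
  let ?e = "word_index m 0 v"
  have si: "s (k - i) \<in> S" if "i \<in> {1..<1 + length v}" for i using that k s by auto
  have s1: "s 1 \<in> S" and sk: "s k \<in> S" using s k by auto
  have e: "?e < m ^ (k - 1)" using word_index_less[of 0 1 v m] v k by simp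
  have "foldl (*) (1\<^sub>m n) (map F [1..<1 + length v]) \<in> carrier_mat n (1 * m ^ length v * n) \<and>
    blk n ?e (foldl (*) (1\<^sub>m n) (map F [1..<1 + length v])) = word_prod ?D (blk n 0 (1\<^sub>m n)) v"
  proof (rule blk_foldl_kron[where m = m and A = A])
    fix i assume i: "i \<in> {1..<1 + length v}"
    show "F i = kron (1\<^sub>m (1 * m ^ (i - 1))) (A i)"
      using kron_Nhor_Kinv[OF si[OF i]] i by (simp add: F_def A_def)
    show "A i \<in> carrier_mat n (m * n)"
      unfolding A_def using holo_mat_carrier[OF Ki si[OF i]]
      by (intro mult_carrier_mat[OF Nhor_carrier] kron_carrier) auto
    \<comment> \<open>Factor \<open>i\<close> belongs to the variable \<open>s (k - i)\<close>, and
      its distance from the right end of the word is \<open>k - Suc i\<close>.\<close>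
    show "blk n j (A i) = ?D (1 + length v - Suc i) j" if "j < m" for j
      using Nhor_Kinv[OF si[OF i] that] i k by (simp add: A_def Suc_diff_le)
  qed (use v in auto)
  then have P: "mat_prod n (map F [1..<k]) \<in> carrier_mat n (m ^ (k - 1) * n)"
    "blk n ?e (mat_prod n (map F [1..<k])) = word_prod ?D (1\<^sub>m n) v"
    using k blk_one_block[of "1\<^sub>m n :: complex mat" n n] by (simp_all add: mat_prod_def)
  have CK: "Cs (s k) * Kis (s k) \<in> carrier_mat p n"
    using holo_mat_carrier[OF C sk] holo_mat_carrier[OF Ki sk] by simp
  have D: "?D t j \<in> carrier_mat n n" if "t < length v" "j \<in> set v" for t j
    using that v s[of "Suc t"] k holo_mat_carrier[OF N] holo_mat_carrier[OF Ki]
    by (intro mult_carrier_mat[where n = n]) auto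
  have tf: "transfer_function n m G k \<mu> s
    = Cs (s k) * Kis (s k) * mat_prod n (map F [1..<k]) * kron (1\<^sub>m (m ^ (k - 1))) (Bs (s 1))"
    by (simp add: transfer_function_def F_def[abs_def])
  note CKP = mult_carrier_mat[OF CK P(1)]
  note B1 = holo_mat_carrier[OF B s1]
  have "blk m ?e (transfer_function n m G k \<mu> s)
    = Cs (s k) * Kis (s k) * word_prod ?D (1\<^sub>m n) v * Bs (s 1)"
    unfolding tf blk_mult_kron_last[OF CKP B1 e] blk_mult_left[OF CK P(1) e] P(2) ..
  also have "Cs (s k) * Kis (s k) * word_prod ?D (1\<^sub>m n) v
      = word_prod ?D (Cs (s k) * Kis (s k) * 1\<^sub>m n) v"
    using word_prod_mult_left[OF CK one_carrier_mat D] by simp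
  also have "Cs (s k) * Kis (s k) * 1\<^sub>m n = Cs (s k) * Kis (s k)" using CK by (rule right_mult_one_mat)
  also have "word_prod ?D (Cs (s k) * Kis (s k)) v * Bs (s 1)
      = Cs (s k) * Kis (s k) * right (\<lambda>_. 0) s v (s k)"
    using word_prod_right_factor[OF CK v] s k by simp
  finally have "blk m ?e (transfer_function n m G k \<mu> s)
      = Cs (s k) * Kis (s k) * right (\<lambda>_. 0) s v (s k)" .
  moreover have "transfer_function n m G k \<mu> s \<in> carrier_mat p (m ^ (k - 1) * m)"
    unfolding tf using CKP B1 by (intro mult_carrier_mat[OF CKP] kron_carrier) auto
  ultimately show ?thesis by blast
qed

lemma blk_mixed_deriv_transfer_function:
  assumes k: "k = Suc (length u + length w)" and u: "set u \<subseteq> {..<m}" and w: "set w \<subseteq> {..<m}"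
    and z: "\<And>i. i \<in> {1..k} \<Longrightarrow> z i \<in> S"
  shows "blk m (word_index m 0 (rev u @ w)) (mixed_deriv k js (transfer_function n m G k \<mu>) z)
    = word_deriv k js z u w"
  by (rule blk_mixed_deriv[OF k u w blk_transfer_function z]) (use k u w in auto)

lemma mixed_deriv_transfer_function_carrier:
  assumes k: "k \<ge> 1" and m: "m > 0" and z: "\<And>i. i \<in> {1..k} \<Longrightarrow> z i \<in> S"
  shows "mixed_deriv k js (transfer_function n m G k \<mu>) z \<in> carrier_mat p (m ^ (k - 1) * m)"
proof -
  have "transfer_function n m G k \<mu> z \<in> carrier_mat p (m ^ (k - 1) * m)"
    \<comment> \<open>The dimensions come with \<open>blk_transfer_function\<close>, which asks for
      some word; \<open>m > 0\<close> admits the letter 0.\<close>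
    using blk_transfer_function[of k "replicate (k - 1) 0" z] assms
    by (auto simp: set_replicate_conv_if)
  then show ?thesis unfolding mixed_deriv_def by simp
qed

lemma mat_deriv_Nhor_Kinv:
  fixes a i j :: nat
  assumes z: "z \<in> S"
  defines "A \<equiv> mat_deriv a (\<lambda>s. Nhor n m G s \<mu> * kron (1\<^sub>m m) (Kis s)) z"
  shows "A \<in> carrier_mat n (m * n)"
    and "j < m \<Longrightarrow> blk n j A = mat_deriv a (\<lambda>s. Ns j s * Kis s) z"
    and "i \<ge> 1 \<Longrightarrow> mat_deriv a (\<lambda>s. kron (1\<^sub>m (m ^ (i - 1))) (Nhor n m G s \<mu>)
      * kron (1\<^sub>m (m ^ i)) (Kis s)) z = kron (1\<^sub>m (m ^ (i - 1))) A"
proof -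
  have c: "Nhor n m G s \<mu> * kron (1\<^sub>m m) (Kis s) \<in> carrier_mat n (m * n)" if "s \<in> S" for s
    using holo_mat_carrier[OF Ki that]
    by (intro mult_carrier_mat[OF Nhor_carrier] kron_carrier) auto
  then show "A \<in> carrier_mat n (m * n)"
    unfolding A_def using z by (intro mat_deriv_carrier)
  show "blk n j A = mat_deriv a (\<lambda>s. Ns j s * Kis s) z" if "j < m"
    unfolding A_def by (rule blk_mat_deriv[OF S z that]) (rule Nhor_Kinv[OF _ that])
  show "mat_deriv a (\<lambda>s. kron (1\<^sub>m (m ^ (i - 1))) (Nhor n m G s \<mu>)
      * kron (1\<^sub>m (m ^ i)) (Kis s)) z = kron (1\<^sub>m (m ^ (i - 1))) A" if "i \<ge> 1"
  proof -
    have "mat_deriv a (\<lambda>s. kron (1\<^sub>m (m ^ (i - 1))) (Nhor n m G s \<mu>) * kron (1\<^sub>m (m ^ i)) (Kis s)) z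
      = mat_deriv a (\<lambda>s. kron (1\<^sub>m (m ^ (i - 1))) (Nhor n m G s \<mu> * kron (1\<^sub>m m) (Kis s))) z"
      by (rule mat_deriv_cong[OF S z]) (rule kron_Nhor_Kinv[OF _ that])
    also have "\<dots> = kron (1\<^sub>m (m ^ (i - 1))) A"
      unfolding A_def by (rule mat_deriv_kron_one[OF S z c])
    finally show ?thesis .
  qed
qed

lemma mat_deriv_Nhor_Kinv_B:
  fixes a i j :: nat
  assumes z: "z \<in> S"
  defines "A \<equiv> mat_deriv a (\<lambda>s. Nhor n m G s \<mu> * kron (1\<^sub>m m) (Kis s) * kron (1\<^sub>m m) (Bs s)) z"
  shows "A \<in> carrier_mat n (m * m)"
    and "j < m \<Longrightarrow> blk m j A = mat_deriv a (\<lambda>s. Ns j s * Kis s * Bs s) z"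
    and "i \<ge> 1 \<Longrightarrow> mat_deriv a (\<lambda>s. kron (1\<^sub>m (m ^ (i - 1))) (Nhor n m G s \<mu>)
      * kron (1\<^sub>m (m ^ i)) (Kis s) * kron (1\<^sub>m (m ^ i)) (Bs s)) z = kron (1\<^sub>m (m ^ (i - 1))) A"
proof -
  have c: "Nhor n m G s \<mu> * kron (1\<^sub>m m) (Kis s) \<in> carrier_mat n (m * n)" if "s \<in> S" for s
    using holo_mat_carrier[OF Ki that]
    by (intro mult_carrier_mat[OF Nhor_carrier] kron_carrier) auto
  have c': "Nhor n m G s \<mu> * kron (1\<^sub>m m) (Kis s) * kron (1\<^sub>m m) (Bs s) \<in> carrier_mat n (m * m)"
    if "s \<in> S" for s
    using holo_mat_carrier[OF B that]
    by (intro mult_carrier_mat[OF c[OF that]] kron_carrier) auto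
  then show "A \<in> carrier_mat n (m * m)"
    unfolding A_def using z by (intro mat_deriv_carrier)
  show "blk m j A = mat_deriv a (\<lambda>s. Ns j s * Kis s * Bs s) z" if "j < m"
    unfolding A_def
  proof (rule blk_mat_deriv[OF S z that], rule conjI, erule c')
    fix s assume s: "s \<in> S"
    show "blk m j (Nhor n m G s \<mu> * kron (1\<^sub>m m) (Kis s) * kron (1\<^sub>m m) (Bs s)) = Ns j s * Kis s * Bs s"
      using blk_mult_kron_last[OF c[OF s] holo_mat_carrier[OF B s] that] Nhor_Kinv[OF s that] by simp
  qed
  show "mat_deriv a (\<lambda>s. kron (1\<^sub>m (m ^ (i - 1))) (Nhor n m G s \<mu>)
      * kron (1\<^sub>m (m ^ i)) (Kis s) * kron (1\<^sub>m (m ^ i)) (Bs s)) z = kron (1\<^sub>m (m ^ (i - 1))) A" if "i \<ge> 1"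
  proof -
    have "mat_deriv a (\<lambda>s. kron (1\<^sub>m (m ^ (i - 1))) (Nhor n m G s \<mu>) * kron (1\<^sub>m (m ^ i)) (Kis s)
        * kron (1\<^sub>m (m ^ i)) (Bs s)) z
      = mat_deriv a (\<lambda>s. kron (1\<^sub>m (m ^ (i - 1)))
          (Nhor n m G s \<mu> * kron (1\<^sub>m m) (Kis s) * kron (1\<^sub>m m) (Bs s))) z"
    proof (rule mat_deriv_cong[OF S z])
      fix s assume s: "s \<in> S"
      show "kron (1\<^sub>m (m ^ (i - 1))) (Nhor n m G s \<mu>) * kron (1\<^sub>m (m ^ i)) (Kis s)
        * kron (1\<^sub>m (m ^ i)) (Bs s)
        = kron (1\<^sub>m (m ^ (i - 1))) (Nhor n m G s \<mu> * kron (1\<^sub>m m) (Kis s) * kron (1\<^sub>m m) (Bs s))"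
        unfolding kron_Nhor_Kinv[OF s that]
        using kron_one_mult[OF c[OF s] holo_mat_carrier[OF B s], of "m ^ (i - 1)"] that
        by (simp add: power_eq_if mult.commute)
    qed
    also have "\<dots> = kron (1\<^sub>m (m ^ (i - 1))) A"
      unfolding A_def by (rule mat_deriv_kron_one[OF S z c'])
    finally show ?thesis .
  qed
qed

text \<open>The empty word gives the special matrix for \<open>q = 1\<close>. Otherwise the last
  letter comes from the factor containing \<open>B\<close>, the others from the Kronecker factors
  before it, and the derivative of \<open>K^-1\<close> stands alone because the right factor is then
  constant.\<close>

lemma blk_Vmat:
  assumes w: "set w \<subseteq> {..<m}" and \<sigma>: "\<And>i. i \<in> {1..Suc (length w)} \<Longrightarrow> \<sigma> i \<in> S"
  defines "q \<equiv> Suc (length w)"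
  shows "Vmat n m G \<mu> \<sigma> l q j \<in> carrier_mat n (m ^ (q - 1) * m) \<and>
    blk m (word_index m 0 w) (Vmat n m G \<mu> \<sigma> l q j) = mat_deriv j (\<lambda>s. Kis s * right l \<sigma> w s) (\<sigma> q)"
proof (cases w rule: rev_cases)
  case Nil
  have "holo_mat S n m (\<lambda>s. Kis s * Bs s)" by (intro holo_mat_mult[where b = n] Ki B)
  then have "Vmat n m G \<mu> \<sigma> l 1 j \<in> carrier_mat n m"
    using \<sigma> Nil unfolding Vmat_def by (auto intro: holo_mat_deriv_carrier)
  then show ?thesis using blk_one_block Nil by (simp add: q_def Vmat_def)
next
  case (snoc w' j')
  define T where "T = length w'"
  have q: "q = Suc (Suc T)" and j': "j' < m" and w': "set w' \<subseteq> {..<m}"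
    using snoc w by (auto simp: q_def T_def)
  define A where "A i = mat_deriv (l (q - i)) (\<lambda>s. Nhor n m G s \<mu> * kron (1\<^sub>m m) (Kis s)) (\<sigma> (q - i))" for i
  define F where "F i = mat_deriv (l (q - i)) (\<lambda>s. kron (1\<^sub>m (m ^ (i - 1))) (Nhor n m G s \<mu>)
    * kron (1\<^sub>m (m ^ i)) (Kis s)) (\<sigma> (q - i))" for i
  define A1 where "A1 = mat_deriv (l 1) (\<lambda>s. Nhor n m G s \<mu> * kron (1\<^sub>m m) (Kis s) * kron (1\<^sub>m m) (Bs s)) (\<sigma> 1)"
  define Kd where "Kd = mat_deriv j Kis (\<sigma> q)"
  let ?D = "\<lambda>t j. mat_deriv (l (Suc (Suc t))) (\<lambda>s. Ns j s * Kis s) (\<sigma> (Suc (Suc t)))"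
  let ?e = "word_index m 0 w'"
  have \<sigma>S: "\<sigma> i \<in> S" if "1 \<le> i" "i \<le> q" for i using that \<sigma> by (auto simp: q_def)
  have \<sigma>q: "\<sigma> q \<in> S" and \<sigma>1: "\<sigma> 1 \<in> S" using \<sigma>S q by auto
  have si: "\<sigma> (q - i) \<in> S" if "i \<in> {1..<1 + length w'}" for i using that \<sigma>S q by (auto simp: T_def)
  have e: "?e < m ^ T" using word_index_less[of 0 1 w' m] w' by (simp add: T_def)
  have "foldl (*) (1\<^sub>m n) (map F [1..<1 + length w']) \<in> carrier_mat n (1 * m ^ length w' * n) \<and>
    blk n ?e (foldl (*) (1\<^sub>m n) (map F [1..<1 + length w'])) = word_prod ?D (blk n 0 (1\<^sub>m n)) w'"
  proof (rule blk_foldl_kron[where m = m and A = A])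
    fix i assume i: "i \<in> {1..<1 + length w'}"
    show "F i = kron (1\<^sub>m (1 * m ^ (i - 1))) (A i)"
      using mat_deriv_Nhor_Kinv(3)[OF si[OF i]] i by (simp add: F_def A_def)
    show "A i \<in> carrier_mat n (m * n)"
      unfolding A_def using si[OF i] by (rule mat_deriv_Nhor_Kinv)
    \<comment> \<open>Positions are shifted by 2, since variable 1 is taken by
      \<open>A1\<close>.\<close>
    have "Suc (Suc (1 + length w' - Suc i)) = q - i" using i q by (auto simp: T_def)
    then show "blk n j (A i) = ?D (1 + length w' - Suc i) j" if "j < m" for j
      unfolding A_def using mat_deriv_Nhor_Kinv(2)[OF si[OF i] that] by simp
  qed (use w' in auto)
  then have P: "mat_prod n (map F [1..<q - 1]) \<in> carrier_mat n (m ^ T * n)"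
    "blk n ?e (mat_prod n (map F [1..<q - 1])) = word_prod ?D (1\<^sub>m n) w'"
    using q blk_one_block[of "1\<^sub>m n :: complex mat" n n] by (simp_all add: mat_prod_def T_def)
  have Kd: "Kd \<in> carrier_mat n n" unfolding Kd_def using Ki \<sigma>q by (rule holo_mat_deriv_carrier)
  have A1: "A1 \<in> carrier_mat n (m * m)" "blk m j' A1 = mat_deriv (l 1) (\<lambda>s. Ns j' s * Kis s * Bs s) (\<sigma> 1)"
    unfolding A1_def using mat_deriv_Nhor_Kinv_B[OF \<sigma>1] j' by auto
  have V: "Vmat n m G \<mu> \<sigma> l q j = Kd * mat_prod n (map F [1..<q - 1]) * kron (1\<^sub>m (m ^ T)) A1"
    using mat_deriv_Nhor_Kinv_B(3)[OF \<sigma>1, of "Suc T" "l 1"] q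
    by (simp add: Vmat_def Kd_def F_def[abs_def] A1_def)
  note KP = mult_carrier_mat[OF Kd P(1)]
  have D: "?D t j \<in> carrier_mat n n" if "t < length w'" "j \<in> set w'" for t j
    using that w' q \<sigma>S by (intro holo_mat_deriv_carrier[where S = S] holo_mat_mult[where b = n] N Ki) (auto simp: T_def)
  have "holo_mat S n m (right l \<sigma> w)"
    using w \<sigma> by (intro right_holo) auto
  from holo_mat_carrier[OF this \<sigma>q] have R: "right l \<sigma> w (\<sigma> q) \<in> carrier_mat n m" .
  have "blk m (?e * m + j') (Vmat n m G \<mu> \<sigma> l q j)
      = Kd * word_prod ?D (1\<^sub>m n) w' * mat_deriv (l 1) (\<lambda>s. Ns j' s * Kis s * Bs s) (\<sigma> 1)"
    unfolding V blk_mult_kron_one[OF KP A1(1) e j'] blk_mult_left[OF Kd P(1) e] P(2) A1(2) ..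
  also have "Kd * word_prod ?D (1\<^sub>m n) w' = word_prod ?D (Kd * 1\<^sub>m n) w'"
    using word_prod_mult_left[OF Kd one_carrier_mat D] by simp
  also have "Kd * 1\<^sub>m n = Kd" using Kd by simp
  also have "word_prod ?D Kd w' * mat_deriv (l 1) (\<lambda>s. Ns j' s * Kis s * Bs s) (\<sigma> 1)
      = Kd * right l \<sigma> (w' @ [j']) (\<sigma> q)"
    by (rule word_prod_right_factor_deriv[OF Kd w' j']) (use \<sigma>S q in \<open>auto simp: T_def\<close>)
  also have "\<dots> = mat_deriv j (\<lambda>s. Kis s * right l \<sigma> w (\<sigma> q)) (\<sigma> q)"
    unfolding Kd_def using mat_deriv_mult_right[OF S \<sigma>q Ki R] snoc by simp
  \<comment> \<open>The right factor of a nonempty word has the same value at every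
    argument.\<close>
  also have "\<dots> = mat_deriv j (\<lambda>s. Kis s * right l \<sigma> w s) (\<sigma> q)"
    unfolding snoc by (cases w') simp_all
  finally have "blk m (word_index m 0 w) (Vmat n m G \<mu> \<sigma> l q j) = mat_deriv j (\<lambda>s. Kis s * right l \<sigma> w s) (\<sigma> q)"
    using snoc by (simp add: word_index_append)
  moreover have "Vmat n m G \<mu> \<sigma> l q j \<in> carrier_mat n (m ^ T * (m * m))"
    unfolding V by (intro mult_carrier_mat[OF KP] kron_carrier one_carrier_mat A1)
  ultimately show ?thesis using q by (simp add: algebra_simps)
qed

text \<open>Taking adjoints turns the vertical stack of the bilinear matrices into a row of column
  blocks.\<close>

lemma KN_deriv_blk:
  assumes z: "z \<in> S"
  shows "KN_deriv n m G \<mu> a z \<in> carrier_mat n (m * n)"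
    and "j < m \<Longrightarrow> blk n j (KN_deriv n m G \<mu> a z) = mat_adjoint (mat_deriv a (\<lambda>s. Ns j s * Kis s) z)"
proof -
  have Nv: "Nver n m G s \<mu> \<in> carrier_mat (m * n) n" for s
    by (simp add: Nver_def mult.commute)
  have NvK: "Nver n m G s \<mu> * Kis s \<in> carrier_mat (m * n) n" if "s \<in> S" for s
    using Nv holo_mat_carrier[OF Ki that] by (rule mult_carrier_mat)
  let ?M = "mat_deriv a (\<lambda>s. Nver n m G s \<mu> * Kis s) z"
  have M: "?M \<in> carrier_mat (m * n) n"
    using NvK[OF z] by (rule mat_deriv_carrier)
  show c: "KN_deriv n m G \<mu> a z \<in> carrier_mat n (m * n)"
    unfolding KN_deriv_def using M by (rule mat_adjoint_carrier)
  show "blk n j (KN_deriv n m G \<mu> a z) = mat_adjoint (mat_deriv a (\<lambda>s. Ns j s * Kis s) z)"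
    if j: "j < m"
  proof (rule eq_matI)
    have NK: "Ns j s * Kis s \<in> carrier_mat n n" if "s \<in> S" for s
      using holo_mat_carrier[OF N[OF j] that] holo_mat_carrier[OF Ki that] by (rule mult_carrier_mat)
    have D: "mat_deriv a (\<lambda>s. Ns j s * Kis s) z \<in> carrier_mat n n"
      using NK[OF z] by (rule mat_deriv_carrier)
    show "dim_row (blk n j (KN_deriv n m G \<mu> a z)) = dim_row (mat_adjoint (mat_deriv a (\<lambda>s. Ns j s * Kis s) z))"
      "dim_col (blk n j (KN_deriv n m G \<mu> a z)) = dim_col (mat_adjoint (mat_deriv a (\<lambda>s. Ns j s * Kis s) z))"
      using c mat_adjoint_carrier[OF D] by (auto simp: blk_def)
    fix x y assume "x < dim_row (mat_adjoint (mat_deriv a (\<lambda>s. Ns j s * Kis s) z))"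
      "y < dim_col (mat_adjoint (mat_deriv a (\<lambda>s. Ns j s * Kis s) z))"
    then have xy: "x < n" "y < n" using mat_adjoint_carrier[OF D] by auto
    have jy: "j * n + y < m * n" using j xy(2) by (rule block_index_less)
    have ev: "eventually (\<lambda>s. (Nver n m G s \<mu> * Kis s) $$ (j * n + y, x) = (Ns j s * Kis s) $$ (y, x)) (nhds z)"
      unfolding eventually_nhds
    proof (intro exI[of _ S] conjI ballI S z)
      fix s assume s: "s \<in> S"
      have "(Nver n m G s \<mu> * Kis s) $$ (j * n + y, x)
          = (\<Sum>k<n. Nver n m G s \<mu> $$ (j * n + y, k) * Kis s $$ (k, x))"
        by (rule index_mult_mat_sum[OF Nv holo_mat_carrier[OF Ki s] jy xy(1)])
      also have "\<dots> = (\<Sum>k<n. Ns j s $$ (y, k) * Kis s $$ (k, x))"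
        using jy xy by (intro sum.cong) (auto simp: Nver_def mult.commute)
      also have "\<dots> = (Ns j s * Kis s) $$ (y, x)"
        by (rule index_mult_mat_sum[symmetric, OF holo_mat_carrier[OF N[OF j] s] holo_mat_carrier[OF Ki s] xy(2,1)])
      finally show "(Nver n m G s \<mu> * Kis s) $$ (j * n + y, x) = (Ns j s * Kis s) $$ (y, x)" .
    qed
    have "blk n j (KN_deriv n m G \<mu> a z) $$ (x, y) = KN_deriv n m G \<mu> a z $$ (x, j * n + y)"
      using c xy by (rule index_blk)
    also have "\<dots> = conjugate (?M $$ (j * n + y, x))"
      unfolding KN_deriv_def using M xy(1) jy by (rule index_mat_adjoint)
    also have "?M $$ (j * n + y, x) = (deriv ^^ a) (\<lambda>s. (Nver n m G s \<mu> * Kis s) $$ (j * n + y, x)) z"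
      using NvK[OF z] jy xy(1) by (rule index_mat_deriv)
    also have "\<dots> = (deriv ^^ a) (\<lambda>s. (Ns j s * Kis s) $$ (y, x)) z"
      by (rule higher_deriv_cong_ev[OF ev refl])
    also have "\<dots> = mat_deriv a (\<lambda>s. Ns j s * Kis s) z $$ (y, x)"
      using NK[OF z] xy(2,1) by (rule index_mat_deriv[symmetric])
    also have "conjugate \<dots> = mat_adjoint (mat_deriv a (\<lambda>s. Ns j s * Kis s) z) $$ (x, y)"
      using D xy by (rule index_mat_adjoint[symmetric])
    finally show "blk n j (KN_deriv n m G \<mu> a z) $$ (x, y)
      = mat_adjoint (mat_deriv a (\<lambda>s. Ns j s * Kis s) z) $$ (x, y)" .
  qed
qed

lemma KC_deriv_carrier: "z \<in> S \<Longrightarrow> KC_deriv G \<mu> a z \<in> carrier_mat n p"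
  unfolding KC_deriv_def
  by (intro mat_adjoint_carrier holo_mat_deriv_carrier[where S = S] holo_mat_mult[where b = n] C Ki)

text \<open>The first letter comes from the leading factor, the others from the Kronecker factors.
  The words are the reversed words of the transfer function, which permutes the blocks only; the
  span condition concerns all of them.\<close>

lemma blk_Wmat:
  assumes u: "set u \<subseteq> {..<m}" and \<tau>: "\<And>i. i \<in> {1..\<theta>} \<Longrightarrow> \<tau> i \<in> S" and \<theta>: "length u < \<theta>"
  defines "\<eta> \<equiv> Suc (length u)"
  shows "Wmat n m G \<mu> \<theta> \<tau> \<nu> \<eta> j \<in> carrier_mat n (m ^ (\<eta> - 1) * p) \<and>
    blk p (word_index m 0 u) (Wmat n m G \<mu> \<theta> \<tau> \<nu> \<eta> j)
      = mat_adjoint (mat_deriv j (\<lambda>s. left (\<lambda>t. \<nu> (\<theta> - t)) (\<lambda>t. \<tau> (\<theta> - t)) u s * Kis s) (\<tau> (\<theta> - length u)))"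
proof (cases u)
  case Nil
  have "\<theta> - 1 + 1 = \<theta>" using \<theta> by simp
  moreover have "KC_deriv G \<mu> j (\<tau> \<theta>) \<in> carrier_mat n p"
    using \<tau> \<theta> by (intro KC_deriv_carrier) auto
  ultimately show ?thesis using Nil
    by (simp add: \<eta>_def Wmat_def blk_one_block KC_deriv_def)
next
  case (Cons j0 v)
  define T where "T = length v"
  \<comment> \<open>Expressing all indices by sums with \<open>b\<close> avoids truncated
    subtraction.\<close>
  define b where "b = \<theta> - \<eta>"
  define a where "a = b + 2"
  have \<eta>: "\<eta> = Suc (Suc T)"
    and j0: "j0 < m" and v: "set v \<subseteq> {..<m}"
    using Cons u by (auto simp: \<eta>_def T_def)
  have b: "\<theta> = b + Suc (Suc T)"
    using \<theta> \<eta> unfolding b_def \<eta>_def by linarith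
  then have \<theta>': "\<theta> = a + T" "\<theta> - \<eta> + 1 = \<theta> - Suc T"
    using \<eta> by (simp_all add: a_def)
  define F where "F i = kron (1\<^sub>m (m ^ (i - b - 1))) (KN_deriv n m G \<mu> (\<nu> i) (\<tau> i))" for i
  define X where "X = KN_deriv n m G \<mu> j (\<tau> (\<theta> - \<eta> + 1))"
  let ?js = "\<lambda>t. \<nu> (\<theta> - t)" and ?z = "\<lambda>t. \<tau> (\<theta> - t)"
  let ?D = "\<lambda>t i. mat_adjoint (mat_deriv (?js (Suc t)) (\<lambda>s. Ns i s * Kis s) (?z (Suc t)))"
  let ?e = "word_index m j0 v"
  let ?I = "1\<^sub>m (n * m) :: complex mat"
  have z: "?z t \<in> S" if "t \<le> Suc T" for t using that \<tau> \<theta> Cons by (auto simp: T_def)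
  have e: "?e < m ^ Suc T" using word_index_less[of j0 m v m] v j0 by (simp add: T_def)
  have I: "?I \<in> carrier_mat (n * m) (m * n)" by (simp add: mult.commute)
  \<comment> \<open>The identity of size \<open>n * m\<close> is read as \<open>m\<close> column
    blocks. Its block \<open>j0\<close>, multiplied by \<open>X\<close> on the left, selects the
    block of \<open>X\<close> for the first letter.\<close>
  have "foldl (*) ?I (map F [a..<a + length v]) \<in> carrier_mat (n * m) (m * m ^ length v * n) \<and>
    blk n ?e (foldl (*) ?I (map F [a..<a + length v])) = word_prod ?D (blk n j0 ?I) v"
  proof (rule blk_foldl_kron[OF I j0 v])
    fix i assume "i \<in> {a..<a + length v}"
    then obtain c where c: "i = a + c" "c < T" by (auto simp: T_def le_iff_add)
    then have \<tau>i: "\<tau> i \<in> S" by (intro \<tau>) (simp add: b a_def)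
    have "m ^ (i - b - 1) = m * m ^ (i - a)" by (simp add: c a_def)
    then show "F i = kron (1\<^sub>m (m * m ^ (i - a))) (KN_deriv n m G \<mu> (\<nu> i) (\<tau> i))"
      by (simp add: F_def)
    show "KN_deriv n m G \<mu> (\<nu> i) (\<tau> i) \<in> carrier_mat n (m * n)"
      using \<tau>i by (rule KN_deriv_blk)
    have "\<theta> - Suc (a + length v - Suc i) = i" using c by (simp add: \<theta>' flip: T_def)
    then show "blk n j (KN_deriv n m G \<mu> (\<nu> i) (\<tau> i)) = ?D (a + length v - Suc i) j" if "j < m" for j
      using KN_deriv_blk(2)[OF \<tau>i that] by simp
  qed
  then have P: "mat_prod (n * m) (map F [a..<\<theta>]) \<in> carrier_mat (n * m) (m ^ Suc T * n)"
    "blk n ?e (mat_prod (n * m) (map F [a..<\<theta>])) = word_prod ?D (blk n j0 ?I) v"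
    using \<theta>' by (simp_all add: mat_prod_def T_def mult.assoc)
  have X: "X \<in> carrier_mat n (n * m)" "blk n j0 X = mat_adjoint (mat_deriv j (\<lambda>s. Ns j0 s * Kis s) (?z (Suc T)))"
    unfolding X_def \<theta>'(2) using KN_deriv_blk[OF z[of "Suc T"]] j0 by (auto simp: mult.commute)
  define Y where "Y = KC_deriv G \<mu> (\<nu> \<theta>) (\<tau> \<theta>)"
  have Y: "Y \<in> carrier_mat n p" unfolding Y_def using z[of 0] by (intro KC_deriv_carrier) simp
  have W: "Wmat n m G \<mu> \<theta> \<tau> \<nu> \<eta> j = X * mat_prod (n * m) (map F [a..<\<theta>]) * kron (1\<^sub>m (m ^ Suc T)) Y"
    using \<eta> by (simp add: Wmat_def X_def F_def[abs_def] Y_def a_def b_def)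
  note XP = mult_carrier_mat[OF X(1) P(1)]
  have D: "?D t i \<in> carrier_mat n n" if "t < length v" "i \<in> set v" for t i
    using that v z
    by (intro mat_adjoint_carrier holo_mat_deriv_carrier[where S = S] holo_mat_mult[where b = n] N Ki)
      (auto simp: T_def)
  define M where "M = mat_adjoint (mat_deriv j (\<lambda>s. Ns j0 s * Kis s) (?z (Suc T)))"
  define Z where "Z = mat_deriv (?js T) (\<lambda>s. left ?js ?z v s * Kis s) (?z T)"
  have zT: "?z (Suc T) \<in> S" "?z T \<in> S" using z by auto
  have NK: "holo_mat S n n (\<lambda>s. Ns j0 s * Kis s)" by (intro holo_mat_mult[where b = n] N Ki j0)
  have Dj0: "mat_deriv j (\<lambda>s. Ns j0 s * Kis s) (?z (Suc T)) \<in> carrier_mat n n"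
    using NK zT(1) by (rule holo_mat_deriv_carrier)
  have M: "M \<in> carrier_mat n n" unfolding M_def using Dj0 by (rule mat_adjoint_carrier)
  have "holo_mat S p n (\<lambda>s. left ?js ?z v s * Kis s)"
    using v z by (intro holo_mat_mult[where b = n] left_holo Ki) (auto simp: T_def)
  then have Z: "Z \<in> carrier_mat p n" unfolding Z_def using zT(2) by (rule holo_mat_deriv_carrier)
  have E: "Z * (Ns j0 s * Kis s) = left ?js ?z u s * Kis s" if s: "s \<in> S" for s
  proof -
    have "left ?js ?z u s = Z * Ns j0 s"
      unfolding Cons left_factor.simps Z_def T_def ..
    then show ?thesis
      using assoc_mult_mat[OF Z holo_mat_carrier[OF N[OF j0] s] holo_mat_carrier[OF Ki s]] by simp
  qed
  have zv: "?z t \<in> S" if "t \<le> length v" for t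
    using that by (intro z) (simp add: T_def)
  have XI: "X * blk n j0 ?I = M"
    using blk_mult_left[OF X(1) I j0] right_mult_one_mat[OF X(1)] X(2) by (simp add: M_def)
  have XD: "X * word_prod ?D (blk n j0 ?I) v = word_prod ?D M v"
    unfolding XI[symmetric] by (rule word_prod_mult_left[symmetric, OF X(1) blk_carrier[OF I] D])
  have M_adj: "M * mat_adjoint Z = mat_adjoint (Z * mat_deriv j (\<lambda>s. Ns j0 s * Kis s) (?z (Suc T)))"
    unfolding M_def by (rule mat_adjoint_mult[symmetric, OF Z Dj0])
  have "blk p ?e (Wmat n m G \<mu> \<theta> \<tau> \<nu> \<eta> j) = X * word_prod ?D (blk n j0 ?I) v * Y"
    unfolding W blk_mult_kron_last[OF XP Y e] blk_mult_left[OF X(1) P(1) e] P(2) ..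
  also have "\<dots> = word_prod ?D M v * Y"
    by (simp only: XD)
  also have "\<dots> = M * mat_adjoint Z"
    unfolding Z_def Y_def KC_deriv_def T_def
    using word_prod_left_factor[where z = ?z and js = ?js, OF M v zv] by (simp only: diff_zero)
  also have "\<dots> = mat_adjoint (mat_deriv j (\<lambda>s. Z * (Ns j0 s * Kis s)) (?z (Suc T)))"
    unfolding M_adj mat_deriv_mult_left[OF S zT(1) Z NK] ..
  also have "\<dots> = mat_adjoint (mat_deriv j (\<lambda>s. left ?js ?z u s * Kis s) (?z (length u)))"
    using mat_deriv_cong[OF S zT(1) E] Cons by (simp only: T_def list.size add_Suc_right add_0_right)
  finally have "blk p (word_index m 0 u) (Wmat n m G \<mu> \<theta> \<tau> \<nu> \<eta> j)
    = mat_adjoint (mat_deriv j (\<lambda>s. left ?js ?z u s * Kis s) (?z (length u)))"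
    using Cons by simp
  moreover have "Wmat n m G \<mu> \<theta> \<tau> \<nu> \<eta> j \<in> carrier_mat n (m ^ Suc T * p)"
    unfolding W by (rule mult_carrier_mat[OF XP kron_carrier[OF one_carrier_mat Y]])
  ultimately show ?thesis
    unfolding \<eta>(1) diff_Suc_1 by (intro conjI)
qed

end

section \<open>Projected systems\<close>

text \<open>Here \<open>W\<close> has the shape of the adjoint of the projection matrix, so no
  conjugation occurs. \<open>Kih\<close> is the inverse of the projected \<open>K\<close>.\<close>

locale projected_system = G: holo_system n m p S C Ki B N
  for n m p :: nat and S :: "complex set"
    and C Ki B :: "complex \<Rightarrow> complex mat" and N :: "nat \<Rightarrow> complex \<Rightarrow> complex mat" +
  fixes r :: nat and V W :: "complex mat" and K Kih :: "complex \<Rightarrow> complex mat"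
  assumes V: "V \<in> carrier_mat n r" and W: "W \<in> carrier_mat r n"
    and K: "holo_mat S n n K" and Kih: "holo_mat S r r Kih"
    and KKi: "\<And>s. s \<in> S \<Longrightarrow> K s * Ki s = 1\<^sub>m n"
    and KiK: "\<And>s. s \<in> S \<Longrightarrow> Ki s * K s = 1\<^sub>m n"
    and KhKih: "\<And>s. s \<in> S \<Longrightarrow> W * K s * V * Kih s = 1\<^sub>m r"
    and KihKh: "\<And>s. s \<in> S \<Longrightarrow> Kih s * (W * K s * V) = 1\<^sub>m r"
begin

sublocale H: holo_system r m p S "\<lambda>s. C s * V" Kih "\<lambda>s. W * B s" "\<lambda>j s. W * N j s * V"
proof
  show "holo_mat S p r (\<lambda>s. C s * V)"
    by (rule holo_mat_mult[OF G.C holo_mat_const[OF V]])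
  show "holo_mat S r m (\<lambda>s. W * B s)"
    by (rule holo_mat_mult[OF holo_mat_const[OF W] G.B])
  show "holo_mat S r r (\<lambda>s. W * N j s * V)" if "j < m" for j
    by (rule holo_mat_mult[OF holo_mat_mult[OF holo_mat_const[OF W] G.N[OF that]] holo_mat_const[OF V]])
qed (rule G.S Kih)+

text \<open>This is the inverse of the reduced system lifted to the full state space; it replaces
  \<open>Ki\<close> when the two systems are compared.\<close>

lemmas holo = holo_mat_mult[OF holo_mat_const[OF V] holo_mat_mult[OF Kih holo_mat_const[OF W]]]

lemmas VKW = holo_mat_carrier[OF holo]

lemma carriers:
  assumes "s \<in> S"
  shows "C s \<in> carrier_mat p n" "Ki s \<in> carrier_mat n n" "B s \<in> carrier_mat n m"
    "K s \<in> carrier_mat n n" "Kih s \<in> carrier_mat r r" "j < m \<Longrightarrow> N j s \<in> carrier_mat n n"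
  using assms holo_mat_carrier G.C G.Ki G.B K Kih G.N by blast+

text \<open>\<open>V * Kih s * W * K s\<close> is a projection onto the column space of \<open>V\<close>, and it maps
  \<open>Ki s * X s\<close> to \<open>V * Kih s * W * X s\<close>.\<close>

lemma mat_deriv_projection_right:
  assumes z: "z \<in> S" and X: "holo_mat S n c X"
    and range: "\<And>i. i \<le> j \<Longrightarrow> \<exists>Y\<in>carrier_mat r c. mat_deriv i (\<lambda>s. Ki s * X s) z = V * Y"
  shows "mat_deriv j (\<lambda>s. V * (Kih s * W) * X s) z = mat_deriv j (\<lambda>s. Ki s * X s) z"
proof -
  have P: "holo_mat S n n (\<lambda>s. V * (Kih s * W) * K s)"
    by (rule holo_mat_mult[OF holo K])
  have I: "holo_mat S n n (\<lambda>_. 1\<^sub>m n)" by (rule holo_mat_const) simp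
  have KX: "holo_mat S n c (\<lambda>s. Ki s * X s)" by (rule holo_mat_mult[OF G.Ki X])
  have "mat_deriv j (\<lambda>s. V * (Kih s * W) * X s) z
      = mat_deriv j (\<lambda>s. V * (Kih s * W) * K s * (Ki s * X s)) z"
  proof (rule mat_deriv_cong[OF G.S z])
    fix s assume s: "s \<in> S"
    note c = carriers[OF s] holo_mat_carrier[OF X s] V W
    have "V * (Kih s * W) * K s * (Ki s * X s) = V * (Kih s * W) * (K s * Ki s * X s)"
      using c by (simp add: mult_mat_assoc)
    then show "V * (Kih s * W) * X s = V * (Kih s * W) * K s * (Ki s * X s)"
      unfolding KKi[OF s] using c by simp
  qed
  also have "\<dots> = mat_deriv j (\<lambda>s. 1\<^sub>m n * (Ki s * X s)) z"
  proof (rule mat_deriv_mult_eq_on_range[OF G.S z P I KX V _ range])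
    fix s assume s: "s \<in> S"
    note c = carriers[OF s] V W
    have "V * (Kih s * W) * K s * V = V * (Kih s * (W * K s * V))"
      using c by (simp add: mult_mat_assoc)
    then show "V * (Kih s * W) * K s * V = 1\<^sub>m n * V"
      unfolding KihKh[OF s] using c by simp
  qed
  also have "\<dots> = mat_deriv j (\<lambda>s. Ki s * X s) z"
  proof (rule mat_deriv_cong[OF G.S z])
    fix s assume s: "s \<in> S"
    show "1\<^sub>m n * (Ki s * X s) = Ki s * X s"
      using holo_mat_carrier[OF KX s] by (rule left_mult_one_mat)
  qed
  finally show ?thesis .
qed

text \<open>The dual projection \<open>K s * (V * (Kih s * W))\<close> is absorbed by
  \<open>W\<close> on its left, because \<open>W * K s * V * Kih s\<close> is the identity. It maps
  \<open>X s * Ki s\<close> to \<open>X s * (V * (Kih s * W))\<close>.\<close>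

lemma mat_deriv_projection_left:
  assumes z: "z \<in> S" and X: "holo_mat S c n X"
    and corange: "\<And>i. i \<le> j \<Longrightarrow> \<exists>Y\<in>carrier_mat c r. mat_deriv i (\<lambda>s. X s * Ki s) z = Y * W"
  shows "mat_deriv j (\<lambda>s. X s * (V * (Kih s * W))) z = mat_deriv j (\<lambda>s. X s * Ki s) z"
proof -
  have P: "holo_mat S n n (\<lambda>s. K s * (V * (Kih s * W)))"
    by (rule holo_mat_mult[OF K holo])
  have I: "holo_mat S n n (\<lambda>_. 1\<^sub>m n)" by (rule holo_mat_const) simp
  have XK: "holo_mat S c n (\<lambda>s. X s * Ki s)" by (rule holo_mat_mult[OF X G.Ki])
  have "mat_deriv j (\<lambda>s. X s * (V * (Kih s * W))) z
      = mat_deriv j (\<lambda>s. X s * Ki s * (K s * (V * (Kih s * W)))) z"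
  proof (rule mat_deriv_cong[OF G.S z])
    fix s assume s: "s \<in> S"
    note c = carriers[OF s] holo_mat_carrier[OF X s] V W
    have "X s * Ki s * (K s * (V * (Kih s * W))) = X s * (Ki s * K s * (V * (Kih s * W)))"
      using c by (simp add: mult_mat_assoc)
    then show "X s * (V * (Kih s * W)) = X s * Ki s * (K s * (V * (Kih s * W)))"
      unfolding KiK[OF s] left_mult_one_mat[OF VKW[OF s]] by simp
  qed
  also have "\<dots> = mat_deriv j (\<lambda>s. X s * Ki s * 1\<^sub>m n) z"
  proof (rule mat_deriv_mult_eq_on_corange[OF G.S z P I XK W _ corange])
    fix s assume s: "s \<in> S"
    note c = carriers[OF s] V W
    have "W * (K s * (V * (Kih s * W))) = W * K s * V * Kih s * W"
      using c by (simp add: mult_mat_assoc)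
    then show "W * (K s * (V * (Kih s * W))) = W * 1\<^sub>m n"
      unfolding KhKih[OF s] using c by simp
  qed
  also have "\<dots> = mat_deriv j (\<lambda>s. X s * Ki s) z"
  proof (rule mat_deriv_cong[OF G.S z])
    fix s assume s: "s \<in> S"
    show "X s * Ki s * 1\<^sub>m n = X s * Ki s"
      using holo_mat_carrier[OF XK s] by (rule right_mult_one_mat)
  qed
  finally show ?thesis .
qed

section \<open>Right factors of the projected system\<close>

context
  fixes k :: nat and l :: "nat \<Rightarrow> nat" and \<sigma> :: "nat \<Rightarrow> complex"
  assumes \<sigma>: "\<And>i. i \<in> {1..k} \<Longrightarrow> \<sigma> i \<in> S"
    and V_range: "\<And>w j. set w \<subseteq> {..<m} \<Longrightarrow> length w < k \<Longrightarrow> j \<le> l (Suc (length w)) \<Longrightarrow>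
      \<exists>Y\<in>carrier_mat r m. mat_deriv j (\<lambda>s. Ki s * G.right l \<sigma> w s) (\<sigma> (Suc (length w))) = V * Y"
begin

lemma right_holo:
  assumes "set w \<subseteq> {..<m}" "length w < k"
  shows "holo_mat S n m (G.right l \<sigma> w)"
  using assms \<sigma> by (intro G.right_holo) auto

text \<open>The function \<open>E\<close> is arbitrary so that one lemma serves the induction over
  words, with \<open>E = W * N j\<close>, and the final comparisons. Its derivatives are common to
  both sides, hence by the Leibniz rule only the derivatives of the remaining factor matter.\<close>

lemma mat_deriv_projection_right_factor:
  assumes w: "set w \<subseteq> {..<m}" "length w < k" and j: "j \<le> l (Suc (length w))"
    and E: "holo_mat S a n E"
    and H: "\<And>s. s \<in> S \<Longrightarrow> H.right l \<sigma> w s = W * G.right l \<sigma> w s"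
  shows "mat_deriv j (\<lambda>s. E s * V * Kih s * H.right l \<sigma> w s) (\<sigma> (Suc (length w)))
    = mat_deriv j (\<lambda>s. E s * Ki s * G.right l \<sigma> w s) (\<sigma> (Suc (length w)))"
proof -
  let ?z = "\<sigma> (Suc (length w))" and ?R = "G.right l \<sigma> w"
  have z: "?z \<in> S" using \<sigma> w by simp
  note R = right_holo[OF w]
  have "mat_deriv j (\<lambda>s. E s * V * Kih s * H.right l \<sigma> w s) ?z
      = mat_deriv j (\<lambda>s. E s * (V * (Kih s * W) * ?R s)) ?z"
  proof (rule mat_deriv_cong[OF G.S z])
    fix s assume s: "s \<in> S"
    show "E s * V * Kih s * H.right l \<sigma> w s = E s * (V * (Kih s * W) * ?R s)"
      unfolding H[OF s]
      using carriers[OF s] holo_mat_carrier[OF R s] holo_mat_carrier[OF E s] V W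
      by (simp add: mult_mat_assoc)
  qed
  also have "\<dots> = mat_deriv j (\<lambda>s. E s * (Ki s * ?R s)) ?z"
  proof (rule mat_deriv_mult_cong[OF G.S z E holo_mat_mult[OF holo R] E holo_mat_mult[OF G.Ki R]])
    fix i assume "i \<le> j"
    have "mat_deriv (j - i) (\<lambda>s. V * (Kih s * W) * ?R s) ?z = mat_deriv (j - i) (\<lambda>s. Ki s * ?R s) ?z"
      by (rule mat_deriv_projection_right[OF z R V_range[OF w]]) (use j in auto)
    then show "mat_deriv i E ?z * mat_deriv (j - i) (\<lambda>s. V * (Kih s * W) * ?R s) ?z
      = mat_deriv i E ?z * mat_deriv (j - i) (\<lambda>s. Ki s * ?R s) ?z" by (rule arg_cong)
  qed
  also have "\<dots> = mat_deriv j (\<lambda>s. E s * Ki s * ?R s) ?z"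
  proof (rule mat_deriv_cong[OF G.S z])
    fix s assume s: "s \<in> S"
    show "E s * (Ki s * ?R s) = E s * Ki s * ?R s"
      by (rule assoc_mult_mat[symmetric, OF holo_mat_carrier[OF E s] carriers(2)[OF s] holo_mat_carrier[OF R s]])
  qed
  finally show ?thesis .
qed

lemma projected_right_factor:
  "set w \<subseteq> {..<m} \<Longrightarrow> length w < k \<Longrightarrow> s \<in> S \<Longrightarrow> H.right l \<sigma> w s = W * G.right l \<sigma> w s"
proof (induction w arbitrary: s)
  case (Cons j w)
  let ?q = "Suc (length w)"
  have w: "set w \<subseteq> {..<m}" "length w < k" and j: "j < m" and q: "\<sigma> ?q \<in> S"
    using Cons.prems \<sigma> by auto
  have WN: "holo_mat S r n (\<lambda>s. W * N j s)"
    by (rule holo_mat_mult[OF holo_mat_const[OF W] G.N[OF j]])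
  have NKR: "holo_mat S n m (\<lambda>s. N j s * Ki s * G.right l \<sigma> w s)"
    by (rule holo_mat_mult[OF holo_mat_mult[OF G.N[OF j] G.Ki] right_holo[OF w]])
  have "H.right l \<sigma> (j # w) s
      = mat_deriv (l ?q) (\<lambda>s. W * N j s * V * Kih s * H.right l \<sigma> w s) (\<sigma> ?q)"
    by simp
  \<comment> \<open>Inside a right factor the order is exactly \<open>l ?q\<close>, the highest one
    covered by \<open>V_range\<close>.\<close>
  also have "\<dots> = mat_deriv (l ?q) (\<lambda>s. W * N j s * Ki s * G.right l \<sigma> w s) (\<sigma> ?q)"
    by (rule mat_deriv_projection_right_factor[OF w order_refl WN Cons.IH[OF w]])
  also have "\<dots> = mat_deriv (l ?q) (\<lambda>s. W * (N j s * Ki s * G.right l \<sigma> w s)) (\<sigma> ?q)"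
  proof (rule mat_deriv_cong[OF G.S q])
    fix s assume s: "s \<in> S"
    show "W * N j s * Ki s * G.right l \<sigma> w s = W * (N j s * Ki s * G.right l \<sigma> w s)"
      using carriers[OF s] carriers(6)[OF s j] holo_mat_carrier[OF right_holo[OF w] s] W
      by (simp add: mult_mat_assoc)
  qed
  also have "\<dots> = W * G.right l \<sigma> (j # w) s"
    using mat_deriv_mult_left[OF G.S q W NKR] by simp
  finally show ?case .
qed simp

lemma mat_deriv_projected_right:
  assumes w: "set w \<subseteq> {..<m}" "length w < k" and j: "j \<le> l (Suc (length w))"
    and E: "holo_mat S a n E"
  shows "mat_deriv j (\<lambda>s. E s * V * Kih s * H.right l \<sigma> w s) (\<sigma> (Suc (length w)))
    = mat_deriv j (\<lambda>s. E s * Ki s * G.right l \<sigma> w s) (\<sigma> (Suc (length w)))"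
  by (rule mat_deriv_projection_right_factor[OF w j E]) (rule projected_right_factor[OF w])

end

section \<open>Left factors of the projected system\<close>

context
  fixes \<theta> :: nat and js :: "nat \<Rightarrow> nat" and z :: "nat \<Rightarrow> complex"
  assumes z: "\<And>t. t < \<theta> \<Longrightarrow> z t \<in> S"
    and W_range: "\<And>u j. set u \<subseteq> {..<m} \<Longrightarrow> length u < \<theta> \<Longrightarrow> j \<le> js (length u) \<Longrightarrow>
      \<exists>Y\<in>carrier_mat p r. mat_deriv j (\<lambda>s. G.left js z u s * Ki s) (z (length u)) = Y * W"
begin

lemma left_holo:
  assumes "set u \<subseteq> {..<m}" "length u < \<theta>"
  shows "holo_mat S p n (G.left js z u)"
  using assms z by (intro G.left_holo) auto

text \<open>The derivatives have \<open>r\<close> and \<open>n\<close> columns; multiplication by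
  \<open>W\<close> makes them comparable. In a left factor the next bilinear matrix stands outside
  the derivative and supplies this \<open>W\<close>.\<close>

lemma mat_deriv_projection_left_factor:
  assumes u: "set u \<subseteq> {..<m}" "length u < \<theta>" and j: "j \<le> js (length u)"
    and H: "\<And>s. s \<in> S \<Longrightarrow> H.left js z u s = G.left js z u s * V"
  shows "mat_deriv j (\<lambda>s. H.left js z u s * Kih s) (z (length u)) * W
    = mat_deriv j (\<lambda>s. G.left js z u s * Ki s) (z (length u))"
proof -
  let ?z = "z (length u)" and ?L = "G.left js z u"
  have zS: "?z \<in> S" using z u by simp
  note L = left_holo[OF u]
  have HL: "holo_mat S p r (\<lambda>s. H.left js z u s * Kih s)"
    using u z by (intro holo_mat_mult[OF H.left_holo Kih]) auto
  have "mat_deriv j (\<lambda>s. H.left js z u s * Kih s) ?z * W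
      = mat_deriv j (\<lambda>s. H.left js z u s * Kih s * W) ?z"
    by (rule mat_deriv_mult_right[symmetric, OF G.S zS HL W])
  also have "\<dots> = mat_deriv j (\<lambda>s. ?L s * (V * (Kih s * W))) ?z"
  proof (rule mat_deriv_cong[OF G.S zS])
    fix s assume s: "s \<in> S"
    show "H.left js z u s * Kih s * W = ?L s * (V * (Kih s * W))"
      unfolding H[OF s] using carriers[OF s] holo_mat_carrier[OF L s] V W
      by (simp add: mult_mat_assoc)
  qed
  also have "\<dots> = mat_deriv j (\<lambda>s. ?L s * Ki s) ?z"
    by (rule mat_deriv_projection_left[OF zS L W_range[OF u]]) (use j in auto)
  finally show ?thesis .
qed

lemma projected_left_factor:
  "set u \<subseteq> {..<m} \<Longrightarrow> length u < \<theta> \<Longrightarrow> s \<in> S \<Longrightarrow> H.left js z u s = G.left js z u s * V"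
proof (induction u arbitrary: s)
  case (Cons j u)
  have u: "set u \<subseteq> {..<m}" "length u < \<theta>" and j: "j < m" and zS: "z (length u) \<in> S"
    using Cons.prems z by auto
  define M where "M = mat_deriv (js (length u)) (\<lambda>s. H.left js z u s * Kih s) (z (length u))"
  have "holo_mat S p r (\<lambda>s. H.left js z u s * Kih s)"
    using u z by (intro holo_mat_mult[OF H.left_holo Kih]) auto
  then have M: "M \<in> carrier_mat p r" unfolding M_def using zS by (rule holo_mat_deriv_carrier)
  have MW: "M * W = mat_deriv (js (length u)) (\<lambda>s. G.left js z u s * Ki s) (z (length u))"
    unfolding M_def by (rule mat_deriv_projection_left_factor[OF u order_refl Cons.IH[OF u]])
  have "H.left js z (j # u) s = M * (W * N j s * V)" by (simp add: M_def)
  also have "\<dots> = M * W * N j s * V"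
    using M V W carriers(6)[OF Cons.prems(3) j] by (simp add: mult_mat_assoc)
  also have "\<dots> = G.left js z (j # u) s * V"
    by (simp add: MW)
  finally show ?case .
qed simp

lemma mat_deriv_projected_left:
  assumes u: "set u \<subseteq> {..<m}" "length u < \<theta>" and j: "j \<le> js (length u)"
  shows "mat_deriv j (\<lambda>s. H.left js z u s * Kih s) (z (length u)) * W
    = mat_deriv j (\<lambda>s. G.left js z u s * Ki s) (z (length u))"
  by (rule mat_deriv_projection_left_factor[OF u j]) (rule projected_left_factor[OF u])

text \<open>Here \<open>W\<close> is supplied by the matrix to the right, which for
  \<open>E = B\<close> is the input matrix of the reduced system.\<close>

lemma mat_deriv_projected_left_mult:
  assumes u: "set u \<subseteq> {..<m}" "length u < \<theta>" and j: "j \<le> js (length u)" and E: "holo_mat S n c E"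
  shows "mat_deriv j (\<lambda>s. H.left js z u s * Kih s * (W * E s)) (z (length u))
    = mat_deriv j (\<lambda>s. G.left js z u s * Ki s * E s) (z (length u))"
proof -
  let ?z = "z (length u)" and ?L = "G.left js z u"
  have zS: "?z \<in> S" using z u by simp
  note L = left_holo[OF u]
  have HL: "holo_mat S p r (\<lambda>s. H.left js z u s * Kih s)"
    using u z by (intro holo_mat_mult[OF H.left_holo Kih]) auto
  have HLW: "holo_mat S p n (\<lambda>s. H.left js z u s * Kih s * W)"
    by (rule holo_mat_mult[OF HL holo_mat_const[OF W]])
  have "mat_deriv j (\<lambda>s. H.left js z u s * Kih s * (W * E s)) ?z
      = mat_deriv j (\<lambda>s. H.left js z u s * Kih s * W * E s) ?z"
  proof (rule mat_deriv_cong[OF G.S zS])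
    fix s assume s: "s \<in> S"
    show "H.left js z u s * Kih s * (W * E s) = H.left js z u s * Kih s * W * E s"
      by (rule assoc_mult_mat[symmetric, OF holo_mat_carrier[OF HL s] W holo_mat_carrier[OF E s]])
  qed
  also have "\<dots> = mat_deriv j (\<lambda>s. ?L s * Ki s * E s) ?z"
  proof (rule mat_deriv_mult_cong[OF G.S zS HLW E holo_mat_mult[OF L G.Ki] E])
    fix i assume i: "i \<le> j"
    have "mat_deriv i (\<lambda>s. H.left js z u s * Kih s * W) ?z = mat_deriv i (\<lambda>s. ?L s * Ki s) ?z"
      using mat_deriv_projected_left[OF u, of i] i j mat_deriv_mult_right[OF G.S zS HL W, of i]
      by simp
    then show "mat_deriv i (\<lambda>s. H.left js z u s * Kih s * W) ?z * mat_deriv (j - i) E ?z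
      = mat_deriv i (\<lambda>s. ?L s * Ki s) ?z * mat_deriv (j - i) E ?z" by simp
  qed
  finally show ?thesis .
qed

end

end

text \<open>\<open>W\<close> is now the projection matrix itself; its adjoint takes the role of
  \<open>W\<close> in \<open>projected_system\<close>.\<close>

locale reduced_bilinear_at =
  projected_system n m p S "\<lambda>s. Cfun G s \<mu>" "\<lambda>s. Kinv G s \<mu>" "\<lambda>s. Bfun G s \<mu>"
    "\<lambda>j s. Nfun G (Suc j) s \<mu>" r V "mat_adjoint W" "\<lambda>s. Kfun G s \<mu>"
    "\<lambda>s. Kinv (reduced_system V W G) s \<mu>"
  for n m p S G \<mu> r V W +
  assumes m: "m \<ge> 1" and W_carrier: "W \<in> carrier_mat n r"
begin

abbreviation "Gr \<equiv> reduced_system V W G"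

sublocale BG: bilinear_at n m p S G \<mu> ..

sublocale BH: bilinear_at r m p S Gr \<mu>
  unfolding bilinear_at_def
  using H.holo_system_axioms by (simp add: reduced_system_def)

lemma Gr_simps:
  "Cfun Gr s \<mu> = Cfun G s \<mu> * V" "Bfun Gr s \<mu> = mat_adjoint W * Bfun G s \<mu>"
  "Nfun Gr j s \<mu> = mat_adjoint W * Nfun G j s \<mu> * V"
  by (simp_all add: reduced_system_def)

text \<open>The state dimensions differ, but the blocks of both transfer functions are
  \<open>p\<close> by \<open>m\<close> and indexed by the same words. Each word may be split where
  it is convenient.\<close>

lemma mixed_deriv_transfer_function_eqI:
  assumes k: "k \<ge> 1" and z: "\<And>i. i \<in> {1..k} \<Longrightarrow> z i \<in> S"
    and eq: "\<And>v. set v \<subseteq> {..<m} \<Longrightarrow> length v = k - 1 \<Longrightarrow>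
      \<exists>u w. v = rev u @ w \<and> G.word_deriv k js z u w = H.word_deriv k js z u w"
  shows "mixed_deriv k js (transfer_function n m G k \<mu>) z
    = mixed_deriv k js (transfer_function r m Gr k \<mu>) z"
proof (rule blk_eqI[OF BG.mixed_deriv_transfer_function_carrier[OF k _ z]
      BH.mixed_deriv_transfer_function_carrier[OF k _ z]])
  fix e assume "e < m ^ (k - 1)"
  then have "e < 1 * m ^ (k - 1)" by simp
  then obtain e0 v where v: "e0 < 1" "length v = k - 1" "set v \<subseteq> {..<m}" "e = word_index m e0 v"
    by (rule word_index_surj)
  obtain u w where uw: "v = rev u @ w" "G.word_deriv k js z u w = H.word_deriv k js z u w"
    using eq[OF v(3,2)] by blast
  have len: "k = Suc (length u + length w)" and "set u \<subseteq> {..<m}" "set w \<subseteq> {..<m}"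
    using v uw(1) k by auto
  note * = this
  show "blk m e (mixed_deriv k js (transfer_function n m G k \<mu>) z)
    = blk m e (mixed_deriv k js (transfer_function r m Gr k \<mu>) z)"
    using BG.blk_mixed_deriv_transfer_function[OF * z] BH.blk_mixed_deriv_transfer_function[OF * z]
      uw v by (simp add: Gr_simps)
qed (use m in auto)

section \<open>Interpolation from the span of \<open>V\<close>\<close>

context
  fixes k :: nat and l :: "nat \<Rightarrow> nat" and \<sigma> :: "nat \<Rightarrow> complex"
  assumes \<sigma>: "\<And>i. i \<in> {1..k} \<Longrightarrow> \<sigma> i \<in> S"
    and spanV: "\<And>q j. q \<in> {1..k} \<Longrightarrow> j \<le> l q \<Longrightarrow> cols_in_span n (Vmat n m G \<mu> \<sigma> l q j) V"
begin

lemma V_range: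
  assumes w: "set w \<subseteq> {..<m}" "length w < k" and j: "j \<le> l (Suc (length w))"
  shows "\<exists>Y\<in>carrier_mat r m. mat_deriv j (\<lambda>s. Kinv G s \<mu> * G.right l \<sigma> w s) (\<sigma> (Suc (length w))) = V * Y"
proof -
  let ?q = "Suc (length w)" and ?e = "word_index m 0 w"
  have Vm: "Vmat n m G \<mu> \<sigma> l ?q j \<in> carrier_mat n (m ^ (?q - 1) * m)"
    "blk m ?e (Vmat n m G \<mu> \<sigma> l ?q j)
      = mat_deriv j (\<lambda>s. Kinv G s \<mu> * G.right l \<sigma> w s) (\<sigma> ?q)"
    using BG.blk_Vmat[OF w(1), of \<sigma> l j] \<sigma> w(2) by auto
  have e: "?e < m ^ (?q - 1)" using word_index_less[of 0 1 w m] w by simp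
  have "cols_in_span n (blk m ?e (Vmat n m G \<mu> \<sigma> l ?q j)) V"
    using w j by (intro cols_in_span_blk[OF Vm(1) e] spanV) auto
  from cols_in_span_factor[OF blk_carrier[OF Vm(1)] V this] show ?thesis
    unfolding Vm(2) .
qed

lemma interpolation_right:
  assumes q: "q \<in> {1..k}" and j: "j \<le> l q"
  shows "mixed_deriv q (l(q := j)) (transfer_function n m G q \<mu>) \<sigma>
    = mixed_deriv q (l(q := j)) (transfer_function r m Gr q \<mu>) \<sigma>"
proof (rule mixed_deriv_transfer_function_eqI)
  fix v :: "nat list" assume v: "set v \<subseteq> {..<m}" "length v = q - 1"
  then have len: "Suc (length v) = q" "length v < k" using q by auto
  \<comment> \<open>With all letters on the right the distinguished variable is the last one, and
    its order \<open>j\<close> does not enter the right factor.\<close>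
  have R: "right_factor Ki B N (l(q := j)) \<sigma> v = right_factor Ki B N l \<sigma> v" for Ki B N
    using len by (intro right_factor_cong) auto
  have "H.word_deriv q (l(q := j)) \<sigma> [] v = G.word_deriv q (l(q := j)) \<sigma> [] v"
    using mat_deriv_projected_right[OF \<sigma> V_range v(1) len(2) _ G.C, of j] j len(1)
    by (simp add: H.word_deriv_def G.word_deriv_def R Gr_simps)
  then show "\<exists>u w. v = rev u @ w \<and>
      G.word_deriv q (l(q := j)) \<sigma> u w = H.word_deriv q (l(q := j)) \<sigma> u w"
    by (intro exI[of _ "[]"] exI[of _ v]) simp
qed (use q \<sigma> in auto)

end

section \<open>Interpolation from the span of \<open>W\<close>, alone and together with that of
  \<open>V\<close>\<close>

context
  fixes \<theta> :: nat and \<nu> :: "nat \<Rightarrow> nat" and \<tau> :: "nat \<Rightarrow> complex"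
  assumes \<tau>: "\<And>i. i \<in> {1..\<theta>} \<Longrightarrow> \<tau> i \<in> S"
    and spanW: "\<And>\<eta> i. \<eta> \<in> {1..\<theta>} \<Longrightarrow> i \<le> \<nu> (\<theta> - \<eta> + 1) \<Longrightarrow> cols_in_span n (Wmat n m G \<mu> \<theta> \<tau> \<nu> \<eta> i) W"
begin

lemma \<tau>_rev: "t < \<theta> \<Longrightarrow> \<tau> (\<theta> - t) \<in> S"
  by (rule \<tau>) auto

lemma W_range:
  assumes u: "set u \<subseteq> {..<m}" "length u < \<theta>" and j: "j \<le> \<nu> (\<theta> - length u)"
  shows "\<exists>Y\<in>carrier_mat p r. mat_deriv j (\<lambda>s. G.left (\<lambda>t. \<nu> (\<theta> - t)) (\<lambda>t. \<tau> (\<theta> - t)) u s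
    * Kinv G s \<mu>) (\<tau> (\<theta> - length u)) = Y * mat_adjoint W"
proof -
  let ?\<eta> = "Suc (length u)" and ?e = "word_index m 0 u"
  let ?D = "mat_deriv j (\<lambda>s. G.left (\<lambda>t. \<nu> (\<theta> - t)) (\<lambda>t. \<tau> (\<theta> - t)) u s * Kinv G s \<mu>) (\<tau> (\<theta> - length u))"
  have Wm: "Wmat n m G \<mu> \<theta> \<tau> \<nu> ?\<eta> j \<in> carrier_mat n (m ^ (?\<eta> - 1) * p)"
    "blk p ?e (Wmat n m G \<mu> \<theta> \<tau> \<nu> ?\<eta> j) = mat_adjoint ?D"
    using BG.blk_Wmat[where \<nu> = \<nu> and j = j, OF u(1) \<tau> u(2)] by auto
  have e: "?e < m ^ (?\<eta> - 1)" using word_index_less[of 0 1 u m] u by simp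
  have "\<theta> - ?\<eta> + 1 = \<theta> - length u" using u by linarith
  then have "cols_in_span n (blk p ?e (Wmat n m G \<mu> \<theta> \<tau> \<nu> ?\<eta> j)) W"
    using u j by (intro cols_in_span_blk[OF Wm(1) e] spanW) auto
  from cols_in_span_factor[OF blk_carrier[OF Wm(1)] W_carrier this]
  obtain Y where Y: "Y \<in> carrier_mat r p" "mat_adjoint ?D = W * Y"
    unfolding Wm(2) by blast
  have "?D = mat_adjoint Y * mat_adjoint W"
    using mat_adjoint_mult[OF W_carrier Y(1)] Y(2) mat_adjoint_adjoint[of ?D] by simp
  then show ?thesis using mat_adjoint_carrier[OF Y(1)] by blast
qed

text \<open>With all letters on the left the distinguished variable is the first one, and its order
  \<open>i\<close> is free. Counted from the last variable, the points and orders are those at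
  \<open>\<theta> - t\<close>, whatever \<open>\<eta>\<close> is.\<close>

lemma interpolation_left:
  assumes \<eta>: "\<eta> \<in> {1..\<theta>}" and i: "i \<le> \<nu> (\<theta> - \<eta> + 1)"
  defines "js \<equiv> (\<lambda>a. \<nu> (\<theta> - \<eta> + a))(1 := i)" and "z \<equiv> (\<lambda>a. \<tau> (\<theta> - \<eta> + a))"
  shows "mixed_deriv \<eta> js (transfer_function n m G \<eta> \<mu>) z
    = mixed_deriv \<eta> js (transfer_function r m Gr \<eta> \<mu>) z"
proof (rule mixed_deriv_transfer_function_eqI)
  fix v :: "nat list" assume v: "set v \<subseteq> {..<m}" "length v = \<eta> - 1"
  define u where "u = rev v"
  have u: "set u \<subseteq> {..<m}" "Suc (length u) = \<eta>" "length u < \<theta>"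
    using v \<eta> by (auto simp: u_def)
  obtain b where b: "\<theta> = b + \<eta>" using \<eta> by (metis atLeastAtMost_iff le_iff_add add.commute)
  have L: "left_factor C Ki N (\<lambda>t. js (\<eta> - t)) (\<lambda>t. z (\<eta> - t)) u
    = left_factor C Ki N (\<lambda>t. \<nu> (\<theta> - t)) (\<lambda>t. \<tau> (\<theta> - t)) u" for C Ki N
  proof (rule left_factor_cong)
    fix t assume "t < length u"
    then have "t < \<eta>" "\<eta> - t \<noteq> 1" using u(2) by auto
    then show "js (\<eta> - t) = \<nu> (\<theta> - t) \<and> z (\<eta> - t) = \<tau> (\<theta> - t)"
      by (simp add: js_def z_def b)
  qed
  have z1: "z (Suc 0) = \<tau> (\<theta> - length u)" "i \<le> \<nu> (\<theta> - length u)" "js (Suc 0) = i"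
    using u(2) i by (auto simp: z_def js_def b)
  have "H.word_deriv \<eta> js z u [] = G.word_deriv \<eta> js z u []"
    unfolding H.word_deriv_def G.word_deriv_def list.size z1 L right_factor.simps
    by (rule mat_deriv_projected_left_mult[OF \<tau>_rev W_range u(1,3) z1(2) G.B])
  then show "\<exists>u w. v = rev u @ w \<and> G.word_deriv \<eta> js z u w = H.word_deriv \<eta> js z u w"
    by (intro exI[of _ u] exI[of _ "[]"]) (simp add: u_def)
next
  fix a assume "a \<in> {1..\<eta>}"
  then show "z a \<in> S" unfolding z_def using \<eta> by (intro \<tau>) auto
qed (use \<eta> in auto)

context
  fixes k :: nat and l :: "nat \<Rightarrow> nat" and \<sigma> :: "nat \<Rightarrow> complex"
  assumes \<sigma>: "\<And>i. i \<in> {1..k} \<Longrightarrow> \<sigma> i \<in> S"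
    and spanV: "\<And>q j. q \<in> {1..k} \<Longrightarrow> j \<le> l q \<Longrightarrow> cols_in_span n (Vmat n m G \<mu> \<sigma> l q j) V"
begin

text \<open>The two one-sided results are applied in turn. The condition on \<open>W\<close>
  replaces the part in the variables above \<open>q\<close>, differentiated to \<open>Mh\<close>, by
  its counterpart \<open>M\<close> of the full system. Then \<open>M\<close> times a bilinear matrix
  is a holomorphic function to the left of \<open>V\<close>, to which
  \<open>mat_deriv_projected_right\<close> applies.\<close>

lemma interpolation_two_sided:
  assumes q: "q \<in> {1..k}" and j: "j \<le> l q"
    and \<eta>: "\<eta> \<in> {1..\<theta>}" and i: "i \<le> \<nu> (\<theta> - \<eta> + 1)"
  defines "js \<equiv> (\<lambda>a. if a \<le> q then l a else \<nu> (\<theta> - \<eta> + (a - q)))(q := j, q + 1 := i)"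
    and "z \<equiv> (\<lambda>a. if a \<le> q then \<sigma> a else \<tau> (\<theta> - \<eta> + (a - q)))"
  shows "mixed_deriv (q + \<eta>) js (transfer_function n m G (q + \<eta>) \<mu>) z
    = mixed_deriv (q + \<eta>) js (transfer_function r m Gr (q + \<eta>) \<mu>) z"
proof (rule mixed_deriv_transfer_function_eqI)
  fix v :: "nat list" assume v: "set v \<subseteq> {..<m}" "length v = q + \<eta> - 1"
  \<comment> \<open>The last \<open>q - 1\<close> letters form \<open>w\<close>. The letter
    \<open>j0\<close> before them is the one whose bilinear matrix is evaluated at variable
    \<open>q\<close>, and \<open>u\<close> holds the earlier letters reversed.\<close>
  define w where "w = drop \<eta> v"
  have vw: "v = take \<eta> v @ w" by (simp add: w_def)
  have "length (rev (take \<eta> v)) = \<eta>" using v q by auto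
  moreover have "\<eta> = Suc (\<eta> - 1)" using \<eta> by simp
  ultimately obtain j0 u where ju: "rev (take \<eta> v) = j0 # u" "length u = \<eta> - 1"
    by (metis length_Suc_conv)
  have vuw: "v = rev (j0 # u) @ w" using vw by (metis ju(1) rev_rev_ident)
  have sets: "set u \<subseteq> {..<m}" "set w \<subseteq> {..<m}" and j0: "j0 < m"
    using v(1) unfolding vuw by auto
  have w: "Suc (length w) = q" "length w < k" and u: "Suc (length u) = \<eta>" "length u < \<theta>"
    using v q \<eta> ju(2) by (auto simp: w_def)
  obtain b where b: "\<theta> = b + \<eta>" using \<eta> by (metis atLeastAtMost_iff le_iff_add add.commute)
  have R: "right_factor Ki B N js z w = right_factor Ki B N l \<sigma> w" for Ki B N
    using w(1) by (intro right_factor_cong) (auto simp: js_def z_def)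
  have L: "left_factor C Ki N (\<lambda>t. js (q + \<eta> - t)) (\<lambda>t. z (q + \<eta> - t)) u
    = left_factor C Ki N (\<lambda>t. \<nu> (\<theta> - t)) (\<lambda>t. \<tau> (\<theta> - t)) u" for C Ki N
  proof (rule left_factor_cong)
    fix t assume "t < length u"
    then obtain c where "\<eta> = t + (c + 2)" using u(1) by (metis add_2_eq_Suc' less_iff_Suc_add add_Suc_right)
    then show "js (q + \<eta> - t) = \<nu> (\<theta> - t) \<and> z (q + \<eta> - t) = \<tau> (\<theta> - t)"
      by (simp add: js_def z_def b)
  qed
  have top: "js (q + \<eta> - length u) = i" "z (q + \<eta> - length u) = \<tau> (\<theta> - length u)"
    "i \<le> \<nu> (\<theta> - length u)" "js q = j" "z q = \<sigma> q"
    using u(1) i by (auto simp: js_def z_def b)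
  let ?jt = "\<lambda>t. \<nu> (\<theta> - t)" and ?zt = "\<lambda>t. \<tau> (\<theta> - t)"
  define M where "M = mat_deriv i (\<lambda>s. G.left ?jt ?zt u s * Kinv G s \<mu>) (\<tau> (\<theta> - length u))"
  define Mh where "Mh = mat_deriv i (\<lambda>s. H.left ?jt ?zt u s * Kinv Gr s \<mu>) (\<tau> (\<theta> - length u))"
  have \<tau>u: "\<tau> (\<theta> - length u) \<in> S" using u(2) by (rule \<tau>_rev)
  have "holo_mat S p n (\<lambda>s. G.left ?jt ?zt u s * Kinv G s \<mu>)"
    using sets u(2) \<tau>_rev by (intro holo_mat_mult[OF G.left_holo G.Ki]) auto
  then have M: "M \<in> carrier_mat p n" unfolding M_def using \<tau>u by (rule holo_mat_deriv_carrier)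
  have "holo_mat S p r (\<lambda>s. H.left ?jt ?zt u s * Kinv Gr s \<mu>)"
    using sets u(2) \<tau>_rev by (intro holo_mat_mult[OF H.left_holo Kih]) auto
  then have Mh: "Mh \<in> carrier_mat p r" unfolding Mh_def using \<tau>u by (rule holo_mat_deriv_carrier)
  have MhW: "Mh * mat_adjoint W = M"
    using mat_deriv_projected_left[OF \<tau>_rev W_range sets(1) u(2) top(3)]
    by (simp add: M_def Mh_def)
  have MN: "holo_mat S p n (\<lambda>s. M * Nfun G (Suc j0) s \<mu>)"
    by (rule holo_mat_mult[OF holo_mat_const[OF M] G.N[OF j0]])
  note rV = V_range[of k \<sigma> l, OF \<sigma> spanV]
  have \<sigma>q: "\<sigma> q \<in> S" using \<sigma> q by blast
  have "H.word_deriv (q + \<eta>) js z (j0 # u) w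
      = mat_deriv j (\<lambda>s. Mh * (mat_adjoint W * Nfun G (Suc j0) s \<mu> * V) * Kinv Gr s \<mu> * H.right l \<sigma> w s) (\<sigma> q)"
    unfolding H.word_deriv_def left_factor.simps w(1) L top R Mh_def ..
  also have "\<dots> = mat_deriv j (\<lambda>s. M * Nfun G (Suc j0) s \<mu> * V * Kinv Gr s \<mu> * H.right l \<sigma> w s) (\<sigma> q)"
  proof (rule mat_deriv_cong[OF G.S \<sigma>q])
    fix s assume s: "s \<in> S"
    have "Mh * (mat_adjoint W * Nfun G (Suc j0) s \<mu> * V) = M * Nfun G (Suc j0) s \<mu> * V"
      unfolding MhW[symmetric] using Mh W V carriers(6)[OF s j0] by (simp add: mult_mat_assoc)
    then show "Mh * (mat_adjoint W * Nfun G (Suc j0) s \<mu> * V) * Kinv Gr s \<mu> * H.right l \<sigma> w s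
      = M * Nfun G (Suc j0) s \<mu> * V * Kinv Gr s \<mu> * H.right l \<sigma> w s" by simp
  qed
  also have "\<dots> = mat_deriv j (\<lambda>s. M * Nfun G (Suc j0) s \<mu> * Kinv G s \<mu> * G.right l \<sigma> w s) (\<sigma> q)"
    using mat_deriv_projected_right[OF \<sigma> rV sets(2) w(2) _ MN, of j] j w(1)
    by simp
  also have "\<dots> = G.word_deriv (q + \<eta>) js z (j0 # u) w"
    unfolding G.word_deriv_def left_factor.simps w(1) L top R M_def ..
  finally show "\<exists>u w. v = rev u @ w \<and>
      G.word_deriv (q + \<eta>) js z u w = H.word_deriv (q + \<eta>) js z u w"
    using vuw by (intro exI[of _ "j0 # u"] exI[of _ w]) simp
next
  fix a assume "a \<in> {1..q + \<eta>}"
  then show "z a \<in> S" unfolding z_def using \<eta> q by (auto intro!: \<sigma> \<tau> simp del: diff_add_assoc2 Nat.add_diff_assoc2)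
qed (use q in auto)

end

end

end

text \<open>The domain consists of all points at which the hypotheses hold, so it is open by the
  lemmas on analyticity, and the pointwise inverses are true inverses on it.\<close>

lemma reduced_bilinear_at_analytic:
  assumes m: "m \<ge> 1" and V: "V \<in> carrier_mat n r" and W: "W \<in> carrier_mat n r"
    and G: "\<And>s. Cfun G s \<mu> \<in> carrier_mat p n \<and> Kfun G s \<mu> \<in> carrier_mat n n \<and>
      Bfun G s \<mu> \<in> carrier_mat n m \<and> (\<forall>j\<in>{1..m}. Nfun G j s \<mu> \<in> carrier_mat n n)"
  defines "S \<equiv> {z. mat_analytic_at p n (\<lambda>s. Cfun G s \<mu>) z \<and> inv_analytic_at n (\<lambda>s. Kfun G s \<mu>) z
    \<and> mat_analytic_at n (n * m) (\<lambda>s. Nhor n m G s \<mu>) z \<and> mat_analytic_at n m (\<lambda>s. Bfun G s \<mu>) z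
    \<and> inv_analytic_at r (\<lambda>s. Kfun (reduced_system V W G) s \<mu>) z}"
  shows "reduced_bilinear_at n m p S G \<mu> r V W"
proof -
  let ?H = "reduced_system V W G"
  note W' = mat_adjoint_carrier[OF W]
  have c: "Cfun G s \<mu> \<in> carrier_mat p n" "Kfun G s \<mu> \<in> carrier_mat n n"
    "Bfun G s \<mu> \<in> carrier_mat n m" "j < m \<Longrightarrow> Nfun G (Suc j) s \<mu> \<in> carrier_mat n n" for s j
    using G[of s] by auto
  have KH: "Kfun ?H s \<mu> = mat_adjoint W * Kfun G s \<mu> * V" for s
    by (simp add: reduced_system_def)
  have KHc: "Kfun ?H s \<mu> \<in> carrier_mat r r" for s
    unfolding KH using c(2)[of s] V W' by auto
  have S: "open S"
    unfolding S_def Collect_conj_eq by (intro open_Int open_mat_analytic_at open_inv_analytic_at)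
  have inv: "invertible_mat (Kfun G s \<mu>)" "invertible_mat (Kfun ?H s \<mu>)" if "s \<in> S" for s
    using that by (auto simp: S_def inv_analytic_at_def intro: eventually_nhds_x_imp_x)
  note Ki = mat_inv[OF c(2) inv(1), folded Kinv_def]
  note KHi = mat_inv[OF KHc inv(2), folded Kinv_def]
  have hKi: "holo_mat S n n (\<lambda>s. Kinv G s \<mu>)"
    by (rule holo_mat_analytic_at[OF Ki(1)]) (auto simp: S_def inv_analytic_at_def Kinv_def)
  show ?thesis
  proof
    show "open S" by (rule S)
    show "holo_mat S p n (\<lambda>s. Cfun G s \<mu>)"
      by (rule holo_mat_analytic_at[OF c(1)]) (simp add: S_def)
    show "holo_mat S n m (\<lambda>s. Bfun G s \<mu>)"
      by (rule holo_mat_analytic_at[OF c(3)]) (simp add: S_def)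
    show "holo_mat S n n (\<lambda>s. Kinv G s \<mu>)" by (rule hKi)
    show "holo_mat S n n (\<lambda>s. Nfun G (Suc j) s \<mu>)" if j: "j < m" for j
    proof (rule holo_mat_analytic_at[OF c(4)[OF j]])
      fix z assume "z \<in> S"
      then have Nh: "mat_analytic_at n (n * m) (\<lambda>s. Nhor n m G s \<mu>) z" by (simp add: S_def)
      have "(\<lambda>s. Nfun G (Suc j) s \<mu> $$ (a, b)) analytic_on {z}" if ab: "a < n" "b < n" for a b
      proof -
        \<comment> \<open>Column \<open>b\<close> of the bilinear matrix for letter \<open>j\<close>
          is column \<open>j * n + b\<close> of the horizontal concatenation.\<close>
        have jb: "j * n + b < n * m"
          using block_index_less[OF j ab(2)] by (simp add: mult.commute)
        then have "(\<lambda>s. Nhor n m G s \<mu> $$ (a, j * n + b)) analytic_on {z}"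
          using Nh ab by (simp add: mat_analytic_at_def)
        then show ?thesis using ab jb by (simp add: Nhor_def)
      qed
      then show "mat_analytic_at n n (\<lambda>s. Nfun G (Suc j) s \<mu>) z" by (simp add: mat_analytic_at_def)
    qed
    show "V \<in> carrier_mat n r" by (rule V)
    show "mat_adjoint W \<in> carrier_mat r n" by (rule W')
    \<comment> \<open>The hypotheses speak of the inverse; \<open>K\<close> itself is recovered by
      Cramer's rule.\<close>
    show "holo_mat S n n (\<lambda>s. Kfun G s \<mu>)"
      by (rule holo_mat_inverse[OF hKi c(2) Ki(2)])
    show "holo_mat S r r (\<lambda>s. Kinv ?H s \<mu>)"
      by (rule holo_mat_analytic_at[OF KHi(1)]) (auto simp: S_def inv_analytic_at_def Kinv_def)
    show "Kfun G s \<mu> * Kinv G s \<mu> = 1\<^sub>m n" "Kinv G s \<mu> * Kfun G s \<mu> = 1\<^sub>m n" if "s \<in> S" for s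
      using Ki(2,3)[OF that] .
    show "mat_adjoint W * Kfun G s \<mu> * V * Kinv ?H s \<mu> = 1\<^sub>m r"
      "Kinv ?H s \<mu> * (mat_adjoint W * Kfun G s \<mu> * V) = 1\<^sub>m r" if "s \<in> S" for s
      using KHi(2,3)[OF that] unfolding KH .
    show "m \<ge> 1" by (rule m)
    show "W \<in> carrier_mat n r" by (rule W)
  qed
qed

theorem theorem2:
  fixes n m p d r k \<theta> :: nat
    and M :: "real vec set" and \<mu> :: "real vec"
    and G :: bilinear_system
    and V W :: "complex mat"
    and \<sigma> \<tau> :: "nat \<Rightarrow> complex"
    and l \<nu> :: "nat \<Rightarrow> nat"
  defines "H \<equiv> reduced_system V W G"
  defines "spanV \<equiv> \<forall>q\<in>{1..k}. \<forall>j\<le>l q. cols_in_span n (Vmat n m G \<mu> \<sigma> l q j) V"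
    and "spanW \<equiv> \<forall>\<eta>\<in>{1..\<theta>}. \<forall>i\<le>\<nu> (\<theta> - \<eta> + 1). cols_in_span n (Wmat n m G \<mu> \<theta> \<tau> \<nu> \<eta> i) W"
  defines "interpV \<equiv> \<forall>q\<in>{1..k}. \<forall>j\<le>l q.
      mixed_deriv q (l(q := j)) (transfer_function n m G q \<mu>) \<sigma>
      = mixed_deriv q (l(q := j)) (transfer_function r m H q \<mu>) \<sigma>"
    and "interpW \<equiv> \<forall>\<eta>\<in>{1..\<theta>}. \<forall>i\<le>\<nu> (\<theta> - \<eta> + 1).
      (let js = (\<lambda>a. \<nu> (\<theta> - \<eta> + a))(1 := i);
           z = (\<lambda>a. \<tau> (\<theta> - \<eta> + a))
       in mixed_deriv \<eta> js (transfer_function n m G \<eta> \<mu>) z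
          = mixed_deriv \<eta> js (transfer_function r m H \<eta> \<mu>) z)"
    and "interpVW \<equiv> \<forall>q\<in>{1..k}. \<forall>\<eta>\<in>{1..\<theta>}. \<forall>j\<le>l q. \<forall>i\<le>\<nu> (\<theta> - \<eta> + 1).
      (let js = (\<lambda>a. if a \<le> q then l a else \<nu> (\<theta> - \<eta> + (a - q)))(q := j, q + 1 := i);
           z = (\<lambda>a. if a \<le> q then \<sigma> a else \<tau> (\<theta> - \<eta> + (a - q)))
       in mixed_deriv (q + \<eta>) js (transfer_function n m G (q + \<eta>) \<mu>) z
          = mixed_deriv (q + \<eta>) js (transfer_function r m H (q + \<eta>) \<mu>) z)"
  assumes "n \<ge> 1" and "m \<ge> 1" and "p \<ge> 1" and "d \<ge> 1" and "r \<ge> 1"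
    and "M \<subseteq> carrier_vec d" and "\<mu> \<in> M"
    and "parametric_bilinear_system n m p M G"
    and "V \<in> carrier_mat n r" and "W \<in> carrier_mat n r"
    and "k \<ge> 1" and "\<theta> \<ge> 1"
    and "\<And>z. z \<in> \<sigma> ` {1..k} \<union> \<tau> ` {1..\<theta>} \<Longrightarrow>
      mat_analytic_at p n (\<lambda>s. Cfun G s \<mu>) z \<and>
      inv_analytic_at n (\<lambda>s. Kfun G s \<mu>) z \<and>
      mat_analytic_at n (n * m) (\<lambda>s. Nhor n m G s \<mu>) z \<and>
      mat_analytic_at n m (\<lambda>s. Bfun G s \<mu>) z \<and>
      inv_analytic_at r (\<lambda>s. Kfun H s \<mu>) z"
  shows "(spanV \<longrightarrow> interpV) \<and> (spanW \<longrightarrow> interpW)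
    \<and> (spanV \<and> spanW \<longrightarrow> interpV \<and> interpW \<and> interpVW)"
proof -
  \<comment> \<open>A mixed derivative involves neighbourhoods of several points at once;
    \<open>S\<close> is one open set that contains all of them.\<close>
  define S where "S = {z. mat_analytic_at p n (\<lambda>s. Cfun G s \<mu>) z \<and> inv_analytic_at n (\<lambda>s. Kfun G s \<mu>) z
    \<and> mat_analytic_at n (n * m) (\<lambda>s. Nhor n m G s \<mu>) z \<and> mat_analytic_at n m (\<lambda>s. Bfun G s \<mu>) z
    \<and> inv_analytic_at r (\<lambda>s. Kfun H s \<mu>) z}"
  interpret reduced_bilinear_at n m p S G \<mu> r V W
    unfolding S_def H_def
    by (rule reduced_bilinear_at_analytic[OF \<open>m \<ge> 1\<close> \<open>V \<in> carrier_mat n r\<close> \<open>W \<in> carrier_mat n r\<close>])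
      (use \<open>parametric_bilinear_system n m p M G\<close> \<open>\<mu> \<in> M\<close>
        in \<open>unfold parametric_bilinear_system_def, blast\<close>)
  have points: "z \<in> S" if "z \<in> \<sigma> ` {1..k} \<union> \<tau> ` {1..\<theta>}" for z
    unfolding S_def using assms(19)[OF that] by blast
  have \<sigma>: "\<sigma> i \<in> S" if "i \<in> {1..k}" for i using that by (intro points) auto
  have \<tau>: "\<tau> i \<in> S" if "i \<in> {1..\<theta>}" for i using that by (intro points) auto
  have a: interpV if spanV
    unfolding interpV_def H_def
  proof (intro ballI allI impI)
    fix q j assume "q \<in> {1..k}" "j \<le> l q"
    then show "mixed_deriv q (l(q := j)) (transfer_function n m G q \<mu>) \<sigma>
      = mixed_deriv q (l(q := j)) (transfer_function r m Gr q \<mu>) \<sigma>"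
      using that unfolding spanV_def by (intro interpolation_right[OF \<sigma>]) blast+
  qed
  have b: interpW if spanW
    unfolding interpW_def H_def Let_def
  proof (intro ballI allI impI)
    fix \<eta> i assume "\<eta> \<in> {1..\<theta>}" "i \<le> \<nu> (\<theta> - \<eta> + 1)"
    then show "mixed_deriv \<eta> ((\<lambda>a. \<nu> (\<theta> - \<eta> + a))(1 := i)) (transfer_function n m G \<eta> \<mu>) (\<lambda>a. \<tau> (\<theta> - \<eta> + a))
      = mixed_deriv \<eta> ((\<lambda>a. \<nu> (\<theta> - \<eta> + a))(1 := i)) (transfer_function r m Gr \<eta> \<mu>) (\<lambda>a. \<tau> (\<theta> - \<eta> + a))"
      using that unfolding spanW_def by (intro interpolation_left[OF \<tau>]) blast+
  qed
  have c: interpVW if v: spanV and w: spanW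
    unfolding interpVW_def H_def Let_def
  proof (intro ballI allI impI)
    fix q \<eta> j i assume h: "q \<in> {1..k}" "\<eta> \<in> {1..\<theta>}" "j \<le> l q" "i \<le> \<nu> (\<theta> - \<eta> + 1)"
    let ?js = "(\<lambda>a. if a \<le> q then l a else \<nu> (\<theta> - \<eta> + (a - q)))(q := j, q + 1 := i)"
    let ?z = "\<lambda>a. if a \<le> q then \<sigma> a else \<tau> (\<theta> - \<eta> + (a - q))"
    show "mixed_deriv (q + \<eta>) ?js (transfer_function n m G (q + \<eta>) \<mu>) ?z
      = mixed_deriv (q + \<eta>) ?js (transfer_function r m Gr (q + \<eta>) \<mu>) ?z"
    proof (rule interpolation_two_sided[where \<theta> = \<theta> and \<nu> = \<nu> and \<tau> = \<tau>
          and k = k and l = l and \<sigma> = \<sigma>, OF \<tau> _ \<sigma> _ h(1,3,2,4)])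
      show "cols_in_span n (Wmat n m G \<mu> \<theta> \<tau> \<nu> \<eta> i) W" if "\<eta> \<in> {1..\<theta>}" "i \<le> \<nu> (\<theta> - \<eta> + 1)" for \<eta> i
        using w that unfolding spanW_def by blast
      show "cols_in_span n (Vmat n m G \<mu> \<sigma> l q j) V" if "q \<in> {1..k}" "j \<le> l q" for q j
        using v that unfolding spanV_def by blast
    qed
  qed
  show ?thesis using a b c by blast
qed

end
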